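(* Let $N\in\mathbb{N}$, $\xi$ a Dirichlet character modulo $N$, $k$ a positive integer with $\xi(-1)=(-1)^k$, and $\{f_n\}_{n\ge1},\{g_n\}_{n\ge1}$ complex sequences with $f_n,g_n=O(n^\sigma)$ for some $\sigma>0$. Suppose that for every $q\in\mathbb{N}$ with $(q,N)=1$, $\Lambda_f(s,c_q)$ and $\Lambda_g(s,c_q)$ continue to entire functions of finite order and satisfy $\Lambda_f(s,c_q)=i^k\xi(q)(Nq^2)^{\frac12-s}\Lambda_g(1-s,c_q)$. Let $f(z)=\sum_{n\ge1}f_ne(nz)$. Suppose moreover that there is a congruence subgroup $H\le\Gamma_0(N)$ such that $|(f|\gamma)(z)|=|f(z)|$ for all $\gamma\in H$ and all $z\in\mathbb{H}$. Then $f\in M_k(\Gamma_0(N),\xi)$.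
   Context: $e(x):=e^{2\pi i x}$; $c_q(n)=\sum_{a \bmod q,\,(a,q)=1}e(an/q)$ is the Ramanujan sum; $\Gamma_\mathbb{C}(s):=2(2\pi)^{-s}\Gamma(s)$; for $\Re(s)>\sigma+1-\frac{k-1}2$, $\Lambda_f(s,c_q)=\Gamma_\mathbb{C}(s+\frac{k-1}2)\sum_{n\ge1}f_nc_q(n)n^{-s-\frac{k-1}2}$ and similarly $\Lambda_g(s,c_q)$ with $g_n$ in place of $f_n$. $\mathbb{H}$ is the upper half-plane; for $h:\mathbb{H}\to\mathbb{C}$ and $\gamma=\begin{pmatrix}a&b\\c&d\end{pmatrix}\in\mathrm{GL}_2^+(\mathbb{R})$, $h|\gamma(z)=(\det\gamma)^{k/2}(cz+d)^{-k}h\big(\frac{az+b}{cz+d}\big)$. $M_k(\Gamma_0(N),\xi)$ is the space of holomorphic modular forms of weight $k$, level $N$, nebentypus $\xi$. *)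

theory Defs
  imports "HOL-Analysis.Analysis"
begin

definition ee :: "complex \<Rightarrow> complex" where
  "ee x = exp (2 * pi * \<i> * x)"

definition ramanujan_sum :: "nat \<Rightarrow> nat \<Rightarrow> complex" where
  "ramanujan_sum q n = (\<Sum>a\<in>{a. 1 \<le> a \<and> a \<le> q \<and> coprime a q}. ee (of_nat (a * n) / of_nat q))"

definition GammaC :: "complex \<Rightarrow> complex" where
  "GammaC s = 2 * (of_real (2 * pi)) powr (- s) * Gamma s"

definition dirichlet_character :: "nat \<Rightarrow> (int \<Rightarrow> complex) \<Rightarrow> bool" where
  "dirichlet_character N chi \<longleftrightarrow> N > 0 \<and>
     (\<forall>m n. chi (m * n) = chi m * chi n) \<and>
     (\<forall>n. chi (n + int N) = chi n) \<and>
     (\<forall>n. chi n \<noteq> 0 \<longleftrightarrow> coprime n (int N))"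

definition Lambda_tw :: "nat \<Rightarrow> (nat \<Rightarrow> complex) \<Rightarrow> nat \<Rightarrow> complex \<Rightarrow> complex" where
  "Lambda_tw k a q s = GammaC (s + (of_nat k - 1) / 2) *
     (\<Sum>n. a (Suc n) * ramanujan_sum q (Suc n) * (of_nat (Suc n)) powr (- s - (of_nat k - 1) / 2))"

definition entire_finite_order :: "(complex \<Rightarrow> complex) \<Rightarrow> bool" where
  "entire_finite_order F \<longleftrightarrow> F holomorphic_on UNIV \<and>
     (\<exists>\<rho> A. \<forall>z. norm (F z) \<le> A * exp (norm z powr \<rho>))"

definition qexp :: "(nat \<Rightarrow> complex) \<Rightarrow> complex \<Rightarrow> complex" where
  "qexp a z = (\<Sum>n. a (Suc n) * ee (of_nat (Suc n) * z))"

definition upper_half_plane :: "complex set" where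
  "upper_half_plane = {z. Im z > 0}"

type_synonym imat = "int ^ 2 ^ 2"

definition ma :: "imat \<Rightarrow> int" where "ma g = g $ 1 $ 1"
definition mb :: "imat \<Rightarrow> int" where "mb g = g $ 1 $ 2"
definition mc :: "imat \<Rightarrow> int" where "mc g = g $ 2 $ 1"
definition md :: "imat \<Rightarrow> int" where "md g = g $ 2 $ 2"

definition SL2Z :: "imat set" where
  "SL2Z = {g. det g = 1}"

definition Gamma0 :: "nat \<Rightarrow> imat set" where
  "Gamma0 N = {g \<in> SL2Z. int N dvd mc g}"

definition principal_congruence :: "nat \<Rightarrow> imat set" where
  "principal_congruence M = {g \<in> SL2Z. (ma g - 1) mod int M = 0 \<and> (mb g - 0) mod int M = 0
      \<and> (mc g - 0) mod int M = 0 \<and> (md g - 1) mod int M = 0}"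

definition sl2_inv :: "imat \<Rightarrow> imat" where
  "sl2_inv g = (\<chi> i j. if i = 1 \<and> j = 1 then md g else if i = 1 \<and> j = 2 then - mb g
                       else if i = 2 \<and> j = 1 then - mc g else ma g)"

definition congruence_subgroup :: "imat set \<Rightarrow> bool" where
  "congruence_subgroup H \<longleftrightarrow> H \<subseteq> SL2Z \<and> mat 1 \<in> H \<and>
     (\<forall>g\<in>H. \<forall>h\<in>H. g ** h \<in> H) \<and> (\<forall>g\<in>H. sl2_inv g \<in> H) \<and>
     (\<exists>M>0. principal_congruence M \<subseteq> H)"

definition slash :: "nat \<Rightarrow> (complex \<Rightarrow> complex) \<Rightarrow> imat \<Rightarrow> complex \<Rightarrow> complex" where
  "slash k h g z = of_real (real_of_int (det g) powr (real k / 2)) *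
     (of_int (mc g) * z + of_int (md g)) powi (- int k) *
     h ((of_int (ma g) * z + of_int (mb g)) / (of_int (mc g) * z + of_int (md g)))"

text \<open>Holomorphic modular forms of weight k, level N, nebentypus xi:
  holomorphic on H, (h|g) = xi(d) h for g in Gamma0(N), and holomorphic at all cusps
  (h|g bounded on Im z >= 1 for every g in SL2(Z)).\<close>
definition modular_form :: "nat \<Rightarrow> nat \<Rightarrow> (int \<Rightarrow> complex) \<Rightarrow> (complex \<Rightarrow> complex) \<Rightarrow> bool" where
  "modular_form k N \<xi> h \<longleftrightarrow> h holomorphic_on upper_half_plane \<and>
     (\<forall>g\<in>Gamma0 N. \<forall>z\<in>upper_half_plane. slash k h g z = \<xi> (md g) * h z) \<and>
     (\<forall>g\<in>SL2Z. \<exists>C. \<forall>z. Im z \<ge> 1 \<longrightarrow> norm (slash k h g z) \<le> C)"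

end

theory Submission
  imports Defs "HOL-Complex_Analysis.Complex_Analysis" "HOL-Number_Theory.Number_Theory"
    "HOL-Computational_Algebra.Squarefree" "HOL-Real_Asymp.Real_Asymp"
begin

text \<open>
  By Hecke's argument the functional equations say
  \<open>f\<^sub>q(z) = (-1)\<^sup>k \<xi>(q) (\<surd>N q z)\<^sup>-\<^sup>k g\<^sub>q(-1/(N q\<^sup>2 z))\<close>, where \<open>f\<^sub>q(z)\<close> is the sum of \<open>f(z + a/q)\<close>
  over the units \<open>a\<close> modulo \<open>q\<close>; the case \<open>q = 1\<close> makes \<open>f\<close> invariant under \<open>T : z \<mapsto> z + 1\<close> and
  \<open>U : z \<mapsto> z / (N z + 1)\<close>. On \<open>H\<close> the form \<open>f\<close> transforms by a unitary character, by the maximum principle;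
  since \<open>T\<close> and \<open>U\<close> generate \<open>\<Gamma>\<^sub>1(N)\<close> modulo every principal congruence subgroup, so it does on \<open>\<Gamma>\<^sub>1(N)\<close>.

  For \<open>\<gamma>\<^sub>a \<in> \<Gamma>\<^sub>1(N)\<close> with right column \<open>(a, q)\<close> and lower left entry \<open>N c\<^sub>a\<close> the equation for \<open>q\<close> becomes
  \<open>\<Sum> (\<chi>(\<gamma>\<^sub>a) - 1) g(w + c\<^sub>a/q) = 0\<close>. Averaging over \<open>w + j/q\<close> gives \<open>\<Sum> (\<chi>(\<gamma>\<^sub>a) - 1) = 0\<close>, hence \<open>\<chi>(\<gamma>\<^sub>a) = 1\<close>
  by unitarity, unless all \<open>g\<^sub>n\<close> with \<open>q | n\<close> vanish. For squarefree \<open>q\<close> that cannot happen: it would give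
  a linear relation between the functions \<open>f\<^sub>r(w / r\<^sup>2)\<close>, \<open>r | q\<close>, whose leading term has coefficient
  \<open>f\<^sub>n c\<^sub>q(n) \<noteq> 0\<close>, \<open>n\<close> minimal. Every element of \<open>\<Gamma>\<^sub>1(N)\<close> becomes one with squarefree lower right entry after
  multiplication by powers of \<open>T\<close> and \<open>U\<close>, because reduced residue classes contain squarefree numbers; so \<open>\<chi> = 1\<close>.
  Finally the equations for primes \<open>p\<close> give \<open>f|\<gamma> = \<xi>(p) f\<close> for \<open>\<gamma> \<in> \<Gamma>\<^sub>0(N)\<close> with lower right entry \<open>p\<close>,
  and primes generate the units modulo \<open>N\<close>.
\<close>

subsection \<open>Mellin transforms on the unit interval\<close>

text \<open>Twisting by \<open>c_q\<close> controls only the sum of F(z + a/q) over all units a and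
  gives no equation for a single a. The relation for q is one linear equation in as many unknown
  scalars as there are units, and the two ways of solving it shape the proof. On \<Gamma>_1(N) the
  scalars lie on the unit circle, so a vanishing sum of y_a - 1 determines each of them; this is
  where the hypothesis on H enters. For a prime lower right entry p outside \<Gamma>_1(N) unitarity
  does not single out a value. But once \<Gamma>_1(N) acts trivially, the functions F|\<gamma>_a all
  coincide, and a periodic function whose translates by a/p, 1 \<le> a < p, always sum to 0 must
  vanish, because only one class modulo p is missing. Squarefreeness ensures that c_q(n) is nonzero
  for every n. The equation for q = 1 makes G the Fricke transform of F, which turns U into a
  translation; the nonvanishing for G is read off from the coefficients of f by reversing the
  equations.\<close>

definition mellin01 :: "(real \<Rightarrow> complex) \<Rightarrow> complex \<Rightarrow> complex" where
  "mellin01 \<alpha> s = integral {0..1} (\<lambda>u. \<alpha> u * of_real u powr (s - 1))"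

text \<open>\<open>K\<close> may be negative: \<open>dominated01 C (- m) \<alpha>\<close> for large
  m expresses vanishing of order m at 0, and the half plane Re s > K + 2 on which the Mellin
  transform is shown to be holomorphic then moves to the left.\<close>

definition dominated01 :: "real \<Rightarrow> real \<Rightarrow> (real \<Rightarrow> complex) \<Rightarrow> bool" where
  "dominated01 C K \<alpha> \<longleftrightarrow> continuous_on {0<..1} \<alpha> \<and> C \<ge> 0 \<and> (\<forall>u\<in>{0<..1}. norm (\<alpha> u) \<le> C * u powr (- K))"

lemma mellin01_integrand_bound:
  assumes "dominated01 C K \<alpha>" "u \<in> {0..1}" "Re s \<ge> K + 1 + real m"
  shows "norm (\<alpha> u * of_real u powr (s - 1)) \<le> C * u ^ m"
proof (cases "u = 0")
  case True
  then show ?thesis using assms by (auto simp: dominated01_def)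
next
  case False
  then have u: "0 < u" "u \<le> 1" using assms by auto
  have "norm (\<alpha> u * of_real u powr (s - 1)) = norm (\<alpha> u) * u powr (Re s - 1)"
    using u by (simp add: norm_mult norm_powr_real_powr)
  also have "\<dots> \<le> (C * u powr (- K)) * u powr (Re s - 1)"
    using assms u by (intro mult_right_mono) (auto simp: dominated01_def)
  also have "\<dots> = C * u powr (Re s - 1 - K)"
    by (simp add: powr_add[symmetric] algebra_simps)
  also have "\<dots> \<le> C * u powr (real m)"
    using assms u by (intro mult_left_mono powr_mono') (auto simp: dominated01_def)
  finally show ?thesis using u by (simp add: powr_realpow)
qed

lemma continuous_on_mellin01_integrand:
  assumes "dominated01 C K \<alpha>" "Re s \<ge> K + 2"
  shows "continuous_on {0..1} (\<lambda>u. \<alpha> u * of_real u powr (s - 1))"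
proof -
  let ?h = "\<lambda>u. \<alpha> u * of_real u powr (s - 1)"
  have c: "continuous_on {0<..1} ?h"
    using assms(1) unfolding dominated01_def by (auto intro!: continuous_intros)
  have "continuous (at u within {0..1}) ?h" if u: "u \<in> {0..1}" for u
  proof (cases "u = 0")
    case False
    then have "u \<in> {0<..1}" using u by auto
    with c have "continuous (at u within {0<..1}) ?h"
      by (simp add: continuous_on_eq_continuous_within)
    moreover have "at u within {0<..1} = at u within {0..1}"
      by (rule at_within_nhd[of _ "{0<..}"]) (use \<open>u \<in> {0<..1}\<close> in auto)
    ultimately show ?thesis by simp
  next
    case True
    \<comment> \<open>The value of the integrand at 0 is 0 by the convention
      \<open>0 powr w = 0\<close>, and this is also its limit.\<close>
    have "((\<lambda>u. ?h u) \<longlongrightarrow> 0) (at 0 within {0..1})"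
    proof (rule Lim_null_comparison)
      show "\<forall>\<^sub>F x in at 0 within {0..1}. norm (?h x) \<le> C * x ^ 1"
        unfolding eventually_at
        by (rule exI[of _ 1], intro conjI ballI impI mellin01_integrand_bound[OF assms(1)])
           (use assms(2) in auto)
      have "continuous_on {0..1} (\<lambda>x::real. C * x ^ 1)" by (intro continuous_intros)
      then show "((\<lambda>x::real. C * x ^ 1) \<longlongrightarrow> 0) (at 0 within {0..1})"
        by (force simp: continuous_on_def)
    qed
    then show ?thesis using True by (simp add: continuous_within)
  qed
  then show ?thesis by (simp add: continuous_on_eq_continuous_within)
qed

text \<open>For fixed \<open>C\<close> and \<open>K\<close> the bound tends to 0 as Re s grows; this
  later forces a constant function to be 0.\<close>

lemma norm_mellin01_le:
  assumes "dominated01 C K \<alpha>" "Re s \<ge> K + 2 + real m"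
  shows "norm (mellin01 \<alpha> s) \<le> C / (real m + 1)"
proof -
  have "((\<lambda>u::real. u ^ Suc m / real (Suc m)) has_real_derivative u ^ m) (at u within {0..1})" for u
    by (rule DERIV_cong, (rule derivative_intros)+) auto
  then have i: "((\<lambda>u::real. C * u ^ m) has_integral (C * (1 ^ Suc m / (Suc m) - 0 ^ Suc m / (Suc m)))) {0..1}"
    by (intro has_integral_mult_right fundamental_theorem_of_calculus)
       (auto simp: has_real_derivative_iff_has_vector_derivative[symmetric] simp del: of_nat_Suc)
  have "norm (integral {0..1} (\<lambda>u. \<alpha> u * of_real u powr (s - 1))) \<le> integral {0..1} (\<lambda>u. C * u ^ m)"
    by (rule integral_norm_bound_integral)
       (use i assms in \<open>auto intro!: mellin01_integrand_bound[OF assms(1)] integrable_continuous_real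
          continuous_on_mellin01_integrand[OF assms(1)] simp: has_integral_integrable\<close>)
  also have "\<dots> = C / (real m + 1)" using integral_unique[OF i] by (simp add: field_simps)
  finally show ?thesis by (simp add: mellin01_def)
qed

text \<open>On [1/(n+1), 1] differentiation under the integral applies. The part cut off at 0
  contributes at most C/(n+1), uniformly in s, so holomorphy passes to the limit.\<close>

lemma holomorphic_mellin01:
  assumes d: "dominated01 C K \<alpha>"
  shows "mellin01 \<alpha> holomorphic_on {s. Re s > K + 2}"
proof (rule holomorphic_uniform_sequence)
  show "open {s. Re s > K + 2}" by (simp add: open_halfspace_Re_gt)
next
  fix n :: nat
  let ?a = "1 / real (Suc n)"
  have "(\<lambda>s. integral (cbox ?a 1) (\<lambda>u. \<alpha> u * of_real u powr (s - 1))) holomorphic_on {s. Re s > K + 2}"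
  proof (rule leibniz_rule_holomorphic)
    fix s :: complex and u :: real
    assume "u \<in> cbox ?a 1"
    then have "u > 0" by (auto intro: less_le_trans[rotated])
    then show "((\<lambda>s. \<alpha> u * of_real u powr (s - 1)) has_field_derivative
                 \<alpha> u * (of_real u powr (s - 1) * of_real (ln u))) (at s within {s. Re s > K + 2})"
      by (intro DERIV_cmult DERIV_cong[OF DERIV_chain2[OF has_field_derivative_powr_right]])
         (auto intro!: derivative_eq_intros simp: Ln_of_real)
  next
    fix s :: complex
    show "(\<lambda>u. \<alpha> u * of_real u powr (s - 1)) integrable_on cbox ?a 1" if "s \<in> {s. Re s > K + 2}"
      using that
      by (intro integrable_continuous continuous_on_subset[OF continuous_on_mellin01_integrand[OF d]]) auto
  next
    have pos: "0 < u" if "inverse (1 + real n) \<le> u" for u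
      using that by (smt (verit) inverse_positive_iff_positive of_nat_0_le_iff)
    have "continuous_on (UNIV \<times> {?a..1}) (\<lambda>p::complex \<times> real. \<alpha> (snd p))"
      by (rule continuous_on_compose2[of "{0<..1}" \<alpha>])
         (use d pos in \<open>auto simp: dominated01_def field_simps intro!: continuous_intros\<close>)
    then have "continuous_on ({s. Re s > K + 2} \<times> {?a..1}) (\<lambda>p::complex \<times> real. \<alpha> (snd p))"
      by (rule continuous_on_subset) auto
    then show "continuous_on ({s. Re s > K + 2} \<times> cbox ?a 1)
            (\<lambda>(s, u). \<alpha> u * (of_real u powr (s - 1) * of_real (ln u)))"
      unfolding case_prod_unfold
      by (intro continuous_intros) (use pos in \<open>force simp: divide_simps\<close>)+
  qed (simp add: convex_halfspace_Re_gt)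
  then show "(\<lambda>s. integral {?a..1} (\<lambda>u. \<alpha> u * of_real u powr (s - 1))) holomorphic_on {s. Re s > K + 2}"
    by simp
next
  fix s assume "s \<in> {s. Re s > K + 2}"
  then obtain e where e: "e > 0" "cball s e \<subseteq> {s. Re s > K + 2}"
    using open_contains_cball_eq[OF open_halfspace_Re_gt[of "K+2"]] by blast
  have "uniform_limit {s. Re s > K + 2}
          (\<lambda>n s. integral {1 / real (Suc n)..1} (\<lambda>u. \<alpha> u * of_real u powr (s - 1))) (mellin01 \<alpha>) sequentially"
  proof (rule uniform_limitI)
    fix \<epsilon> :: real assume "\<epsilon> > 0"
    have "(\<lambda>n. C * inverse (real (Suc n))) \<longlonglongrightarrow> C * 0"
      by (intro tendsto_intros LIMSEQ_inverse_real_of_nat)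
    then have "\<forall>\<^sub>F n in sequentially. C * inverse (real (Suc n)) < \<epsilon>"
      using \<open>\<epsilon> > 0\<close> by (auto dest: order_tendstoD)
    then show "\<forall>\<^sub>F n in sequentially. \<forall>s\<in>{s. Re s > K + 2}.
        dist (integral {1 / real (Suc n)..1} (\<lambda>u. \<alpha> u * of_real u powr (s - 1))) (mellin01 \<alpha> s) < \<epsilon>"
    proof eventually_elim
      case (elim n)
      show ?case
      proof
        fix s assume s: "s \<in> {s. Re s > K + 2}"
        let ?h = "\<lambda>u. \<alpha> u * of_real u powr (s - 1)" and ?a = "1 / real (Suc n)"
        have c: "continuous_on {0..1} ?h" using continuous_on_mellin01_integrand[OF d] s by auto
        have aux: "y - z = - x" if "x + y = z" for x y z :: complex
          using that by auto
        have a: "0 \<le> ?a" "?a \<le> 1" by (auto simp: divide_simps)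
        have "integral {0..?a} ?h + integral {?a..1} ?h = integral {0..1} ?h"
          using a c by (intro Henstock_Kurzweil_Integration.integral_combine integrable_continuous_real) auto
        then have "integral {?a..1} ?h - mellin01 \<alpha> s = - integral {0..?a} ?h"
          unfolding mellin01_def by (rule aux)
        then have "norm (integral {?a..1} ?h - mellin01 \<alpha> s) = norm (integral {0..?a} ?h)"
          by (simp only: norm_minus_cancel)
        also have "\<dots> \<le> C * (?a - 0)"
        proof (rule integral_bound)
          show "continuous_on {0..?a} ?h" using c a by (elim continuous_on_subset) auto
          fix u assume "u \<in> {0..?a}"
          then have "u \<in> {0..1}" using a by (meson atLeastAtMost_iff order_trans)
          then show "norm (?h u) \<le> C"
            using mellin01_integrand_bound[OF d, where u=u and s=s and m=0] s by auto
        qed (use a in auto)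
        finally show "dist (integral {?a..1} ?h) (mellin01 \<alpha> s) < \<epsilon>"
          using elim by (simp add: dist_norm divide_inverse)
      qed
    qed
  qed
  then show "\<exists>d>0. cball s d \<subseteq> {s. K + 2 < Re s} \<and> uniform_limit (cball s d)
          (\<lambda>n s. integral {1 / real (Suc n)..1} (\<lambda>u. \<alpha> u * of_real u powr (s - 1))) (mellin01 \<alpha>) sequentially"
    using e uniform_limit_on_subset by blast
qed

text \<open>Vanishing moments make h orthogonal to the polynomials that approximate it, so the
  integral of h^2 is 0.\<close>

lemma continuous_moments_zero_real:
  fixes h :: "real \<Rightarrow> real"
  assumes c: "continuous_on {0..1} h" and m: "\<And>m. integral {0..1} (\<lambda>u. h u * u ^ m) = 0" and "x \<in> {0..1}"
  shows "h x = 0"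
proof -
  have ih: "(\<lambda>u. h u * u ^ m) integrable_on {0..1}" for m
    using c by (intro integrable_continuous_real continuous_intros) auto
  have poly: "integral {0..1} (\<lambda>u. h u * p u) = 0" if "real_polynomial_function p" for p
  proof -
    obtain a n where p: "p = (\<lambda>x. \<Sum>i\<le>n. a i * x ^ i)"
      using \<open>real_polynomial_function p\<close> real_polynomial_function_iff_sum by blast
    have "integral {0..1} (\<lambda>u. h u * p u) = integral {0..1} (\<lambda>u. \<Sum>i\<le>n. a i * (h u * u ^ i))"
      by (simp add: p sum_distrib_left mult_ac)
    also have "\<dots> = (\<Sum>i\<le>n. a i * integral {0..1} (\<lambda>u. h u * u ^ i))"
      by (subst integral_sum) (auto intro!: integrable_on_mult_right ih)
    finally show ?thesis using m by simp
  qed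
  have ch2: "continuous_on {0..1} (\<lambda>u. h u * h u)" using c by (intro continuous_intros)
  have z: "integral {0..1} (\<lambda>u. h u * h u) = 0"
  proof (rule ccontr)
    assume "integral {0..1} (\<lambda>u. h u * h u) \<noteq> 0"
    then have I: "\<bar>integral {0..1} (\<lambda>u. h u * h u)\<bar> > 0" (is "\<bar>?I\<bar> > 0") by simp
    have "compact (h ` {0..1})" using c by (intro compact_continuous_image) auto
    then obtain B where B: "\<And>u. u \<in> {0..1} \<Longrightarrow> \<bar>h u\<bar> \<le> B"
      by (metis bounded_real compact_imp_bounded imageI)
    have "B \<ge> 0" using B[of 0] by auto
    \<comment> \<open>With |h| \<le> B the approximation error is at most \<open>B * e\<close>, less
      than the integral in question; the \<open>+ 1\<close> covers B = 0.\<close>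
    define e where "e = \<bar>?I\<bar> / (2 * (B + 1))"
    have "e > 0" using I \<open>B \<ge> 0\<close> by (simp add: e_def)
    obtain p where p: "real_polynomial_function p" "\<And>u. u \<in> {0..1} \<Longrightarrow> \<bar>h u - p u\<bar> < e"
      using Stone_Weierstrass_real_polynomial_function[of "{0..1::real}" h e] c \<open>e > 0\<close> by auto
    have cp: "continuous_on {0..1} p"
      using p(1) by (simp add: continuous_on_polymonial_function real_polynomial_function_eq)
    have "?I = ?I - integral {0..1} (\<lambda>u. h u * p u)" using poly[OF p(1)] by simp
    also have "\<dots> = integral {0..1} (\<lambda>u. h u * h u - h u * p u)"
      by (rule integral_diff[symmetric]) (auto intro!: integrable_continuous_real continuous_intros c cp)
    also have "\<dots> = integral {0..1} (\<lambda>u. h u * (h u - p u))" by (simp add: algebra_simps)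
    finally have "\<bar>?I\<bar> = norm (integral {0..1} (\<lambda>u. h u * (h u - p u)))" by simp
    also have "\<dots> \<le> (B * e) * (1 - 0)"
      by (rule integral_bound)
         (use c cp B p(2) \<open>B \<ge> 0\<close> in \<open>auto intro!: continuous_intros mult_mono simp: abs_mult less_imp_le\<close>)
    also have "\<dots> < \<bar>?I\<bar>" using I \<open>B \<ge> 0\<close> by (simp add: e_def divide_simps)
    finally show False by simp
  qed
  have "h x * h x = 0"
  proof (rule integral_cbox_eq_0_iff[THEN iffD1, rule_format, of 0 1 "\<lambda>u. h u * h u"])
    show "integral (cbox 0 1) (\<lambda>u. h u * h u) = 0" using z by simp
  qed (use ch2 assms in auto)
  then show ?thesis by simp
qed

lemma continuous_moments_zero:
  fixes h :: "real \<Rightarrow> complex"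
  assumes c: "continuous_on {0..1} h" and m: "\<And>m. integral {0..1} (\<lambda>u. h u * of_real u ^ m) = 0" and x: "x \<in> {0..1}"
  shows "h x = 0"
proof -
  have i: "(\<lambda>u. h u * of_real u ^ m) integrable_on {0..1}" for m
    using c by (intro integrable_continuous_real continuous_intros) auto
  have "integral {0..1} (\<lambda>u. Re (h u) * u ^ m) = 0" for m
    using integral_linear[OF i[of m] bounded_linear_Re] m[of m]
    by (simp add: o_def flip: of_real_power)
  moreover have "integral {0..1} (\<lambda>u. Im (h u) * u ^ m) = 0" for m
    using integral_linear[OF i[of m] bounded_linear_Im] m[of m]
    by (simp add: o_def flip: of_real_power)
  ultimately have "Re (h x) = 0" "Im (h x) = 0"
    using x c by (auto intro!: continuous_moments_zero_real[of "\<lambda>u. Re (h u)"]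
       continuous_moments_zero_real[of "\<lambda>u. Im (h u)"] continuous_intros)
  then show ?thesis by (simp add: complex_eq_iff)
qed

subsection \<open>The Phragmen-Lindelof principle and Hecke inversion\<close>

text \<open>The growth that finite order permits is beaten by the doubly exponential decay of the
  damping factor used in \<open>phragmen_lindelof_strip\<close>.\<close>

lemma exp_power_double_exp_tendsto_0:
  fixes A c \<eta> q \<delta> :: real
  assumes "\<eta> > 0" "q > 0" "\<delta> > 0"
  shows "((\<lambda>T. A * exp ((T + c) ^ m) * exp (- \<eta> * (q * cosh (\<delta> * T)))) \<longlongrightarrow> 0) at_top"
proof (rule Lim_null_comparison)
  show "((\<lambda>T. \<bar>A\<bar> * exp ((T + c) ^ m - \<eta> * (q * exp (\<delta> * T) / 2))) \<longlongrightarrow> 0) at_top"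
    using assms by real_asymp
  have "\<eta> * (q * exp (\<delta> * T) / 2) \<le> \<eta> * (q * cosh (\<delta> * T))" for T
    using assms by (simp add: cosh_field_def)
  then have "exp ((T + c) ^ m) * exp (- \<eta> * (q * cosh (\<delta> * T))) \<le> exp ((T + c) ^ m - \<eta> * (q * exp (\<delta> * T) / 2))" for T
    by (smt (verit) exp_add exp_le_cancel_iff mult_minus_left)
  then show "\<forall>\<^sub>F T in at_top. norm (A * exp ((T + c) ^ m) * exp (- \<eta> * (q * cosh (\<delta> * T))))
      \<le> \<bar>A\<bar> * exp ((T + c) ^ m - \<eta> * (q * exp (\<delta> * T) / 2))"
    by (intro always_eventually allI) (simp add: abs_mult mult_left_mono mult.assoc)
qed

text \<open>The function is multiplied by exp(-\<eta> cos(s/R)). In the strip |Re(s/R)| \<le> 1 <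
  \<pi>/2, so the real part of the cosine is at least cos 1 * cosh(Im s/R) > 0. The maximum
  principle on a tall rectangle gives B + \<epsilon> for every \<epsilon>; then \<eta> tends to
  0.\<close>

lemma phragmen_lindelof_strip:
  assumes holo: "E holomorphic_on UNIV" and R: "R > 0"
    and edge: "\<And>s. \<bar>Re s\<bar> = R \<Longrightarrow> norm (E s) \<le> B"
    and growth: "\<And>s. \<bar>Re s\<bar> \<le> R \<Longrightarrow> norm (E s) \<le> A * exp ((\<bar>Im s\<bar> + c) ^ m)"
    and s: "\<bar>Re s\<bar> \<le> R"
  shows "norm (E s) \<le> B"
proof -
  define \<delta> where "\<delta> = 1 / R"
  have "\<delta> > 0" using R by (simp add: \<delta>_def)
  define k where "k = (\<lambda>\<eta> s. exp (- of_real \<eta> * cos (of_real \<delta> * s :: complex)))"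
  have nk: "norm (k \<eta> s) = exp (- \<eta> * (cos (\<delta> * Re s) * cosh (\<delta> * Im s)))" for \<eta> s
    by (simp add: k_def Re_cos cosh_def algebra_simps)
  have cos1: "cos (\<delta> * x) \<ge> cos 1" if "\<bar>x\<bar> \<le> R" for x
  proof -
    have "\<bar>\<delta> * x\<bar> \<le> 1" using that R by (simp add: \<delta>_def abs_mult divide_simps)
    then have "cos 1 \<le> cos \<bar>\<delta> * x\<bar>" using pi_gt3 by (intro cos_monotone_0_pi_le) auto
    then show ?thesis by simp
  qed
  have cos1p: "cos (1::real) > 0" using cos_gt_zero[of 1] pi_gt3 by linarith
  have B0: "B \<ge> 0" using order_trans[OF norm_ge_zero edge[of "of_real R"]] R by simp
  have key: "norm (E s) * norm (k \<eta> s) \<le> B" if \<eta>: "\<eta> > 0" for \<eta>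
  proof -
    have "((\<lambda>T. A * exp ((T + c) ^ m) * exp (- \<eta> * (cos 1 * cosh (\<delta> * T)))) \<longlongrightarrow> 0) at_top"
      by (rule exp_power_double_exp_tendsto_0[OF \<eta> cos1p \<open>\<delta> > 0\<close>])
    from order_tendstoD(2)[OF this] have lim: "\<forall>\<^sub>F T in at_top. A * exp ((T + c) ^ m) * exp (- \<eta> * (cos 1 * cosh (\<delta> * T))) \<le> B + \<epsilon>"
      if "\<epsilon> > 0" for \<epsilon>
      by (rule eventually_mono) (use that B0 in auto)
    have "norm (E s) * norm (k \<eta> s) \<le> B + \<epsilon>" if "\<epsilon> > 0" for \<epsilon>
    proof -
      obtain T where T: "T \<ge> \<bar>Im s\<bar> + 1" "A * exp ((T + c) ^ m) * exp (- \<eta> * (cos 1 * cosh (\<delta> * T))) \<le> B + \<epsilon>"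
        using eventually_conj[OF lim[OF \<open>\<epsilon> > 0\<close>] eventually_ge_at_top[of "\<bar>Im s\<bar> + 1"]]
        by (auto dest: eventually_happens)
      let ?S = "cbox (Complex (- R) (- T)) (Complex R T)"
      have "norm (E s * k \<eta> s) \<le> B + \<epsilon>"
      proof (rule maximum_modulus_frontier[where S = ?S and f = "\<lambda>s. E s * k \<eta> s"])
        have h: "(\<lambda>s. E s * k \<eta> s) holomorphic_on UNIV"
          unfolding k_def by (intro holomorphic_intros holo)
        then show "(\<lambda>s. E s * k \<eta> s) holomorphic_on interior ?S" "continuous_on (closure ?S) (\<lambda>s. E s * k \<eta> s)"
          by (auto intro: holomorphic_on_subset holomorphic_on_imp_continuous_on)
        show "s \<in> ?S" using s T by (auto simp: in_cbox_complex_iff)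
        fix z assume z: "z \<in> frontier ?S"
        then have zR: "\<bar>Re z\<bar> \<le> R" and zz: "\<bar>Re z\<bar> = R \<or> \<bar>Im z\<bar> = T"
          by (auto simp: frontier_cbox in_cbox_complex_iff in_box_complex_iff)
        have cn: "cos (\<delta> * Re z) \<ge> cos 1" using cos1 zR by blast
        then have "norm (k \<eta> z) \<le> exp (- \<eta> * (cos 1 * cosh (\<delta> * Im z)))"
          unfolding nk using \<eta> by (simp add: mult_right_mono)
        moreover have "norm (k \<eta> z) \<le> 1"
          unfolding nk using \<eta> cn cos1p by (simp add: mult_nonneg_nonneg)
        ultimately consider "\<bar>Re z\<bar> = R" "norm (k \<eta> z) \<le> 1"
          | "\<bar>Im z\<bar> = T" "norm (k \<eta> z) \<le> exp (- \<eta> * (cos 1 * cosh (\<delta> * Im z)))"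
          using zz by blast
        then show "norm (E z * k \<eta> z) \<le> B + \<epsilon>"
        proof cases
          case 1
          then have "norm (E z) * norm (k \<eta> z) \<le> B * 1" using edge[OF 1(1)] B0 by (intro mult_mono) auto
          then show ?thesis using \<open>\<epsilon> > 0\<close> by (simp add: norm_mult)
        next
          case 2
          have "cosh (\<delta> * Im z) = cosh (\<delta> * T)"
            using 2(1) by (metis abs_if cosh_minus mult_minus_right)
          with 2 have "norm (E z) * norm (k \<eta> z) \<le> (A * exp ((T + c) ^ m)) * exp (- \<eta> * (cos 1 * cosh (\<delta> * T)))"
            using growth[OF zR] by (intro mult_mono) (auto intro: order_trans[OF norm_ge_zero])
          then show ?thesis using T(2) by (simp add: norm_mult)
        qed
      qed auto
      then show ?thesis by (simp add: norm_mult)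
    qed
    then show ?thesis by (rule field_le_epsilon)
  qed
  have "((\<lambda>\<eta>. norm (E s) * norm (k \<eta> s)) \<longlongrightarrow> norm (E s) * exp (- 0 * (cos (\<delta> * Re s) * cosh (\<delta> * Im s)))) (at_right 0)"
    unfolding nk by (intro tendsto_intros)
  then have "norm (E s) * exp (- 0 * (cos (\<delta> * Re s) * cosh (\<delta> * Im s))) \<le> B"
    by (rule tendsto_upperbound) (auto intro: eventually_mono[OF eventually_at_right_less] key)
  then show ?thesis by simp
qed

text \<open>A single term of the exponential series bounds exp x from below.\<close>

lemma exp_minus_le_power:
  fixes x :: real
  assumes "x > 0"
  shows "exp (- x) \<le> fact m / x ^ m"
proof -
  have "x ^ m /\<^sub>R fact m \<le> exp x"
    unfolding exp_def using assms sum_le_suminf[OF summable_exp_generic[of x], of "{m}"] by simp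
  then show ?thesis using assms by (simp add: exp_minus field_simps divide_simps)
qed

text \<open>The Mellin integral over \<open>[1, \<infinity>)\<close> is folded back to \<open>[0, 1]\<close> by inversion, so only
  integrals over a compact interval occur.\<close>
lemma mellin01_exp:
  fixes L :: real
  assumes "L > 0" "Re s > 0"
  shows "mellin01 (\<lambda>u. of_real (exp (- L * u))) s + mellin01 (\<lambda>u. of_real (exp (- L / u))) (- s) = of_real L powr (- s) * Gamma s"
proof -
  \<comment> \<open>This is Euler's integrand, split at t = L: u -> L u maps (0, 1] onto (0, L], and
    u -> L/u maps it onto [L, \<infinity>).\<close>
  define h where "h = (\<lambda>t. of_real t powr (s - 1) / of_real (exp t) :: complex)"
  have h: "h absolutely_integrable_on {0<..}"
    unfolding h_def by (rule absolutely_integrable_Gamma_integral'[OF assms(2)])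
  have hI: "integral {0<..} h = Gamma s"
    unfolding h_def using Gamma_integral_complex'[OF assms(2)] by (rule integral_unique)
  have h1: "h absolutely_integrable_on {0<..L}" and h2: "h absolutely_integrable_on {L..}"
    using assms by (auto intro: set_integrable_subset[OF h])
  have "integral {0<..L} h + integral {L..} h = integral ({0<..L} \<union> {L..}) h"
  proof (rule integral_Un[symmetric])
    have "{0<..L} \<inter> {L..} = {L}" using assms by auto
    then show "negligible ({0<..L} \<inter> {L..})" by simp
  qed (use h1 h2 in \<open>auto simp: absolutely_integrable_on_def\<close>)
  also have "{0<..L} \<union> {L..} = {0<..}" using assms by auto
  finally have split: "integral {0<..L} h + integral {L..} h = Gamma s" using hI by simp

  have im1: "(\<lambda>u. L * u) ` {0<..1} = {0<..L}"
  proof safe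
    fix x assume "x \<in> {0<..L}"
    then show "x \<in> (*) L ` {0<..1}" using assms by (intro image_eqI[of _ _ "x / L"]) (auto simp: divide_simps)
  qed (use assms in \<open>auto simp: mult_left_le\<close>)
  have "integral {0<..1} (\<lambda>u. \<bar>L\<bar> *\<^sub>R h (L * u)) = integral {0<..L} h"
    using has_absolute_integral_change_of_variables_real[of "{0<..1}" "\<lambda>u. L * u" "\<lambda>_. L" h "integral {0<..L} h"] assms h1
    unfolding im1 by (auto intro!: derivative_eq_intros simp: inj_on_def)
  also have "integral {0<..1} (\<lambda>u. \<bar>L\<bar> *\<^sub>R h (L * u)) =
     integral {0<..1} (\<lambda>u. of_real L powr s * (of_real (exp (- L * u)) * of_real u powr (s - 1)))"
  proof (rule Henstock_Kurzweil_Integration.integral_cong)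
    fix u :: real assume u: "u \<in> {0<..1}"
    have "of_real L powr s = of_real L * of_real L powr (s - 1)"
      using assms by (simp add: powr_diff)
    moreover have "of_real (L * u) powr (s - 1) = of_real L powr (s - 1) * of_real u powr (s - 1)"
      using assms u by (simp add: powr_times_real)
    ultimately show "\<bar>L\<bar> *\<^sub>R h (L * u) = of_real L powr s * (of_real (exp (- L * u)) * of_real u powr (s - 1))"
      using assms by (simp add: h_def scaleR_conv_of_real exp_minus divide_inverse)
  qed
  also have "\<dots> = of_real L powr s * integral {0<..1} (\<lambda>u. of_real (exp (- L * u)) * of_real u powr (s - 1))"
    by simp
  also have "integral {0<..1} (\<lambda>u. of_real (exp (- L * u)) * of_real u powr (s - 1)) = mellin01 (\<lambda>u. of_real (exp (- L * u))) s"
    unfolding mellin01_def by (rule integral_spike_set) (auto intro: negligible_subset[of "{0}"])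
  finally have A: "of_real L powr s * mellin01 (\<lambda>u. of_real (exp (- L * u))) s = integral {0<..L} h" .

  have im2: "(\<lambda>u. L / u) ` {0<..1} = {L..}"
  proof (intro equalityI subsetI)
    fix x assume "x \<in> {L..}"
    then show "x \<in> (\<lambda>u. L / u) ` {0<..1}" using assms by (intro image_eqI[of _ _ "L / x"]) (auto simp: divide_simps)
  qed (use assms in \<open>auto simp: divide_simps mult_left_le\<close>)
  have "((/) L has_real_derivative - L / u\<^sup>2) (at u within {0<..1})" if "u \<in> {0<..1}" for u
    using that by (auto intro!: derivative_eq_intros simp: power2_eq_square)
  then have "integral {0<..1} (\<lambda>u. \<bar>- L / u\<^sup>2\<bar> *\<^sub>R h (L / u)) = integral {L..} h"
    using has_absolute_integral_change_of_variables_real[of "{0<..1}" "\<lambda>u. L / u" "\<lambda>u. - L / u\<^sup>2" h "integral {L..} h"] assms h2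
    unfolding im2 by (auto simp: inj_on_def)
  also have "integral {0<..1} (\<lambda>u. \<bar>- L / u\<^sup>2\<bar> *\<^sub>R h (L / u)) =
     integral {0<..1} (\<lambda>u. of_real L powr s * (of_real (exp (- L / u)) * of_real u powr (- s - 1)))"
  proof (rule Henstock_Kurzweil_Integration.integral_cong)
    fix u :: real assume u: "u \<in> {0<..1}"
    have 1: "of_real L powr s = of_real L * of_real L powr (s - 1)"
      using assms by (simp add: powr_diff)
    have 2: "of_real (L / u) powr (s - 1) = of_real L powr (s - 1) * of_real (inverse u) powr (s - 1)"
      using assms u unfolding divide_inverse of_real_mult by (subst powr_times_real) auto
    have 3: "complex_of_real (inverse u) powr (s - 1) = of_real u powr (1 - s)"
      using u by (simp add: powr_def Ln_of_real ln_inverse algebra_simps del: of_real_inverse)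
    have 4: "complex_of_real u powr (1 - s) = of_real u ^ 2 * of_real u powr (- s - 1)"
      using u by (simp add: powr_diff powr_minus field_simps power2_eq_square)
    show "\<bar>- L / u\<^sup>2\<bar> *\<^sub>R h (L / u) = of_real L powr s * (of_real (exp (- L / u)) * of_real u powr (- s - 1))"
      using assms u unfolding h_def 1 2 3 4 by (simp add: scaleR_conv_of_real exp_minus field_simps)
  qed
  also have "\<dots> = of_real L powr s * integral {0<..1} (\<lambda>u. of_real (exp (- L / u)) * of_real u powr (- s - 1))"
    by simp
  also have "integral {0<..1} (\<lambda>u. of_real (exp (- L / u)) * of_real u powr (- s - 1)) = mellin01 (\<lambda>u. of_real (exp (- L / u))) (- s)"
    unfolding mellin01_def by (rule integral_spike_set) (auto intro: negligible_subset[of "{0}"])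
  finally have B: "of_real L powr s * mellin01 (\<lambda>u. of_real (exp (- L / u))) (- s) = integral {L..} h" .
  have "of_real L powr s * (mellin01 (\<lambda>u. of_real (exp (- L * u))) s + mellin01 (\<lambda>u. of_real (exp (- L / u))) (- s)) = Gamma s"
    using A B split by (simp add: algebra_simps)
  then show ?thesis using assms by (simp add: powr_minus field_simps)
qed

section \<open>Termwise Mellin transforms of exponential series\<close>

lemma dominated01_suminf:
  assumes d: "\<And>n. dominated01 (c n) K (t n)" and c: "summable c"
  shows "dominated01 (suminf c) K (\<lambda>u. \<Sum>n. t n u)"
  unfolding dominated01_def
proof (intro conjI ballI)
  have c0: "c n \<ge> 0" for n using d by (simp add: dominated01_def)
  then show "suminf c \<ge> 0" using c by (intro suminf_nonneg)
  have tb: "norm (t n u) \<le> c n * u powr (- K)" if "u \<in> {0<..1}" for n u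
    using d that by (simp add: dominated01_def)
  show "norm (\<Sum>n. t n u) \<le> suminf c * u powr (- K)" if u: "u \<in> {0<..1}" for u
    unfolding suminf_mult2[OF c]
    by (rule norm_suminf_le) (use tb[OF u] c in \<open>auto intro: summable_mult2\<close>)
  \<comment> \<open>The M-test works only away from 0, so continuity at u is proved on [u/2, 1],
    where u^(-K) is bounded.\<close>
  have "continuous (at u within {0<..1}) (\<lambda>u. \<Sum>n. t n u)" if u: "u \<in> {0<..1}" for u
  proof -
    have "continuous_on {u/2..1} (\<lambda>x. x powr (- K))" using u by (intro continuous_intros) auto
    then have "bounded ((\<lambda>x. x powr (- K)) ` {u/2..1})"
      by (intro compact_imp_bounded compact_continuous_image) auto
    then obtain B where B: "\<And>x. x \<in> {u/2..1} \<Longrightarrow> x powr (- K) \<le> B"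
      unfolding bounded_real by (meson abs_le_iff imageI)
    have unif: "uniform_limit {u/2..1} (\<lambda>n x. \<Sum>i<n. t i x) (\<lambda>x. \<Sum>i. t i x) sequentially"
    proof (rule Weierstrass_m_test)
      show "summable (\<lambda>n. c n * B)" using c by (rule summable_mult2)
      fix n x assume x: "x \<in> {u/2..1}"
      have "norm (t n x) \<le> c n * x powr (- K)" using tb x u by auto
      also have "\<dots> \<le> c n * B" using B[OF x] c0 by (intro mult_left_mono)
      finally show "norm (t n x) \<le> c n * B" .
    qed
    have "continuous_on {u/2..1} (t i)" for i
      by (rule continuous_on_subset[of "{0<..1}"]) (use d[of i] u in \<open>auto simp: dominated01_def\<close>)
    then have cont: "continuous_on {u/2..1} (\<lambda>x. \<Sum>i<n. t i x)" for n
      by (intro continuous_on_sum)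
    have "continuous_on {u/2..1} (\<lambda>x. \<Sum>i. t i x)"
      by (rule uniform_limit_theorem[OF always_eventually unif]) (use cont in auto)
    then have "continuous (at u within {u/2..1}) (\<lambda>x. \<Sum>i. t i x)"
      using u by (auto simp: continuous_on_eq_continuous_within)
    moreover have "at u within {u/2..1} = at u within {0<..1}"
      by (rule at_within_nhd[of _ "{u/2<..}"]) (use u in auto)
    ultimately show ?thesis by simp
  qed
  then show "continuous_on {0<..1} (\<lambda>u. \<Sum>n. t n u)"
    by (simp add: continuous_on_eq_continuous_within)
qed

text \<open>For Re s \<ge> K + 2 the n-th integrand is at most \<open>c n\<close> on all of [0, 1],
  so the convergence is uniform up to the endpoint.\<close>

lemma mellin01_suminf:
  assumes d: "\<And>n. dominated01 (c n) K (t n)" and c: "summable c" and s: "Re s \<ge> K + 2"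
  shows "(\<lambda>n. mellin01 (t n) s) sums mellin01 (\<lambda>u. \<Sum>n. t n u) s"
proof -
  let ?f = "\<lambda>n u. t n u * of_real u powr (s - 1)"
  have cf: "continuous_on {0..1} (?f n)" for n
    by (rule continuous_on_mellin01_integrand[OF d s])
  have "uniform_limit {0..1} (\<lambda>n u. \<Sum>i<n. ?f i u) (\<lambda>u. \<Sum>i. ?f i u) sequentially"
  proof (rule Weierstrass_m_test[OF _ c])
    fix n and u :: real assume "u \<in> {0..1}"
    then show "norm (?f n u) \<le> c n" using mellin01_integrand_bound[OF d, of u 0 s n] s by simp
  qed
  then obtain I J where I: "\<And>n. ((\<lambda>u. \<Sum>i<n. ?f i u) has_integral I n) {0..1}"
    and J: "((\<lambda>u. \<Sum>i. ?f i u) has_integral J) {0..1}" and IJ: "I \<longlonglongrightarrow> J"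
    by (rule uniform_limit_integral) (auto intro!: continuous_on_sum cf)
  have "I n = (\<Sum>i<n. mellin01 (t i) s)" for n
    using integral_unique[OF I[of n]] cf
    by (subst (asm) integral_sum) (auto simp: mellin01_def intro: integrable_continuous_real)
  moreover have "J = mellin01 (\<lambda>u. \<Sum>n. t n u) s"
  proof -
    have "(\<Sum>i. ?f i u) = (\<Sum>n. t n u) * of_real u powr (s - 1)" if u: "u \<in> {0..1}" for u
    proof (cases "u = 0")
      case False
      then have "\<And>n. norm (t n u) \<le> c n * u powr (- K)" using d u by (auto simp: dominated01_def)
      then have "summable (\<lambda>n. t n u)"
        by (rule summable_comparison_test'[OF summable_mult2[OF c]])
      then show ?thesis by (simp add: suminf_mult2)
    qed simp
    then have "integral {0..1} (\<lambda>u. \<Sum>i. ?f i u) = mellin01 (\<lambda>u. \<Sum>n. t n u) s"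
      unfolding mellin01_def by (intro Henstock_Kurzweil_Integration.integral_cong) auto
    then show ?thesis using integral_unique[OF J] by simp
  qed
  moreover from calculation(1) have "I = (\<lambda>n. \<Sum>i<n. mellin01 (t i) s)" by (rule ext)
  ultimately show ?thesis using IJ unfolding sums_def by (simp only:)
qed

text \<open>\<open>a n\<close> is the coefficient of frequency n + 1. For L = 2\<pi>/sqrt M this is
  the q-expansion on the imaginary axis, at the point i v/sqrt M.\<close>

definition exp_series :: "real \<Rightarrow> (nat \<Rightarrow> complex) \<Rightarrow> real \<Rightarrow> complex" where
  "exp_series L a v = (\<Sum>n. a n * of_real (exp (- (L * real (Suc n)) * v)))"

text \<open>m is free beyond p + 2: the surplus over p pays for the summable factor 1/(n+1)^2, and a
  large m gives decay of any order in v.\<close>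

lemma exp_series_term_bound:
  assumes L: "L > 0" and a: "\<And>n. norm (a n) \<le> C * real (Suc n) ^ p" and m: "m \<ge> p + 2" and v: "v > 0"
  shows "norm (a n) * exp (- (L * real (Suc n)) * v) \<le> (C * fact m / L ^ m * inverse (real (Suc n) ^ 2)) * inverse v ^ m"
proof -
  have C: "C \<ge> 0" using order_trans[OF norm_ge_zero a[of 0]] by simp
  have "norm (a n) * exp (- (L * real (Suc n)) * v) = norm (a n) * exp (- (L * real (Suc n) * v))"
    by simp
  also have "\<dots> \<le> (C * real (Suc n) ^ p) * (fact m / (L * real (Suc n) * v) ^ m)"
    using L v a C by (intro mult_mono exp_minus_le_power) auto
  also have "\<dots> = (C * fact m / L ^ m * inverse v ^ m) * (real (Suc n) ^ p * inverse (real (Suc n) ^ m))"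
    by (simp only: power_mult_distrib divide_inverse power_inverse inverse_mult_distrib mult_ac)
  also have "\<dots> \<le> (C * fact m / L ^ m * inverse v ^ m) * inverse (real (Suc n) ^ 2)"
  proof (rule mult_left_mono)
    have "real (Suc n) ^ (p + 2) \<le> real (Suc n) ^ m" using m by (intro power_increasing) auto
    then show "real (Suc n) ^ p * inverse (real (Suc n) ^ m) \<le> inverse (real (Suc n) ^ 2)"
      by (simp add: field_simps del: of_nat_Suc power_Suc add_2_eq_Suc' flip: power_add)
  qed (use C L v in auto)
  finally show ?thesis by (simp add: mult_ac)
qed

lemma summable_exp_series_bound: "summable (\<lambda>n. c * inverse (real (Suc n) ^ 2))"
proof -
  have "summable (\<lambda>n. inverse (real (Suc n) ^ 2))"
    using inverse_power_summable[of 2, where 'a=real] by (subst summable_Suc_iff[of "\<lambda>n. inverse (real n ^ 2)"]) auto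
  then show ?thesis by (rule summable_mult)
qed

text \<open>The same estimate is read at v = u, where it allows growth of order m at 0, and at v =
  1/u, where it yields vanishing of order m.\<close>

lemma exp_series_terms:
  assumes L: "L > 0" and a: "\<And>n. norm (a n) \<le> C * real (Suc n) ^ p" and m: "m \<ge> p + 2"
  defines "c \<equiv> \<lambda>n. C * fact m / L ^ m * inverse (real (Suc n) ^ 2)"
  shows "dominated01 (c n) (real m) (\<lambda>u. a n * of_real (exp (- (L * real (Suc n)) * u)))"
    and "dominated01 (c n) (- real m) (\<lambda>u. a n * of_real (exp (- (L * real (Suc n)) / u)))"
    and "summable c"
proof -
  have C: "C \<ge> 0" using order_trans[OF norm_ge_zero a[of 0]] by simp
  have main: "norm (a n * of_real (exp (- (L * real (Suc n)) * v))) \<le> c n * inverse v ^ m" if "v > 0" for v n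
    using exp_series_term_bound[OF L a m that, of n] by (simp add: c_def norm_mult)
  have c0: "c n \<ge> 0" for n using C L by (simp add: c_def)
  show "dominated01 (c n) (real m) (\<lambda>u. a n * of_real (exp (- (L * real (Suc n)) * u)))"
    unfolding dominated01_def
  proof (intro conjI ballI c0)
    fix u :: real assume "u \<in> {0<..1}"
    then show "norm (a n * of_real (exp (- (L * real (Suc n)) * u))) \<le> c n * u powr - real m"
      using main[of u n] by (simp add: powr_minus powr_realpow power_inverse)
  qed (intro continuous_intros)
  show "dominated01 (c n) (- real m) (\<lambda>u. a n * of_real (exp (- (L * real (Suc n)) / u)))"
    unfolding dominated01_def
  proof (intro conjI ballI c0)
    fix u :: real assume "u \<in> {0<..1}"
    then show "norm (a n * of_real (exp (- (L * real (Suc n)) / u))) \<le> c n * u powr - (- real m)"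
      using main[of "inverse u" n] by (simp add: powr_realpow divide_inverse)
  qed (intro continuous_intros, auto)
  show "summable c" unfolding c_def by (rule summable_exp_series_bound)
qed

lemma dominated01_exp_series:
  assumes "L > 0" "\<And>n. norm (a n) \<le> C * real (Suc n) ^ p" "m \<ge> p + 2"
  shows "\<exists>D. dominated01 D (real m) (exp_series L a) \<and> dominated01 D (- real m) (\<lambda>u. exp_series L a (1 / u))"
proof -
  note t = exp_series_terms[OF assms]
  show ?thesis
    using dominated01_suminf[OF t(1) t(3)] dominated01_suminf[OF t(2) t(3)]
    by (auto simp: exp_series_def[abs_def])
qed

lemma mellin01_exp_series:
  assumes "L > 0" "\<And>n. norm (a n) \<le> C * real (Suc n) ^ p" and s: "Re s \<ge> real p + 4"
  shows "mellin01 (exp_series L a) s + mellin01 (\<lambda>u. exp_series L a (1 / u)) (- s)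
           = Gamma s * (\<Sum>n. a n * of_real (L * real (Suc n)) powr (- s))"
proof -
  \<comment> \<open>Two exponents are needed: p + 2 keeps the growth of the first integrand at 0
    small, whereas the second transform is taken at -s and needs vanishing of order at least Re s +
    2.\<close>
  obtain m :: nat where "real m \<ge> max (Re s + 2) (real (p + 2))"
    using real_arch_simple by blast
  then have m: "real m \<ge> Re s + 2" "m \<ge> p + 2" by auto
  have m0: "p + 2 \<le> p + 2" by simp
  note t = exp_series_terms[OF assms(1,2) m0] and t' = exp_series_terms[OF assms(1,2) m(2)]
  have 1: "(\<lambda>n. mellin01 (\<lambda>u. a n * of_real (exp (- (L * real (Suc n)) * u))) s) sums mellin01 (exp_series L a) s"
    using mellin01_suminf[OF t(1) t(3), of s] s by (simp add: exp_series_def[abs_def])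
  have 2: "(\<lambda>n. mellin01 (\<lambda>u. a n * of_real (exp (- (L * real (Suc n)) / u))) (- s)) sums mellin01 (\<lambda>u. exp_series L a (1 / u)) (- s)"
    using mellin01_suminf[OF t'(2) t'(3), of "- s"] m by (simp add: exp_series_def[abs_def])
  have mult: "mellin01 (\<lambda>u. z * h u) w = z * mellin01 h w" for z h w
    by (simp add: mellin01_def mult.assoc)
  have "mellin01 (\<lambda>u. a n * of_real (exp (- (L * real (Suc n)) * u))) s + mellin01 (\<lambda>u. a n * of_real (exp (- (L * real (Suc n)) / u))) (- s)
      = (a n * of_real (L * real (Suc n)) powr (- s)) * Gamma s" for n
    unfolding mult distrib_left[symmetric] using s assms(1)
    by (subst mellin01_exp) (auto simp del: of_nat_Suc)
  with sums_add[OF 1 2] have S: "(\<lambda>n. (a n * of_real (L * real (Suc n)) powr (- s)) * Gamma s) sums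
       (mellin01 (exp_series L a) s + mellin01 (\<lambda>u. exp_series L a (1 / u)) (- s))"
    by (simp only:)
  \<comment> \<open>Dividing the convergent series by \<Gamma>(s) gives the summability of the
    Dirichlet series.\<close>
  have "Gamma s \<noteq> 0" using s by (subst Gamma_eq_zero_iff) (auto elim!: nonpos_Ints_cases)
  with S have "summable (\<lambda>n. a n * of_real (L * real (Suc n)) powr (- s))"
    using summable_mult2[OF sums_summable[OF S], of "inverse (Gamma s)"] by (simp add: mult.assoc)
  then show ?thesis using sums_unique[OF S] suminf_mult2[of _ "Gamma s"] by (simp only: mult.commute)
qed

text \<open>Growth in vertical strips is what Phragmen-Lindelof consumes, and this form of finite
  order survives a shift of s and a factor M^(s/2).\<close>

definition strip_finite_order :: "(complex \<Rightarrow> complex) \<Rightarrow> bool" where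
  "strip_finite_order F \<longleftrightarrow> (\<forall>R. \<exists>A c m. c \<ge> 0 \<and> (\<forall>s. \<bar>Re s\<bar> \<le> R \<longrightarrow> norm (F s) \<le> A * exp ((\<bar>Im s\<bar> + c) ^ m)))"

text \<open>The difference of the two Mellin transforms extends to an entire function that is bounded in
  two half planes, hence constant by Phragmen-Lindelof and Liouville, and it vanishes at infinity.
  Hence all large moments of the difference of the two sides vanish.\<close>
theorem hecke_inversion:
  fixes a b :: "nat \<Rightarrow> complex" and \<epsilon> :: complex
  assumes L: "L > 0"
    and a: "\<And>n. norm (a n) \<le> C * real (Suc n) ^ p" and b: "\<And>n. norm (b n) \<le> C * real (Suc n) ^ p"
    and \<Phi>: "\<Phi> holomorphic_on UNIV" "strip_finite_order \<Phi>"
    and \<Phi>_eq: "\<And>s. Re s > K \<Longrightarrow> \<Phi> s = Gamma s * (\<Sum>n. a n * of_real (L * real (Suc n)) powr (- s))"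
    and \<Psi>_eq: "\<And>s. Re s > K \<Longrightarrow> \<Psi> s = Gamma s * (\<Sum>n. b n * of_real (L * real (Suc n)) powr (- s))"
    and fe: "\<And>s. \<Phi> s = \<epsilon> * \<Psi> (of_nat k - s)"
    and v: "0 < v" "v \<le> 1"
  shows "exp_series L a v = \<epsilon> * of_real v powr (- of_nat k) * exp_series L b (1 / v)"
proof -
  define A where "A = exp_series L a"
  define A' where "A' = (\<lambda>u. exp_series L a (1 / u))"
  define B where "B = exp_series L b"
  define B' where "B' = (\<lambda>u. exp_series L b (1 / u))"
  define R where "R = real p + \<bar>K\<bar> + real k + 5"
  have R: "R > 0" by (simp add: R_def)
  have A: "\<exists>D. dominated01 D (real m) A \<and> dominated01 D (- real m) A'" if "m \<ge> p + 2" for m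
    unfolding A_def A'_def by (rule dominated01_exp_series[OF L a that])
  have B: "\<exists>D. dominated01 D (real m) B \<and> dominated01 D (- real m) B'" if "m \<ge> p + 2" for m
    unfolding B_def B'_def by (rule dominated01_exp_series[OF L b that])
  have MA: "\<Phi> s = mellin01 A s + mellin01 A' (- s)" if "Re s \<ge> R" for s
    unfolding A_def A'_def using mellin01_exp_series[OF L a, of s] \<Phi>_eq[of s] that by (simp add: R_def)
  have MB: "\<Psi> s = mellin01 B s + mellin01 B' (- s)" if "Re s \<ge> R - real k" for s
    unfolding B_def B'_def using mellin01_exp_series[OF L b, of s] \<Psi>_eq[of s] that by (simp add: R_def)

  \<comment> \<open>For Re s \<ge> R, \<open>MA\<close> turns E into the Mellin transform over (0,
    1] of the difference of the two sides of the claim. For Re s \<le> -R, the functional equation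
    and \<open>MB\<close> give the form \<open>Eneg\<close>. Both forms are bounded; in the strip
    between, only the growth of \<Phi> is known.\<close>
  define E where "E = (\<lambda>s. \<Phi> s - mellin01 A' (- s) - \<epsilon> * mellin01 B' (s - of_nat k))"
  have hol: "mellin01 h holomorphic_on UNIV" if h: "\<And>m. m \<ge> p + 2 \<Longrightarrow> \<exists>D. dominated01 D (- real m) h" for h
  proof -
    have "mellin01 h field_differentiable at s" for s
    proof -
      obtain m :: nat where "real m \<ge> max (3 - Re s) (real (p + 2))"
        using real_arch_simple by blast
      then have m: "Re s > - real m + 2" "m \<ge> p + 2" by auto
      obtain D where "dominated01 D (- real m) h" using h[OF m(2)] by blast
      then have "mellin01 h holomorphic_on {s. Re s > - real m + 2}" by (rule holomorphic_mellin01)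
      then show ?thesis using m(1)
        by (intro holomorphic_on_imp_differentiable_at[OF _ open_halfspace_Re_gt]) auto
    qed
    then show ?thesis by (simp add: holomorphic_on_def field_differentiable_at_within)
  qed
  have "mellin01 A' holomorphic_on UNIV" by (rule hol) (use A in meson)
  then have hA: "(\<lambda>s. mellin01 A' (- s)) holomorphic_on UNIV"
    by (rule holomorphic_on_compose_gen[where f = uminus, unfolded o_def, rotated]) (auto intro: holomorphic_intros)
  have "mellin01 B' holomorphic_on UNIV" by (rule hol) (use B in meson)
  then have hB: "(\<lambda>s. mellin01 B' (s - of_nat k)) holomorphic_on UNIV"
    by (rule holomorphic_on_compose_gen[where f = "\<lambda>s. s - of_nat k", unfolded o_def, rotated]) (auto intro!: holomorphic_intros)
  have holE: "E holomorphic_on UNIV"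
    unfolding E_def by (intro holomorphic_intros \<Phi> hA hB)

  \<comment> \<open>This m keeps -s and s - k in the half planes where the transforms of A' and B'
    are bounded, for all |Re s| \<le> R.\<close>
  obtain m :: nat where m: "real m \<ge> R + real k + 2" using real_arch_simple by blast
  then have mp: "m \<ge> p + 2" by (simp add: R_def)
  obtain D1 where D1: "dominated01 D1 (real (p+2)) A" using A[of "p+2"] by auto
  obtain D2 where D2: "dominated01 D2 (- real m) A'" using A[OF mp] by auto
  obtain D3 where D3: "dominated01 D3 (real (p+2)) B" using B[of "p+2"] by auto
  obtain D4 where D4: "dominated01 D4 (- real m) B'" using B[OF mp] by auto
  have D0: "D1 \<ge> 0" "D2 \<ge> 0" "D3 \<ge> 0" "D4 \<ge> 0" using D1 D2 D3 D4 by (auto simp: dominated01_def)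
  have Epos: "E s = mellin01 A s - \<epsilon> * mellin01 B' (s - of_nat k)" if "Re s \<ge> R" for s
    using MA[OF that] by (simp add: E_def)
  have Eneg: "E s = \<epsilon> * mellin01 B (of_nat k - s) - mellin01 A' (- s)" if "Re s \<le> - R" for s
    using MB[of "of_nat k - s"] that fe[of s] by (simp add: E_def algebra_simps)
  have Edecay: "norm (E s) \<le> (D1 + norm \<epsilon> * D4) / (real j + 1)" if "Re s \<ge> R + real j" for s j
  proof -
    have "norm (E s) \<le> norm (mellin01 A s) + norm (\<epsilon> * mellin01 B' (s - of_nat k))"
      using that by (subst Epos) (auto intro: norm_triangle_ineq4)
    also have "norm (mellin01 A s) \<le> D1 / (real j + 1)"
      by (rule norm_mellin01_le[OF D1]) (use that in \<open>simp add: R_def\<close>)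
    also have "norm (\<epsilon> * mellin01 B' (s - of_nat k)) \<le> norm \<epsilon> * (D4 / (real j + 1))"
      unfolding norm_mult
      by (intro mult_left_mono norm_mellin01_le[OF D4]) (use that m in \<open>simp_all add: R_def\<close>)
    finally show ?thesis by (simp add: add_divide_distrib)
  qed
  define Bd where "Bd = D1 + D2 + norm \<epsilon> * (D3 + D4)"
  have Bd0: "Bd \<ge> 0" using D0 by (simp add: Bd_def)
  have Eout: "norm (E s) \<le> Bd" if "\<bar>Re s\<bar> \<ge> R" for s
  proof (cases "Re s \<ge> R")
    case True
    then have "norm (E s) \<le> D1 + norm \<epsilon> * D4" using Edecay[of 0 s] by simp
    also have "\<dots> \<le> Bd" using D0 by (simp add: Bd_def distrib_left)
    finally show ?thesis .
  next
    case False
    then have s: "Re s \<le> - R" using that by auto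
    have "norm (E s) \<le> norm (\<epsilon> * mellin01 B (of_nat k - s)) + norm (mellin01 A' (- s))"
      unfolding Eneg[OF s] by (rule norm_triangle_ineq4)
    also have "norm (mellin01 A' (- s)) \<le> D2"
      using norm_mellin01_le[OF D2, of 0 "- s"] s m R by simp
    also have "norm (\<epsilon> * mellin01 B (of_nat k - s)) \<le> norm \<epsilon> * D3"
      unfolding norm_mult using norm_mellin01_le[OF D3, of 0 "of_nat k - s"] s
      by (intro mult_left_mono) (auto simp: R_def)
    also have "norm \<epsilon> * D3 + D2 \<le> Bd" using D0 by (simp add: Bd_def distrib_left)
    finally show ?thesis by simp
  qed
  obtain G c n where c: "c \<ge> 0" and G: "\<And>s. \<bar>Re s\<bar> \<le> R \<Longrightarrow> norm (\<Phi> s) \<le> G * exp ((\<bar>Im s\<bar> + c) ^ n)"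
    using \<Phi>(2) unfolding strip_finite_order_def by meson
  have Ein: "norm (E s) \<le> Bd" if "\<bar>Re s\<bar> \<le> R" for s
  proof (rule phragmen_lindelof_strip[OF holE R _ _ that])
    fix s :: complex assume s: "\<bar>Re s\<bar> \<le> R"
    have "norm (E s) \<le> norm (\<Phi> s) + norm (mellin01 A' (- s)) + norm (\<epsilon> * mellin01 B' (s - of_nat k))"
      unfolding E_def by (meson add_mono norm_triangle_ineq4 order_refl order_trans)
    also have "norm (\<Phi> s) \<le> G * exp ((\<bar>Im s\<bar> + c) ^ n)" by (rule G[OF s])
    also have "norm (mellin01 A' (- s)) \<le> D2"
      using norm_mellin01_le[OF D2, of 0 "- s"] s m R by simp
    also have "norm (\<epsilon> * mellin01 B' (s - of_nat k)) \<le> norm \<epsilon> * D4"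
      unfolding norm_mult using norm_mellin01_le[OF D4, of 0 "s - of_nat k"] s m
      by (intro mult_left_mono) auto
    also have "G * exp ((\<bar>Im s\<bar> + c) ^ n) + D2 + norm \<epsilon> * D4 \<le>
        G * exp ((\<bar>Im s\<bar> + c) ^ n) + (D2 + norm \<epsilon> * D4) * exp ((\<bar>Im s\<bar> + c) ^ n)"
      using D0 c mult_left_mono[of 1 "exp ((\<bar>Im s\<bar> + c) ^ n)" "D2 + norm \<epsilon> * D4"] by simp
    finally show "norm (E s) \<le> (G + D2 + norm \<epsilon> * D4) * exp ((\<bar>Im s\<bar> + c) ^ n)"
      by (simp add: algebra_simps)
  qed (use Eout in auto)
  have "bounded (range E)"
    unfolding bounded_iff using Ein Eout by (metis linear rangeE)
  then obtain e where e: "\<And>s. E s = e"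
    using Liouville_theorem[OF holE] unfolding constant_on_def by blast
  have "e = 0"
  proof -
    have "(\<lambda>j. (D1 + norm \<epsilon> * D4) * inverse (real (Suc j))) \<longlonglongrightarrow> (D1 + norm \<epsilon> * D4) * 0"
      by (intro tendsto_intros LIMSEQ_inverse_real_of_nat)
    moreover have "norm e \<le> (D1 + norm \<epsilon> * D4) * inverse (real (Suc j))" for j
      using Edecay[of j "of_real (R + real j)"] e by (simp add: divide_inverse add.commute)
    ultimately have "norm e \<le> (D1 + norm \<epsilon> * D4) * 0" by (intro LIMSEQ_le_const) auto
    then show ?thesis by simp
  qed
  then have Mel: "mellin01 A s = \<epsilon> * mellin01 B' (s - of_nat k)" if "Re s \<ge> R" for s
    using Epos[OF that] e[of s] by simp

  obtain r :: nat where r: "real r \<ge> R + 1" using real_arch_simple by blast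
  \<comment> \<open>The extra power of u makes both sides continuous up to 0; the i-th moment of h
    is then the relation \<open>Mel\<close> at s = r + i.\<close>
  define h where "h = (\<lambda>u. A u * of_real u powr (of_nat r - 1) - \<epsilon> * (B' u * of_real u powr (of_nat r - of_nat k - 1)))"
  have "h v = 0"
  proof (rule continuous_moments_zero)
    have cA: "continuous_on {0..1} (\<lambda>u. A u * of_real u powr (s - 1))" if "Re s \<ge> R" for s
      by (rule continuous_on_mellin01_integrand[OF D1]) (use that in \<open>simp add: R_def\<close>)
    have cB: "continuous_on {0..1} (\<lambda>u. B' u * of_real u powr (s - of_nat k - 1))" if "Re s \<ge> R" for s
      by (rule continuous_on_mellin01_integrand[OF D4]) (use that m in \<open>simp add: R_def\<close>)
    show "continuous_on {0..1} h"
      unfolding h_def using r by (intro continuous_intros cA cB) auto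
    show "integral {0..1} (\<lambda>u. h u * of_real u ^ i) = 0" for i
    proof -
      let ?s = "of_nat r + of_nat i :: complex"
      have pw: "of_real u powr w * of_real u ^ i = of_real u powr (w + of_nat i)" if "u \<in> {0..1}" for u :: real and w :: complex
        using that by (cases "u = 0") (auto simp: powr_add powr_nat)
      have "integral {0..1} (\<lambda>u. h u * of_real u ^ i) =
          integral {0..1} (\<lambda>u. A u * of_real u powr (?s - 1) - \<epsilon> * (B' u * of_real u powr (?s - of_nat k - 1)))"
      proof (rule Henstock_Kurzweil_Integration.integral_cong)
        fix u :: real assume u: "u \<in> {0..1}"
        show "h u * of_real u ^ i = A u * of_real u powr (?s - 1) - \<epsilon> * (B' u * of_real u powr (?s - of_nat k - 1))"
          using pw[OF u, of "of_nat r - 1"] pw[OF u, of "of_nat r - of_nat k - 1"]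
          by (simp add: h_def algebra_simps)
      qed
      also have "\<dots> = mellin01 A ?s - \<epsilon> * mellin01 B' (?s - of_nat k)"
        unfolding mellin01_def using r
        by (subst integral_diff) (auto intro!: integrable_continuous_real continuous_intros cA cB)
      finally show ?thesis using Mel[of ?s] r by simp
    qed
  qed (use v in auto)
  then have "A v * of_real v powr (of_nat r - 1) = \<epsilon> * (of_real v powr (- of_nat k) * B' v) * of_real v powr (of_nat r - 1)"
    by (simp add: h_def algebra_simps flip: powr_add)
  moreover have "of_real v powr (of_nat r - 1) \<noteq> (0::complex)" using v by simp
  ultimately show ?thesis by (simp add: A_def B'_def)
qed

subsection \<open>The slash action of the modular group\<close>

definition mk :: "int \<Rightarrow> int \<Rightarrow> int \<Rightarrow> int \<Rightarrow> imat" where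
  "mk a b c d = (\<chi> i j. if i = 1 then (if j = 1 then a else b) else (if j = 1 then c else d))"

lemma mk_entries [simp]: "ma (mk a b c d) = a" "mb (mk a b c d) = b" "mc (mk a b c d) = c" "md (mk a b c d) = d"
  by (simp_all add: mk_def ma_def mb_def mc_def md_def)

lemma imat_eqI:
  assumes "ma g = ma h" "mb g = mb h" "mc g = mc h" "md g = md h"
  shows "g = h"
  using assms by (simp add: vec_eq_iff forall_2 ma_def mb_def mc_def md_def)

lemma mult_entries [simp]:
  "ma (g ** h) = ma g * ma h + mb g * mc h" "mb (g ** h) = ma g * mb h + mb g * md h"
  "mc (g ** h) = mc g * ma h + md g * mc h" "md (g ** h) = mc g * mb h + md g * md h"
  by (simp_all add: ma_def mb_def mc_def md_def matrix_matrix_mult_def sum_2)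

lemma det_imat: "det g = ma g * md g - mb g * mc g" for g :: imat
  by (simp add: det_2 ma_def mb_def mc_def md_def)

lemma SL2Z_iff: "g \<in> SL2Z \<longleftrightarrow> ma g * md g - mb g * mc g = 1"
  by (simp add: SL2Z_def det_imat)

lemma SL2Z_coprime:
  assumes "g \<in> SL2Z"
  shows "coprime (mc g) (md g)"
proof (rule coprimeI)
  fix l assume "l dvd mc g" "l dvd md g"
  then have "l dvd ma g * md g - mb g * mc g" by (intro dvd_diff dvd_mult)
  then show "is_unit l" using assms by (simp add: SL2Z_iff)
qed

lemma SL2Z_mult: "g \<in> SL2Z \<Longrightarrow> h \<in> SL2Z \<Longrightarrow> g ** h \<in> SL2Z"
  by (simp add: SL2Z_def det_mul)

lemma sl2_inv_entries [simp]: "ma (sl2_inv g) = md g" "mb (sl2_inv g) = - mb g" "mc (sl2_inv g) = - mc g" "md (sl2_inv g) = ma g"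
  by (simp_all add: sl2_inv_def ma_def mb_def mc_def md_def)

lemma SL2Z_inv: "g \<in> SL2Z \<Longrightarrow> sl2_inv g \<in> SL2Z"
  by (simp add: SL2Z_iff algebra_simps)

lemma mult_sl2_inv:
  assumes "g \<in> SL2Z"
  shows "g ** sl2_inv g = mk 1 0 0 1" "sl2_inv g ** g = mk 1 0 0 1"
  using assms by (auto intro!: imat_eqI simp: SL2Z_iff algebra_simps)

lemma mk_id [simp]: "g ** mk 1 0 0 1 = g" "mk 1 0 0 1 ** g = g"
  by (auto intro!: imat_eqI)

text \<open>This is the automorphy factor; its cocycle relation \<open>aut_mult\<close> makes
  \<open>slash\<close> a right action of \<open>SL2Z\<close>.\<close>

definition aut :: "imat \<Rightarrow> complex \<Rightarrow> complex" where
  "aut g z = of_int (mc g) * z + of_int (md g)"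

definition moeb :: "imat \<Rightarrow> complex \<Rightarrow> complex" where
  "moeb g z = (of_int (ma g) * z + of_int (mb g)) / aut g z"

lemma aut_nonzero:
  assumes "g \<in> SL2Z" "Im z > 0"
  shows "aut g z \<noteq> 0"
proof
  assume h: "aut g z = 0"
  have "real_of_int (mc g) * Im z = 0" using arg_cong[OF h, of Im] by (simp add: aut_def)
  then have c: "mc g = 0" using assms by simp
  then have "md g = 0" using h by (simp add: aut_def)
  with c assms(1) show False by (simp add: SL2Z_iff)
qed

lemma slash_eq:
  assumes "g \<in> SL2Z"
  shows "slash k h g z = h (moeb g z) / aut g z ^ k"
proof -
  have "w powi (- int k) * x = x / w ^ k" for w x :: complex
    by (simp add: power_int_minus field_simps)
  then show ?thesis using assms by (simp add: slash_def moeb_def aut_def SL2Z_def)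
qed

lemma Im_moeb:
  assumes "g \<in> SL2Z" "Im z > 0"
  shows "Im (moeb g z) = Im z / (norm (aut g z))\<^sup>2"
proof -
  have "real_of_int (ma g) * real_of_int (md g) - real_of_int (mb g) * real_of_int (mc g) = real_of_int 1"
    using assms(1) unfolding SL2Z_iff by (metis of_int_diff of_int_mult)
  then have e: "real_of_int (ma g) * real_of_int (md g) = 1 + real_of_int (mb g) * real_of_int (mc g)"
    by simp
  have "Im ((of_int (ma g) * z + of_int (mb g)) * cnj (aut g z)) = Im z * (real_of_int (ma g) * real_of_int (md g)) - real_of_int (mb g) * real_of_int (mc g) * Im z"
    by (simp add: aut_def algebra_simps)
  also have "\<dots> = Im z" unfolding e by (simp add: algebra_simps)
  finally have "Im ((of_int (ma g) * z + of_int (mb g)) * cnj (aut g z)) = Im z" .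
  moreover have "moeb g z = (of_int (ma g) * z + of_int (mb g)) * cnj (aut g z) / of_real ((norm (aut g z))\<^sup>2)"
    unfolding moeb_def by (subst complex_div_cnj) simp
  ultimately show ?thesis by (simp only: Im_divide_of_real)
qed

lemma Im_moeb_pos:
  assumes "g \<in> SL2Z" "Im z > 0"
  shows "Im (moeb g z) > 0"
  using assms aut_nonzero[OF assms] by (simp add: Im_moeb)

lemma aut_mult:
  assumes "g \<in> SL2Z" "h \<in> SL2Z" "Im z > 0"
  shows "aut (g ** h) z = aut g (moeb h z) * aut h z"
  using aut_nonzero[OF assms(2,3)]
  by (simp add: aut_def[of g] moeb_def aut_def[of "g ** h"] field_simps) (simp add: aut_def algebra_simps)

lemma moeb_mult:
  assumes "g \<in> SL2Z" "h \<in> SL2Z" "Im z > 0"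
  shows "moeb (g ** h) z = moeb g (moeb h z)"
proof -
  have nz: "aut h z \<noteq> 0" "aut g (moeb h z) \<noteq> 0"
    using aut_nonzero[OF assms(2,3)] aut_nonzero[OF assms(1) Im_moeb_pos[OF assms(2,3)]] by auto
  have "of_int (ma g) * moeb h z + of_int (mb g) = (of_int (ma (g ** h)) * z + of_int (mb (g ** h))) / aut h z"
    using nz(1) by (simp add: moeb_def field_simps) (simp add: aut_def algebra_simps)
  then show ?thesis using nz by (simp add: moeb_def[of g] moeb_def[of "g ** h"] aut_mult[OF assms])
qed

lemma slash_mult:
  assumes "g \<in> SL2Z" "h \<in> SL2Z" "Im z > 0"
  shows "slash k F (g ** h) z = slash k (slash k F g) h z"
  using assms by (simp add: slash_eq SL2Z_mult aut_mult moeb_mult power_mult_distrib)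

lemma holomorphic_slash:
  assumes "F holomorphic_on upper_half_plane" "g \<in> SL2Z"
  shows "slash k F g holomorphic_on upper_half_plane"
proof -
  have "moeb g holomorphic_on upper_half_plane"
    unfolding moeb_def aut_def using aut_nonzero[OF assms(2)]
    by (intro holomorphic_intros) (auto simp: upper_half_plane_def aut_def)
  then have "(\<lambda>z. F (moeb g z)) holomorphic_on upper_half_plane"
    by (rule holomorphic_on_compose_gen[OF _ assms(1), unfolded o_def])
       (use Im_moeb_pos[OF assms(2)] in \<open>auto simp: upper_half_plane_def\<close>)
  then have "(\<lambda>z. F (moeb g z) / aut g z ^ k) holomorphic_on upper_half_plane"
    unfolding aut_def using aut_nonzero[OF assms(2)]
    by (intro holomorphic_intros) (auto simp: upper_half_plane_def aut_def)
  moreover have "slash k F g = (\<lambda>z. F (moeb g z) / aut g z ^ k)"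
    by (intro ext slash_eq assms)
  ultimately show ?thesis by simp
qed

text \<open>A relation rather than a multiplier as a function of g: the scalar is determined only if
  F does not vanish identically, and the group operations on scalars are available without choosing
  one.\<close>

definition slash_scalar :: "nat \<Rightarrow> (complex \<Rightarrow> complex) \<Rightarrow> imat \<Rightarrow> complex \<Rightarrow> bool" where
  "slash_scalar k F g x \<longleftrightarrow> g \<in> SL2Z \<and> (\<forall>z. Im z > 0 \<longrightarrow> slash k F g z = x * F z)"

lemma slash_cong:
  assumes "g \<in> SL2Z" "Im z > 0" "\<And>z. Im z > 0 \<Longrightarrow> F z = G z"
  shows "slash k F g z = slash k G g z"
  using assms Im_moeb_pos[OF assms(1,2)] by (simp add: slash_eq)

lemma slash_scale: "slash k (\<lambda>z. c * F z) g z = c * slash k F g z"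
  by (simp add: slash_def mult_ac)

lemma slash_scalar_mult:
  assumes "slash_scalar k F g x" "slash_scalar k F h y"
  shows "slash_scalar k F (g ** h) (x * y)"
proof -
  have g: "g \<in> SL2Z" and h: "h \<in> SL2Z" using assms by (auto simp: slash_scalar_def)
  have "slash k F (g ** h) z = x * y * F z" if "Im z > 0" for z
  proof -
    have "slash k F (g ** h) z = slash k (\<lambda>z. x * F z) h z"
      using slash_cong[OF h that, of "slash k F g" "\<lambda>z. x * F z"] assms(1) slash_mult[OF g h that]
      by (simp add: slash_scalar_def)
    then show ?thesis using assms(2) that by (simp add: slash_scale slash_scalar_def)
  qed
  then show ?thesis using SL2Z_mult[OF g h] by (simp add: slash_scalar_def)
qed

lemma slash_id: "slash k F (mk 1 0 0 1) z = F z"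
proof -
  have "mk 1 0 0 1 \<in> SL2Z" by (simp add: SL2Z_iff)
  then show ?thesis by (simp add: slash_eq moeb_def aut_def)
qed

lemma slash_scalar_inv:
  assumes "slash_scalar k F g x" "x \<noteq> 0"
  shows "slash_scalar k F (sl2_inv g) (inverse x)"
proof -
  have g: "g \<in> SL2Z" using assms by (simp add: slash_scalar_def)
  have "slash k F (sl2_inv g) z = inverse x * F z" if z: "Im z > 0" for z
  proof -
    have "F z = slash k F (g ** sl2_inv g) z" using g by (simp add: mult_sl2_inv slash_id)
    also have "\<dots> = slash k (\<lambda>z. x * F z) (sl2_inv g) z"
      using slash_cong[OF SL2Z_inv[OF g] z, of "slash k F g" "\<lambda>z. x * F z"] assms(1) slash_mult[OF g SL2Z_inv[OF g] z]
      by (simp add: slash_scalar_def)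
    finally show ?thesis using assms(2) by (simp add: slash_scale field_simps)
  qed
  then show ?thesis using SL2Z_inv[OF g] by (simp add: slash_scalar_def)
qed

definition Tmat :: "int \<Rightarrow> imat" where "Tmat j = mk 1 j 0 1"
definition Umat :: "int \<Rightarrow> imat" where "Umat j = mk 1 0 j 1"

lemma TU_SL2Z [simp]: "Tmat j \<in> SL2Z" "Umat j \<in> SL2Z"
  by (simp_all add: Tmat_def Umat_def SL2Z_iff)

lemma slash_Tmat: "slash k F (Tmat j) z = F (z + of_int j)"
  using slash_eq[of "Tmat j" k F z] by (simp add: moeb_def aut_def) (simp add: Tmat_def)

text \<open>The shift j is the product of the primes that divide M but not d. A prime divisor p of M
  not dividing d divides j, hence not d + c j; if p divides d, it divides neither c nor j.\<close>

lemma exists_shift_coprime: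
  fixes c d :: int and M :: nat
  assumes "coprime c d" "M > 0"
  shows "\<exists>j. coprime (d + c * j) (int M)"
proof -
  define P where "P = {p. prime p \<and> p dvd int M \<and> \<not> p dvd d}"
  have fin: "finite P"
    unfolding P_def using assms(2) by (intro finite_subset[OF _ finite_divisors_int[of "int M"]]) auto
  have "coprime (d + c * \<Prod>P) (int M)"
  proof (rule ccontr)
    assume "\<not> coprime (d + c * \<Prod>P) (int M)"
    then obtain e where e: "e dvd d + c * \<Prod>P" "e dvd int M" "\<not> is_unit e" by (rule not_coprimeE)
    then obtain p where "prime p" "p dvd e" using prime_divisor_exists[of e] e(2,3) assms(2) by fastforce
    with e have p: "prime p" "p dvd d + c * \<Prod>P" "p dvd int M" by (auto intro: dvd_trans)
    show False
    proof (cases "p dvd d")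
      case False
      then have "p \<in> P" using p by (simp add: P_def)
      then have "p dvd c * \<Prod>P" using fin by (auto intro!: dvd_mult dvd_prodI)
      with p(2) False show False by (simp add: dvd_add_left_iff)
    next
      case True
      with p(2) have "p dvd c * \<Prod>P" by (simp add: dvd_add_right_iff)
      moreover have "\<not> p dvd c" using assms(1) True p(1) by (meson coprime_common_divisor not_prime_unit)
      ultimately have "p dvd \<Prod>P" using p(1) prime_dvd_mult_iff by blast
      then obtain r where r: "r \<in> P" "p dvd r" using fin p(1) by (auto simp: prime_dvd_prod_iff)
      then have "p = r" using p(1) by (simp add: P_def primes_dvd_imp_eq)
      then show False using r True by (simp add: P_def)
    qed
  qed
  then show ?thesis by blast
qed

text \<open>With \<open>d = 1 + N t\<close> coprime to the level \<open>M\<close>, the element \<open>U T\<^sup>t\<close> has the same lower right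
  entry, and after a power of \<open>U\<close> also the same lower row modulo \<open>M\<close>.\<close>
lemma Gamma1_decomposition:
  assumes g: "g \<in> SL2Z" "int N dvd mc g" "md g mod int N = 1 mod int N" and M: "M > 0"
    and S: "\<And>g h. g \<in> S \<Longrightarrow> h \<in> S \<Longrightarrow> g ** h \<in> S" "\<And>g. g \<in> S \<Longrightarrow> sl2_inv g \<in> S"
    and T: "\<And>j. Tmat j \<in> S" and U: "\<And>j. Umat (int N * j) \<in> S"
    and PM: "principal_congruence M \<subseteq> S"
  shows "g \<in> S"
proof -
  obtain j where j: "coprime (md g + mc g * j) (int M)"
    using exists_shift_coprime[OF SL2Z_coprime[OF g(1)] M] by blast
  define h where "h = g ** Tmat j"
  have hd: "md h = md g + mc g * j" "mc h = mc g" by (simp_all add: h_def Tmat_def add.commute)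
  obtain c where c: "mc h = int N * c" using g(2) hd by auto
  have "int N dvd (md g - 1) + mc g * j" using g(2,3) by (intro dvd_add) (auto simp: mod_eq_dvd_iff)
  then obtain t where "(md g - 1) + mc g * j = int N * t" by (elim dvdE)
  then have t: "md h = 1 + int N * t" by (simp add: hd)
  obtain x where "[md h * x = 1] (mod int M)" using j hd cong_solve_coprime_int by metis
  \<comment> \<open>With x inverse to the lower right entry d modulo M, i = x (1 - c) makes c + d i
    congruent to 1.\<close>
  then obtain i where i: "int M dvd c + md h * i - 1"
  proof -
    assume "[md h * x = 1] (mod int M)"
    then have "int M dvd (md h * x - 1) * (1 - c)" by (auto simp: cong_iff_dvd_diff)
    then have "int M dvd c + md h * (x * (1 - c)) - 1" by (simp add: algebra_simps)
    then show thesis by (rule that)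
  qed
  define w where "w = Umat (int N) ** Tmat t"
  \<comment> \<open>Modulo M both h U^(N i) and w have the lower row (N, d), where d is the lower
    right entry of h; the quotient therefore has the lower row (0, 1).\<close>
  define q where "q = h ** Umat (int N * i) ** sl2_inv w"
  have hS: "h \<in> SL2Z" using g(1) by (simp add: h_def SL2Z_mult)
  have wS: "w \<in> SL2Z" by (simp add: w_def SL2Z_mult)
  have w: "w \<in> S" using U[of 1] T S(1) by (simp add: w_def)
  have qS: "q \<in> SL2Z" unfolding q_def by (intro SL2Z_mult hS SL2Z_inv wS) simp
  have wd: "md w = md h" "mc w = int N" "ma w = 1" "mb w = t" by (simp_all add: w_def Umat_def Tmat_def t add.commute)
  have qc: "mc q = int N * md h * (c + md h * i - 1)" and qd: "md q = md h - int N * t * (c + md h * i)"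
    by (simp_all add: q_def wd Umat_def c algebra_simps)
  have 1: "int M dvd mc q" using i unfolding qc by simp
  have "md q - 1 = - (int N * t) * (c + md h * i - 1)" unfolding qd by (simp add: t algebra_simps)
  then have 2: "int M dvd md q - 1" using i by simp
  \<comment> \<open>This translation keeps the lower row and replaces the upper right entry b by b
    (1 - d), which is 0 modulo M; the determinant then fixes the upper left entry.\<close>
  define r where "r = Tmat (- mb q) ** q"
  have rS: "r \<in> SL2Z" using qS by (simp add: r_def SL2Z_mult)
  have rc: "mc r = mc q" "md r = md q" "mb r = mb q - mb q * md q" by (simp_all add: r_def Tmat_def)
  have 3: "int M dvd mb r"
  proof -
    have "mb r = - mb q * (md q - 1)" by (simp add: rc algebra_simps)
    then show ?thesis using 2 by simp
  qed
  have 4: "int M dvd ma r - 1"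
  proof -
    have "ma r * md r - mb r * mc r = 1" using rS by (simp add: SL2Z_iff)
    then have "ma r - 1 = mb r * mc r - ma r * (md r - 1)" by (simp add: algebra_simps)
    then show ?thesis using 2 3 rc by simp
  qed
  have "r \<in> principal_congruence M"
    using rS 1 2 3 4 rc by (simp add: principal_congruence_def mod_eq_0_iff_dvd)
  then have r: "r \<in> S" using PM by blast
  have assoc: "(x ** y) ** z = x ** (y ** z)" for x y z :: imat by (simp add: matrix_mul_assoc)
  have TT: "Tmat (mb q) ** Tmat (- mb q) = mk 1 0 0 1" "Umat (int N * i) ** Umat (int N * - i) = mk 1 0 0 1"
     "Tmat j ** Tmat (- j) = mk 1 0 0 1"
    by (auto intro!: imat_eqI simp: Tmat_def Umat_def)
  have "q = Tmat (mb q) ** r" unfolding r_def by (simp add: TT flip: assoc)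
  then have q: "q \<in> S" using r T S(1) by metis
  have "h = q ** w ** Umat (int N * - i)"
    unfolding q_def assoc using mult_sl2_inv[OF wS] TT
    by (metis assoc mk_id(1) mk_id(2))
  then have "h \<in> S" using q w U S(1) by metis
  moreover have "g = h ** Tmat (- j)" unfolding h_def assoc by (simp add: TT)
  ultimately show ?thesis using T S(1) by metis
qed

section \<open>Multipliers of absolute value 1 on \<Gamma>_1(N)\<close>

lemma upper_half_plane_facts: "open upper_half_plane" "connected upper_half_plane" "convex upper_half_plane"
proof -
  show "open upper_half_plane" unfolding upper_half_plane_def by (rule open_halfspace_Im_gt)
  show "convex upper_half_plane" unfolding upper_half_plane_def by (rule convex_halfspace_Im_gt)
  then show "connected upper_half_plane" by (rule convex_connected)
qed

text \<open>On a ball around a point with F nonzero, G/F is holomorphic of constant modulus, hence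
  constant by the maximum principle; the identity theorem carries G = x F to all of S.\<close>

lemma unimodular_ratio_constant:
  assumes F: "F holomorphic_on S" and G: "G holomorphic_on S" and S: "open S" "connected S"
    and eq: "\<And>z. z \<in> S \<Longrightarrow> norm (G z) = norm (F z)"
  shows "\<exists>x. norm x = 1 \<and> (\<forall>z\<in>S. G z = x * F z)"
proof (cases "\<forall>z\<in>S. F z = 0")
  case True
  then show ?thesis using eq by (intro exI[of _ 1]) auto
next
  case False
  then obtain w where w: "w \<in> S" "F w \<noteq> 0" by blast
  have "continuous_on S F" using F by (rule holomorphic_on_imp_continuous_on)
  then have "open {z \<in> S. F z \<in> - {0}}"
    using continuous_open_preimage[of S F "- {0}"] S(1) by (simp add: vimage_def Int_def open_Compl)
  then obtain e where e: "e > 0" "ball w e \<subseteq> {z \<in> S. F z \<in> - {0}}"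
    using w by (metis (no_types, lifting) ComplI mem_Collect_eq open_contains_ball singletonD)
  have eS: "ball w e \<subseteq> S" and nz: "\<And>z. z \<in> ball w e \<Longrightarrow> F z \<noteq> 0" using e by auto
  have "(\<lambda>z. G z / F z) constant_on ball w e"
  proof (rule maximum_modulus_principle[where U = "ball w e" and \<xi> = w])
    show "(\<lambda>z. G z / F z) holomorphic_on ball w e"
      using nz by (intro holomorphic_intros holomorphic_on_subset[OF F eS] holomorphic_on_subset[OF G eS]) auto
    fix z assume z: "z \<in> ball w e"
    then have "norm (G z / F z) = 1" using eq[of z] nz eS by (auto simp: norm_divide)
    moreover have "norm (G w / F w) = 1" using eq[of w] w by (auto simp: norm_divide)
    ultimately show "norm (G z / F z) \<le> norm (G w / F w)" by simp
  qed (use e in auto)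
  then obtain x where x: "\<And>z. z \<in> ball w e \<Longrightarrow> G z / F z = x" unfolding constant_on_def by blast
  have x': "G z = x * F z" if "z \<in> ball w e" for z using x[OF that] nz[OF that] by (simp add: field_simps)
  have "norm x = 1" using x[of w] e eq[of w] w by (auto simp: norm_divide)
  moreover have "G z = x * F z" if "z \<in> S" for z
  proof -
    have "G z - x * F z = 0"
    proof (rule analytic_continuation_open[where s = "ball w e" and s' = S and f = "\<lambda>z. G z - x * F z" and g = "\<lambda>_. 0"])
      show "(\<lambda>z. G z - x * F z) holomorphic_on S" by (intro holomorphic_intros F G)
    qed (use e eS S that x' in auto)
    then show ?thesis by simp
  qed
  ultimately show ?thesis by blast
qed

text \<open>The matrices acting by a unimodular scalar are closed under products and inverses. They
  include H by \<open>unimodular_ratio_constant\<close>, and T and U with scalar 1, so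
  \<open>Gamma1_decomposition\<close> applies to them.\<close>

lemma slash_scalar_Gamma1:
  assumes F: "F holomorphic_on upper_half_plane"
    and T: "\<And>z. Im z > 0 \<Longrightarrow> F (z + 1) = F z"
    and U: "\<And>z. Im z > 0 \<Longrightarrow> slash k F (Umat (int N)) z = F z"
    and H: "congruence_subgroup H"
    and HF: "\<forall>\<gamma>\<in>H. \<forall>z\<in>upper_half_plane. norm (slash k F \<gamma> z) = norm (F z)"
    and g: "g \<in> SL2Z" "int N dvd mc g" "md g mod int N = 1 mod int N"
  shows "\<exists>x. norm x = 1 \<and> slash_scalar k F g x"
proof -
  define S where "S = {g. \<exists>x. norm x = 1 \<and> slash_scalar k F g x}"
  obtain M where M: "M > 0" "principal_congruence M \<subseteq> H" and HS: "H \<subseteq> SL2Z"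
    using H unfolding congruence_subgroup_def by blast
  have HSub: "H \<subseteq> S"
  proof
    fix h assume h: "h \<in> H"
    have "\<exists>x. norm x = 1 \<and> (\<forall>z\<in>upper_half_plane. slash k F h z = x * F z)"
      using HF h HS
      by (intro unimodular_ratio_constant holomorphic_slash F upper_half_plane_facts) auto
    then show "h \<in> S" using h HS by (auto simp: S_def slash_scalar_def upper_half_plane_def)
  qed
  have mult: "g ** h \<in> S" if gS: "g \<in> S" and hS: "h \<in> S" for g h
  proof -
    obtain x y where "norm x = 1" "slash_scalar k F g x" "norm y = 1" "slash_scalar k F h y"
      using gS hS by (auto simp: S_def)
    then have "norm (x * y) = 1" "slash_scalar k F (g ** h) (x * y)"
      by (auto simp: norm_mult intro: slash_scalar_mult)
    then show ?thesis by (auto simp: S_def)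
  qed
  have inv: "sl2_inv g \<in> S" if gS: "g \<in> S" for g
  proof -
    obtain x where x: "norm x = 1" "slash_scalar k F g x" using gS by (auto simp: S_def)
    then have "slash_scalar k F (sl2_inv g) (inverse x)" by (intro slash_scalar_inv) auto
    moreover have "norm (inverse x) = 1" using x by (simp add: norm_inverse)
    ultimately show ?thesis by (auto simp: S_def)
  qed
  have powers: "P j \<in> S" if "P 1 \<in> S" "P 0 = mk 1 0 0 1" "\<And>i. P (- i) = sl2_inv (P i)" "\<And>i j. P (i + j) = P i ** P j"
    for P :: "int \<Rightarrow> imat" and j
  proof -
    have nat: "P (int n) \<in> S" for n
    proof (induction n)
      case 0
      have "mk 1 0 0 1 \<in> SL2Z" by (simp add: SL2Z_iff)
      then show ?case using that(2) by (auto simp: S_def slash_scalar_def slash_id intro: exI[of _ 1])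
    next
      case (Suc n)
      then show ?case using that(1) that(4)[of 1 "int n"] mult by simp
    qed
    show ?thesis
    proof (cases "j \<ge> 0")
      case True
      then show ?thesis using nat[of "nat j"] by simp
    next
      case False
      then show ?thesis using inv[OF nat[of "nat (- j)"]] that(3)[of "- j"] by simp
    qed
  qed
  have "Tmat 1 \<in> S"
    using T by (auto simp: S_def slash_scalar_def slash_Tmat intro!: exI[of _ 1])
  then have TS: "Tmat j \<in> S" for j
    by (rule powers[of Tmat]) (auto intro!: imat_eqI simp: Tmat_def)
  have "Umat (int N * 1) \<in> S"
    using U by (auto simp: S_def slash_scalar_def intro!: exI[of _ 1])
  then have US: "Umat (int N * j) \<in> S" for j
    by (rule powers[of "\<lambda>j. Umat (int N * j)"]) (auto intro!: imat_eqI simp: Umat_def algebra_simps)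
  have "g \<in> S"
    by (rule Gamma1_decomposition[OF g M(1) mult inv TS US])
       (use M HSub in \<open>auto simp: S_def slash_scalar_def\<close>)
  then show ?thesis by (auto simp: S_def)
qed

subsection \<open>Squarefree numbers in arithmetic progressions\<close>

text \<open>For \<open>d \<ge> 2\<close> at most \<open>X / d\<^sup>2 + 1\<close> of the first \<open>X\<close> terms of the progression are divisible by
  \<open>d\<^sup>2\<close>, and \<open>\<Sum>\<^bsub>d\<ge>2\<^esub> 1 / d\<^sup>2 \<le> 3 / 4\<close>.\<close>
lemma squarefree_in_progression:
  fixes a m :: nat
  assumes "coprime a m" "m > 0"
  shows "\<exists>j. squarefree (a + m * j)"
proof (cases "a + m * 0 = 0")
  \<comment> \<open>The term 0 is divisible by every d^2, so it is set aside: a = 0 forces m = 1,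
    and then 1 is in the progression.\<close>
  case True
  then have "m = 1" using assms by simp
  then show ?thesis using True by (intro exI[of _ 1]) (simp flip: One_nat_def)
next
  case False
  then have a0: "a > 0" by simp
  have bad_card: "real (card {j. j < X \<and> d\<^sup>2 dvd a + m * j}) \<le> real X / real d ^ 2 + 1" if d: "d \<ge> 2" for d X
  proof -
    let ?B = "{j. j < X \<and> d\<^sup>2 dvd a + m * j}"
    \<comment> \<open>d^2 is coprime to m, as a common divisor would divide a. So j is determined
      modulo d^2, and each block of d^2 consecutive indices contains at most one bad j.\<close>
    have inj: "inj_on (\<lambda>j. j div d\<^sup>2) ?B"
    proof (rule inj_onI)
      fix i j assume ij: "i \<in> ?B" "j \<in> ?B" "i div d\<^sup>2 = j div d\<^sup>2"
      have cop: "coprime (d\<^sup>2) m"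
      proof (rule coprimeI)
        fix l assume l: "l dvd d\<^sup>2" "l dvd m"
        then have "l dvd a + m * i" using ij(1) by (auto intro: dvd_trans)
        then have "l dvd a" using l(2) by (simp add: dvd_add_left_iff)
        then show "is_unit l" using assms(1) l(2) by (meson coprime_common_divisor)
      qed
      have "[a + m * i = a + m * j] (mod d\<^sup>2)" using ij by (simp add: cong_def mod_eq_0_iff_dvd)
      then have "[m * i = m * j] (mod d\<^sup>2)" using cong_add_lcancel_nat by blast
      then have "[i = j] (mod d\<^sup>2)" using cop by (simp add: cong_mult_lcancel_nat coprime_commute)
      then show "i = j" using ij(3) by (metis cong_def div_mult_mod_eq)
    qed
    have "card ?B = card ((\<lambda>j. j div d\<^sup>2) ` ?B)" using inj by (simp add: card_image)
    also have "\<dots> \<le> card {..X div d\<^sup>2}" by (intro card_mono) (auto simp: div_le_mono)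
    also have "\<dots> = X div d\<^sup>2 + 1" by simp
    finally have "real (card ?B) \<le> real (X div d\<^sup>2) + 1" by linarith
    also have "real (X div d\<^sup>2) \<le> real X / real (d\<^sup>2)" by (rule of_nat_div_le_of_nat)
    finally show ?thesis by simp
  qed
  have sum34: "(\<Sum>d=2..D. 1 / real d ^ 2) \<le> 3 / 4" for D
  proof -
    \<comment> \<open>The strengthening makes 1/(n+1)^2 \<le> 1/n - 1/(n+1) telescope; at D = 2 it
      is the equality 1/4 = 3/4 - 1/2.\<close>
    have *: "(\<Sum>d=2..D. 1 / real d ^ 2) \<le> 3 / 4 - 1 / real D" if "D \<ge> 2" for D
      using that
    proof (induction D rule: dec_induct)
      case (step n)
      have "1 / real (Suc n) ^ 2 \<le> 1 / real n - 1 / real (Suc n)"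
      proof -
        have n: "real n > 0" using step.hyps by simp
        have "1 / real (Suc n) ^ 2 \<le> 1 / (real n * real (Suc n))"
          using n by (intro divide_left_mono) (auto simp: power2_eq_square)
        also have "\<dots> = 1 / real n - 1 / real (Suc n)" using n by (simp add: field_simps)
        finally show ?thesis .
      qed
      then show ?case using step by simp
    qed simp
    show ?thesis
    proof (cases "D \<ge> 2")
      case True
      then have "(\<Sum>d=2..D. 1 / real d ^ 2) \<le> 3 / 4 - 1 / real D" by (rule *)
      also have "\<dots> \<le> 3 / 4" by simp
      finally show ?thesis .
    qed simp
  qed
  \<comment> \<open>If every term were bad, X/4 \<le> D \<le> sqrt(a + m X) would give X^2 \<le> 16
    (a + m X) \<le> 16 (a + m) X; X is chosen to exceed 16 (a + m).\<close>
  define X where "X = 16 * (a + m) + 16"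
  define D where "D = nat \<lfloor>sqrt (real (a + m * X))\<rfloor>"
  show ?thesis
  proof (rule ccontr)
    assume no: "\<not> ?thesis"
    have cover: "{..<X} \<subseteq> (\<Union>d\<in>{2..D}. {j. j < X \<and> d\<^sup>2 dvd a + m * j})"
    proof
      fix j assume j: "j \<in> {..<X}"
      obtain d where d: "d\<^sup>2 dvd a + m * j" "\<not> is_unit d" using no by (auto simp: squarefree_def)
      have "d \<noteq> 0" using d(1) a0 by (intro notI) simp
      moreover have "d \<noteq> 1" using d(2) by auto
      ultimately have d2: "d \<ge> 2" by simp
      have "d\<^sup>2 \<le> a + m * j" using d(1) a0 by (intro dvd_imp_le) auto
      also have "\<dots> \<le> a + m * X" using j by simp
      finally have "real d ^ 2 \<le> real (a + m * X)" by (metis of_nat_le_iff of_nat_power)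
      then have "real d \<le> sqrt (real (a + m * X))" by (rule real_le_rsqrt)
      then have "d \<le> D" unfolding D_def by linarith
      then show "j \<in> (\<Union>d\<in>{2..D}. {j. j < X \<and> d\<^sup>2 dvd a + m * j})" using j d(1) d2 by auto
    qed
    have "X \<le> card (\<Union>d\<in>{2..D}. {j. j < X \<and> d\<^sup>2 dvd a + m * j})"
      using card_mono[OF _ cover] by simp
    also have "\<dots> \<le> (\<Sum>d=2..D. card {j. j < X \<and> d\<^sup>2 dvd a + m * j})" by (rule card_UN_le) simp
    finally have "real X \<le> (\<Sum>d=2..D. real (card {j. j < X \<and> d\<^sup>2 dvd a + m * j}))"
      unfolding of_nat_sum[symmetric] by (rule of_nat_mono)
    also have "\<dots> \<le> (\<Sum>d=2..D. real X / real d ^ 2 + 1)" by (intro sum_mono bad_card) auto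
    also have "\<dots> = real X * (\<Sum>d=2..D. 1 / real d ^ 2) + real (card {2..D})"
      by (simp add: sum.distrib sum_distrib_left)
    also have "\<dots> \<le> real X * (3 / 4) + real D"
      by (intro add_mono mult_left_mono sum34) auto
    finally have "real X / 4 \<le> real D" by simp
    also have "real D \<le> sqrt (real (a + m * X))" unfolding D_def by simp
    finally have "(real X / 4)\<^sup>2 \<le> (sqrt (real (a + m * X)))\<^sup>2" by (intro power_mono) auto
    also have "\<dots> = real (a + m * X)" by simp
    finally have "real X * real X \<le> 16 * (real a + real m * real X)" by (simp add: power2_eq_square)
    also have "\<dots> \<le> 16 * (real a * real X + real m * real X)" using mult_left_mono[of 1 "real X" "real a"] by (simp add: X_def)
    also have "\<dots> = (16 * (real a + real m)) * real X" by (simp add: algebra_simps)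
    finally have "real X \<le> 16 * (real a + real m)" by (simp add: X_def)
    then show False by (simp add: X_def)
  qed
qed

subsection \<open>Functional equations of additive twists\<close>

text \<open>The exponent is natural to suit \<open>exp_series_term_bound\<close>, and the argument
  \<open>Suc n\<close> matches the indexing of \<open>qexp\<close>.\<close>

definition poly_bounded :: "(nat \<Rightarrow> complex) \<Rightarrow> bool" where
  "poly_bounded f \<longleftrightarrow> (\<exists>C p. \<forall>n. norm (f (Suc n)) \<le> C * real (Suc n) ^ p)"

lemma poly_boundedI_powr:
  assumes "\<exists>C. \<forall>n\<ge>1. norm (f n) \<le> C * real n powr \<sigma>"
  shows "poly_bounded f"
proof -
  obtain C where C: "\<And>n. n \<ge> 1 \<Longrightarrow> norm (f n) \<le> C * real n powr \<sigma>" using assms by blast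
  obtain p :: nat where p: "real p \<ge> \<sigma>" using real_arch_simple by blast
  have C0: "C \<ge> 0" using order_trans[OF norm_ge_zero C[of 1]] by simp
  have "norm (f (Suc n)) \<le> C * real (Suc n) ^ p" for n
  proof -
    have "real (Suc n) powr \<sigma> \<le> real (Suc n) powr real p" using p by (intro powr_mono) auto
    then have "C * real (Suc n) powr \<sigma> \<le> C * real (Suc n) ^ p"
      using C0 by (simp add: powr_realpow mult_left_mono del: of_nat_Suc)
    then show ?thesis using C[of "Suc n"] by linarith
  qed
  then show ?thesis unfolding poly_bounded_def by blast
qed

lemma norm_ee: "norm (ee z) = exp (- 2 * pi * Im z)"
  by (simp add: ee_def)

lemma ee_add: "ee (z + w) = ee z * ee w"
  by (simp add: ee_def distrib_left exp_add)

lemma ee_of_nat [simp]: "ee (of_nat n) = 1"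
proof -
  have "ee (of_nat n) = cis (2 * pi * real n)" by (simp add: ee_def cis_conv_exp mult_ac)
  then show ?thesis by simp
qed

lemma norm_ramanujan_sum: "norm (ramanujan_sum q n) \<le> real q"
proof -
  let ?A = "{a. 1 \<le> a \<and> a \<le> q \<and> coprime a q}"
  have "norm (ramanujan_sum q n) \<le> (\<Sum>a\<in>?A. 1)"
    unfolding ramanujan_sum_def by (rule sum_norm_le) (simp add: norm_ee)
  also have "\<dots> = real (card ?A)" by simp
  also have "card ?A \<le> card {1..q}" by (intro card_mono) auto
  finally show ?thesis by simp
qed

lemma poly_bounded_twist:
  assumes "poly_bounded f"
  shows "poly_bounded (\<lambda>n. f n * ramanujan_sum q n)"
proof -
  obtain C p where C: "\<And>n. norm (f (Suc n)) \<le> C * real (Suc n) ^ p" using assms by (auto simp: poly_bounded_def)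
  have "norm (f (Suc n) * ramanujan_sum q (Suc n)) \<le> (C * real q) * real (Suc n) ^ p" for n
  proof -
    have "norm (f (Suc n) * ramanujan_sum q (Suc n)) \<le> (C * real (Suc n) ^ p) * real q"
      unfolding norm_mult using C[of n] by (intro mult_mono C norm_ramanujan_sum order_trans[OF norm_ge_zero C]) auto
    then show ?thesis by (simp add: mult_ac)
  qed
  then show ?thesis unfolding poly_bounded_def by blast
qed

lemma qexp_term_bound:
  assumes f: "poly_bounded f"
  obtains C p where "C \<ge> 0" "\<And>m n z. m \<ge> p + 2 \<Longrightarrow> Im z > 0 \<Longrightarrow>
     norm (f (Suc n) * ee (of_nat (Suc n) * z)) \<le> (C * fact m * inverse (real (Suc n) ^ 2)) * inverse (Im z) ^ m"
proof -
  obtain C p where C: "\<And>n. norm (f (Suc n)) \<le> C * real (Suc n) ^ p" using f by (auto simp: poly_bounded_def)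
  have C0: "C \<ge> 0" using order_trans[OF norm_ge_zero C[of 0]] by simp
  have "norm (f (Suc n) * ee (of_nat (Suc n) * z)) \<le> (C * fact m * inverse (real (Suc n) ^ 2)) * inverse (Im z) ^ m"
    if m: "m \<ge> p + 2" and z: "Im z > 0" for m n z
  proof -
    have "norm (f (Suc n) * ee (of_nat (Suc n) * z)) = norm (f (Suc n)) * exp (- (2 * pi * real (Suc n)) * Im z)"
      by (simp add: norm_mult norm_ee mult_ac)
    also have "\<dots> \<le> (C * fact m / (2 * pi) ^ m * inverse (real (Suc n) ^ 2)) * inverse (Im z) ^ m"
      by (rule exp_series_term_bound[OF _ C m z]) simp
    also have "\<dots> \<le> (C * fact m * inverse (real (Suc n) ^ 2)) * inverse (Im z) ^ m"
    proof (intro mult_right_mono)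
      have "(1::real) \<le> (2 * pi) ^ m" using pi_gt3 by (intro one_le_power) auto
      then show "C * fact m / (2 * pi) ^ m \<le> C * fact m" using C0 mult_left_mono[of 1 "(2 * pi) ^ m" "C * fact m"] by (simp add: divide_le_eq)
    qed (use z in auto)
    finally show ?thesis .
  qed
  with C0 show thesis by (rule that)
qed

lemma summable_qexp:
  assumes "poly_bounded f" "Im z > 0"
  shows "summable (\<lambda>n. norm (f (Suc n) * ee (of_nat (Suc n) * z)))"
proof -
  obtain C p where C: "C \<ge> 0" "\<And>m n z. m \<ge> p + 2 \<Longrightarrow> Im z > 0 \<Longrightarrow>
     norm (f (Suc n) * ee (of_nat (Suc n) * z)) \<le> (C * fact m * inverse (real (Suc n) ^ 2)) * inverse (Im z) ^ m"
    using qexp_term_bound[OF assms(1)] by metis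
  show ?thesis
    by (rule summable_comparison_test'[OF summable_mult2[OF summable_exp_series_bound[of "C * fact (p + 2)"], of "inverse (Im z) ^ (p + 2)"]])
       (use C(2)[OF order_refl assms(2)] in simp)
qed

text \<open>Moderate growth towards the real line; transported by a matrix it becomes polynomial
  growth of \<open>slash\<close>, needed at the cusps.\<close>

lemma qexp_bound:
  assumes "poly_bounded f"
  shows "\<exists>p. \<forall>m\<ge>p. \<exists>D\<ge>0. \<forall>z. Im z > 0 \<longrightarrow> norm (qexp f z) \<le> D * inverse (Im z) ^ m"
proof -
  obtain C p where C: "C \<ge> 0" "\<And>m n z. m \<ge> p + 2 \<Longrightarrow> Im z > 0 \<Longrightarrow>
     norm (f (Suc n) * ee (of_nat (Suc n) * z)) \<le> (C * fact m * inverse (real (Suc n) ^ 2)) * inverse (Im z) ^ m"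
    using qexp_term_bound[OF assms(1)] by metis
  have "\<exists>D\<ge>0. \<forall>z. Im z > 0 \<longrightarrow> norm (qexp f z) \<le> D * inverse (Im z) ^ m" if m: "m \<ge> p + 2" for m
  proof (intro exI conjI allI impI)
    let ?c = "\<lambda>n. C * fact m * inverse (real (Suc n) ^ 2)"
    show "suminf ?c \<ge> 0" using C(1) by (intro suminf_nonneg summable_exp_series_bound) auto
    fix z assume z: "Im z > 0"
    show "norm (qexp f z) \<le> suminf ?c * inverse (Im z) ^ m"
      unfolding qexp_def suminf_mult2[OF summable_exp_series_bound]
      by (intro norm_suminf_le C(2) m z summable_mult2 summable_exp_series_bound)
  qed
  then show ?thesis by blast
qed

lemma holomorphic_qexp:
  assumes "poly_bounded f"
  shows "qexp f holomorphic_on upper_half_plane"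
proof (rule holomorphic_uniform_sequence[where f = "\<lambda>n z. \<Sum>i<n. f (Suc i) * ee (of_nat (Suc i) * z)"])
  show "open upper_half_plane" by (rule upper_half_plane_facts)
  show "(\<lambda>z. \<Sum>i<n. f (Suc i) * ee (of_nat (Suc i) * z)) holomorphic_on upper_half_plane" for n
    unfolding ee_def by (intro holomorphic_intros)
  fix x assume "x \<in> upper_half_plane"
  then have x: "Im x > 0" by (simp add: upper_half_plane_def)
  obtain C p where C: "C \<ge> 0" "\<And>m n z. m \<ge> p + 2 \<Longrightarrow> Im z > 0 \<Longrightarrow>
     norm (f (Suc n) * ee (of_nat (Suc n) * z)) \<le> (C * fact m * inverse (real (Suc n) ^ 2)) * inverse (Im z) ^ m"
    using qexp_term_bound[OF assms(1)] by metis
  have im: "Im z \<ge> Im x / 2" if "z \<in> cball x (Im x / 2)" for z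
    using that abs_Im_le_cmod[of "x - z"] by (auto simp: dist_norm)
  show "\<exists>d>0. cball x d \<subseteq> upper_half_plane \<and>
      uniform_limit (cball x d) (\<lambda>n z. \<Sum>i<n. f (Suc i) * ee (of_nat (Suc i) * z)) (qexp f) sequentially"
  proof (intro exI conjI)
    show "Im x / 2 > 0" using x by simp
    show "cball x (Im x / 2) \<subseteq> upper_half_plane" using im x by (force simp: upper_half_plane_def)
    show "uniform_limit (cball x (Im x / 2)) (\<lambda>n z. \<Sum>i<n. f (Suc i) * ee (of_nat (Suc i) * z)) (qexp f) sequentially"
      unfolding qexp_def[abs_def]
    proof (rule Weierstrass_m_test)
      show "summable (\<lambda>n. (C * fact (p + 2) * inverse (real (Suc n) ^ 2)) * inverse (Im x / 2) ^ (p + 2))"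
        by (intro summable_mult2 summable_exp_series_bound)
      fix n z assume z: "z \<in> cball x (Im x / 2)"
      then have z0: "Im z > 0" using im x by force
      have "inverse (Im z) ^ (p + 2) \<le> inverse (Im x / 2) ^ (p + 2)"
        using im[OF z] x z0 by (intro power_mono le_imp_inverse_le) auto
      then have "(C * fact (p + 2) * inverse (real (Suc n) ^ 2)) * inverse (Im z) ^ (p + 2)
         \<le> (C * fact (p + 2) * inverse (real (Suc n) ^ 2)) * inverse (Im x / 2) ^ (p + 2)"
        using C(1) by (intro mult_left_mono) auto
      with C(2)[OF order_refl z0, of n]
      show "norm (f (Suc n) * ee (of_nat (Suc n) * z)) \<le> (C * fact (p + 2) * inverse (real (Suc n) ^ 2)) * inverse (Im x / 2) ^ (p + 2)"
        by linarith
    qed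
  qed
qed

lemma qexp_periodic: "qexp f (z + of_nat j) = qexp f z"
proof -
  have "ee (of_nat (Suc n) * (z + of_nat j)) = ee (of_nat (Suc n) * z)" for n
    unfolding distrib_left ee_add of_nat_mult[symmetric] ee_of_nat by simp
  then show ?thesis by (simp only: qexp_def)
qed

lemma ramanujan_sum_totatives: "ramanujan_sum q n = (\<Sum>a\<in>totatives q. ee (of_nat (a * n) / of_nat q))"
  by (simp add: ramanujan_sum_def totatives_def Suc_le_eq conj_assoc)

text \<open>The only totative of 1 is 1 itself, so \<open>twist F 1 z\<close> is F(z + 1), which
  equals F(z) by periodicity.\<close>

definition twist :: "(complex \<Rightarrow> complex) \<Rightarrow> nat \<Rightarrow> complex \<Rightarrow> complex" where
  "twist F q z = (\<Sum>a\<in>totatives q. F (z + of_nat a / of_nat q))"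

lemma twist_qexp:
  assumes "poly_bounded f" "Im z > 0"
  shows "twist (qexp f) q z = qexp (\<lambda>n. f n * ramanujan_sum q n) z"
proof -
  have s: "summable (\<lambda>n. f (Suc n) * ee (of_nat (Suc n) * (z + of_nat a / of_nat q)))" for a
    using assms by (intro summable_norm_cancel[OF summable_qexp]) auto
  have "twist (qexp f) q z = (\<Sum>n. \<Sum>a\<in>totatives q. f (Suc n) * ee (of_nat (Suc n) * (z + of_nat a / of_nat q)))"
    unfolding twist_def qexp_def by (rule suminf_sum[symmetric]) (rule s)
  also have "\<dots> = qexp (\<lambda>n. f n * ramanujan_sum q n) z"
    unfolding qexp_def
  proof (rule suminf_cong)
    fix n
    have "ee (of_nat (Suc n) * (z + of_nat a / of_nat q)) = ee (of_nat (a * Suc n) / of_nat q) * ee (of_nat (Suc n) * z)" for a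
      by (simp add: distrib_left ee_add mult_ac del: of_nat_Suc mult_Suc mult_Suc_right)
    then show "(\<Sum>a\<in>totatives q. f (Suc n) * ee (of_nat (Suc n) * (z + of_nat a / of_nat q)))
        = f (Suc n) * ramanujan_sum q (Suc n) * ee (of_nat (Suc n) * z)"
      by (simp add: ramanujan_sum_totatives sum_distrib_left sum_distrib_right mult_ac del: of_nat_Suc)
  qed
  finally show ?thesis .
qed

text \<open>The exponent \<rho> is an arbitrary real number, so inside the unit disc
  \<open>norm z powr \<rho>\<close> need not be dominated by a natural power; there compactness
  supplies the bound.\<close>

lemma entire_finite_order_imp:
  assumes "entire_finite_order F"
  shows "\<exists>A m. A \<ge> 0 \<and> (\<forall>z. norm (F z) \<le> A * exp (norm z ^ m))"
proof -
  obtain \<rho> A where A: "\<And>z. norm (F z) \<le> A * exp (norm z powr \<rho>)" and h: "F holomorphic_on UNIV"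
    using assms unfolding entire_finite_order_def by blast
  obtain m :: nat where m: "real m \<ge> \<rho>" using real_arch_simple by blast
  have "compact (F ` cball 0 1)"
    using h by (intro compact_continuous_image holomorphic_on_imp_continuous_on[OF holomorphic_on_subset]) auto
  then obtain B where "\<forall>y\<in>F ` cball 0 1. norm y \<le> B"
    using compact_imp_bounded[of "F ` cball 0 1"] unfolding bounded_iff by blast
  then have B: "norm (F z) \<le> B" if "norm z \<le> 1" for z using that by simp
  have B0: "B \<ge> 0" using order_trans[OF norm_ge_zero B[of 0]] by simp
  have "norm (F z) \<le> (\<bar>A\<bar> + B) * exp (norm z ^ m)" for z
  proof (cases "norm z \<le> 1")
    case True
    have "B * 1 \<le> (\<bar>A\<bar> + B) * exp (norm z ^ m)" using B0 by (intro mult_mono) auto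
    then show ?thesis using B[OF True] by simp
  next
    case False
    then have "norm z powr \<rho> \<le> norm z powr real m" using m by (intro powr_mono) auto
    then have "exp (norm z powr \<rho>) \<le> exp (norm z ^ m)" using False by (subst (asm) powr_realpow) auto
    then have "A * exp (norm z powr \<rho>) \<le> (\<bar>A\<bar> + B) * exp (norm z ^ m)" using B0 by (intro mult_mono) auto
    then show ?thesis using A[of z] by linarith
  qed
  then show ?thesis using B0 by (intro exI[of _ "\<bar>A\<bar> + B"] exI[of _ m]) auto
qed

text \<open>With M = N q^2 and c = (k-1)/2 this normalisation turns the functional equation into
  \<Phi>(s) = \<epsilon> \<Psi>(k - s), as \<open>hecke_inversion\<close> expects.\<close>

lemma strip_finite_order_scaled:
  assumes F: "entire_finite_order F" and M: "M > (0::real)"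
  shows "strip_finite_order (\<lambda>s. of_real M powr (s / 2) * F (s - c) / 2)"
  unfolding strip_finite_order_def
proof
  fix R :: real
  obtain A m where A: "A \<ge> 0" "\<And>z. norm (F z) \<le> A * exp (norm z ^ m)"
    using entire_finite_order_imp[OF F] by blast
  define K where "K = exp (\<bar>R\<bar> * \<bar>ln M\<bar>)"
  have "norm (of_real M powr (s / 2) * F (s - c) / 2) \<le> (K * A) * exp ((\<bar>Im s\<bar> + (\<bar>R\<bar> + norm c)) ^ m)"
    if s: "\<bar>Re s\<bar> \<le> R" for s
  proof -
    have "norm (s - c) \<le> \<bar>Im s\<bar> + (\<bar>R\<bar> + norm c)"
      using cmod_le[of s] norm_triangle_ineq4[of s c] s by linarith
    then have "norm (s - c) ^ m \<le> (\<bar>Im s\<bar> + (\<bar>R\<bar> + norm c)) ^ m" by (intro power_mono) auto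
    then have "A * exp (norm (s - c) ^ m) \<le> A * exp ((\<bar>Im s\<bar> + (\<bar>R\<bar> + norm c)) ^ m)"
      using A(1) by (intro mult_left_mono) auto
    then have 1: "norm (F (s - c)) \<le> A * exp ((\<bar>Im s\<bar> + (\<bar>R\<bar> + norm c)) ^ m)"
      using A(2)[of "s - c"] by linarith
    have "norm (of_real M powr (s / 2) :: complex) = exp (Re s / 2 * ln M)"
      using M by (simp add: norm_powr_real)
    also have "\<dots> \<le> K"
    proof -
      have "Re s / 2 * ln M \<le> \<bar>Re s / 2\<bar> * \<bar>ln M\<bar>" by (metis abs_ge_self abs_mult)
      also have "\<dots> \<le> \<bar>R\<bar> * \<bar>ln M\<bar>" using s by (intro mult_right_mono) auto
      finally show ?thesis by (simp add: K_def)
    qed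
    finally have "norm (of_real M powr (s / 2) * F (s - c)) \<le> K * (A * exp ((\<bar>Im s\<bar> + (\<bar>R\<bar> + norm c)) ^ m))"
      unfolding norm_mult using 1 by (intro mult_mono) (auto simp: K_def)
    moreover have "norm (of_real M powr (s / 2) * F (s - c) / 2) \<le> norm (of_real M powr (s / 2) * F (s - c))"
      by (simp add: norm_divide)
    ultimately show ?thesis by (simp only: mult.assoc)
  qed
  then show "\<exists>A c' m. c' \<ge> 0 \<and> (\<forall>s. \<bar>Re s\<bar> \<le> R \<longrightarrow>
        norm (of_real M powr (s / 2) * F (s - c) / 2) \<le> A * exp ((\<bar>Im s\<bar> + c') ^ m))"
    by (intro exI[of _ "K * A"] exI[of _ "\<bar>R\<bar> + norm c"] exI[of _ m]) auto
qed

lemma summable_dirichlet_series: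
  assumes a: "\<And>n. norm (a (Suc n)) \<le> C * real (Suc n) ^ p" and s: "Re s \<ge> real p + 2"
  shows "summable (\<lambda>n. a (Suc n) * of_nat (Suc n) powr (- s))"
proof (rule summable_comparison_test'[OF summable_exp_series_bound[of C]])
  fix n
  have C0: "C \<ge> 0" using order_trans[OF norm_ge_zero a[of 0]] by simp
  have "norm (of_nat (Suc n) powr (- s) :: complex) = real (Suc n) powr (- Re s)"
    using norm_powr_real_powr[of "of_real (real (Suc n))" "- s"] by (simp del: of_nat_Suc)
  also have "\<dots> \<le> real (Suc n) powr (- real (p + 2))" using s by (intro powr_mono) auto
  also have "\<dots> = inverse (real (Suc n) ^ (p + 2))" by (simp add: powr_minus powr_realpow del: of_nat_Suc power_Suc add_2_eq_Suc' of_nat_add)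
  finally have "norm (a (Suc n) * of_nat (Suc n) powr (- s)) \<le> (C * real (Suc n) ^ p) * inverse (real (Suc n) ^ (p + 2))"
    unfolding norm_mult using C0 by (intro mult_mono a) auto
  also have "\<dots> = C * inverse (real (Suc n) ^ 2)"
    by (simp add: power_add field_simps del: of_nat_Suc power_Suc add_2_eq_Suc')
  finally show "norm (a (Suc n) * of_nat (Suc n) powr (- s)) \<le> C * inverse (real (Suc n) ^ 2)" .
qed

text \<open>Absorbing M^(s/2) (2\<pi>)^(-s) into the n-th term turns the frequencies into
  2\<pi>(n+1)/sqrt M; the division by 2 cancels the constant of \<open>GammaC\<close>.\<close>

lemma Lambda_tw_eq:
  assumes M: "M > (0::real)"
    and sm: "summable (\<lambda>n. f (Suc n) * ramanujan_sum q (Suc n) * of_nat (Suc n) powr (- s))"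
  shows "of_real M powr (s / 2) * Lambda_tw k f q (s - (of_nat k - 1) / 2) / 2 =
     Gamma s * (\<Sum>n. f (Suc n) * ramanujan_sum q (Suc n) * of_real (2 * pi / sqrt M * real (Suc n)) powr (- s))"
proof -
  have "of_real (2 * pi / sqrt M * real (Suc n)) powr (- s)
      = of_real M powr (s / 2) * of_real (2 * pi) powr (- s) * of_nat (Suc n) powr (- s)" for n
  proof -
    have "of_real (2 * pi / sqrt M * real (Suc n)) powr (- s) = exp (- s * of_real (ln (2 * pi / sqrt M * real (Suc n))))"
      using M by (simp add: powr_def Ln_of_real del: of_nat_Suc of_real_mult of_real_divide)
    also have "ln (2 * pi / sqrt M * real (Suc n)) = ln (2 * pi) - ln M / 2 + ln (real (Suc n))"
      using M by (simp add: ln_mult ln_div ln_sqrt del: of_nat_Suc)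
    also have "exp (- s * of_real (ln (2 * pi) - ln M / 2 + ln (real (Suc n)))) =
        exp (s / 2 * of_real (ln M)) * exp (- s * of_real (ln (2 * pi))) * exp (- s * of_real (ln (real (Suc n))))"
      by (simp add: exp_add[symmetric] algebra_simps del: of_nat_Suc)
    also have "exp (s / 2 * of_real (ln M)) = of_real M powr (s / 2)"
      using M by (simp add: powr_def Ln_of_real)
    also have "exp (- s * of_real (ln (2 * pi))) = of_real (2 * pi) powr (- s)"
      unfolding powr_def by (subst Ln_of_real) auto
    also have "exp (- s * of_real (ln (real (Suc n)))) = of_nat (Suc n) powr (- s)"
      using Ln_of_real[of "real (Suc n)"] unfolding powr_def by (simp del: of_nat_Suc)
    finally show ?thesis .
  qed
  then have t: "f (Suc n) * ramanujan_sum q (Suc n) * of_real (2 * pi / sqrt M * real (Suc n)) powr (- s) =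
     (of_real M powr (s / 2) * of_real (2 * pi) powr (- s)) * (f (Suc n) * ramanujan_sum q (Suc n) * of_nat (Suc n) powr (- s))" for n
    by (simp only: mult_ac)
  have nz: "of_real M powr (s / 2) * of_real (2 * pi) powr (- s) \<noteq> (0::complex)" using M by simp
  have "Lambda_tw k f q (s - (of_nat k - 1) / 2) = GammaC s * (\<Sum>n. f (Suc n) * ramanujan_sum q (Suc n) * of_nat (Suc n) powr (- s))"
    unfolding Lambda_tw_def by simp
  moreover have "(\<Sum>n. (of_real M powr (s / 2) * of_real (2 * pi) powr (- s)) * (f (Suc n) * ramanujan_sum q (Suc n) * of_nat (Suc n) powr (- s)))
      = (of_real M powr (s / 2) * of_real (2 * pi) powr (- s)) * (\<Sum>n. f (Suc n) * ramanujan_sum q (Suc n) * of_nat (Suc n) powr (- s))"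
    by (rule suminf_mult[OF sm])
  ultimately show ?thesis unfolding t GammaC_def by (simp add: mult_ac)
qed

lemma Im_neg_inverse_pos:
  assumes "M > 0" "Im w > 0"
  shows "Im (- 1 / (of_real M * w)) > 0"
proof -
  have "w \<noteq> 0" using assms(2) by auto
  have "- 1 / (of_real M * w) = of_real (1 / M) * (- 1 / w)" by simp
  also have "Im \<dots> = 1 / M * (Im w / (norm w)\<^sup>2)"
    by (subst complex_div_cnj) (simp add: cmod_def Im_divide_of_real flip: of_real_power)
  finally show ?thesis using assms \<open>w \<noteq> 0\<close> by simp
qed

text \<open>\<open>hecke_inversion\<close> yields the identity at z = i v/sqrt(N q^2) for 0 < v
  \<le> 1, and the identity theorem extends it to the upper half plane.\<close>

lemma twist_functional_equation:
  assumes N: "N \<ge> 1" and q: "q \<ge> 1" and k: "k > 0" and f: "poly_bounded f" and g: "poly_bounded g"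
    and F: "entire_finite_order F" and G: "entire_finite_order G"
    and FL: "\<And>s. Re s > \<sigma> + 1 - (real k - 1) / 2 \<Longrightarrow> F s = Lambda_tw k f q s"
    and GL: "\<And>s. Re s > \<sigma> + 1 - (real k - 1) / 2 \<Longrightarrow> G s = Lambda_tw k g q s"
    and fe: "\<And>s. F s = \<i> ^ k * x * (of_nat (N * q\<^sup>2)) powr (1/2 - s) * G (1 - s)"
    and z: "Im z > 0"
  shows "twist (qexp f) q z = (-1) ^ k * x / (of_real (sqrt (real N)) * of_nat q * z) ^ k * twist (qexp g) q (- 1 / (of_nat (N * q\<^sup>2) * z))"
proof -
  define M where "M = real (N * q\<^sup>2)"
  have M: "M > 0" using N q by (simp add: M_def)
  define L where "L = 2 * pi / sqrt M"
  have L: "L > 0" using M by (simp add: L_def)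
  define \<Phi> where "\<Phi> = (\<lambda>s. of_real M powr (s / 2) * F (s - (of_nat k - 1) / 2) / 2)"
  define \<Psi> where "\<Psi> = (\<lambda>s. of_real M powr (s / 2) * G (s - (of_nat k - 1) / 2) / 2)"
  define a where "a = (\<lambda>n. f n * ramanujan_sum q n)"
  define b where "b = (\<lambda>n. g n * ramanujan_sum q n)"
  have ab: "poly_bounded a" "poly_bounded b" using f g by (simp_all add: a_def b_def poly_bounded_twist)
  obtain Ca pa where Ca: "\<And>n. norm (a (Suc n)) \<le> Ca * real (Suc n) ^ pa" using ab(1) by (auto simp: poly_bounded_def)
  obtain Cb pb where Cb: "\<And>n. norm (b (Suc n)) \<le> Cb * real (Suc n) ^ pb" using ab(2) by (auto simp: poly_bounded_def)
  have C0: "Ca \<ge> 0" "Cb \<ge> 0" using order_trans[OF norm_ge_zero Ca[of 0]] order_trans[OF norm_ge_zero Cb[of 0]] by simp_all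
  have a': "norm (a (Suc n)) \<le> (Ca + Cb) * real (Suc n) ^ (pa + pb)" for n
    using order_trans[OF Ca[of n], of "(Ca + Cb) * real (Suc n) ^ (pa + pb)"] C0
    by (simp add: mult_mono power_increasing del: of_nat_Suc)
  have b': "norm (b (Suc n)) \<le> (Ca + Cb) * real (Suc n) ^ (pa + pb)" for n
    using order_trans[OF Cb[of n], of "(Ca + Cb) * real (Suc n) ^ (pa + pb)"] C0
    by (simp add: mult_mono power_increasing del: of_nat_Suc)
  have FG: "F holomorphic_on UNIV" "G holomorphic_on UNIV" using F G by (auto simp: entire_finite_order_def)
  have hol: "\<Phi> holomorphic_on UNIV"
  proof -
    have "(\<lambda>s. F (s - (of_nat k - 1) / 2)) holomorphic_on UNIV"
      by (rule holomorphic_on_compose_gen[OF _ FG(1), unfolded o_def]) (auto intro!: holomorphic_intros)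
    then show ?thesis unfolding \<Phi>_def using M by (intro holomorphic_intros) auto
  qed
  have key: "exp_series L (\<lambda>n. a (Suc n)) v = (\<i> ^ k * x) * of_real v powr (- of_nat k) * exp_series L (\<lambda>n. b (Suc n)) (1 / v)"
    if v: "0 < v" "v \<le> 1" for v
  proof (rule hecke_inversion[OF L a' b' hol, where K = "max (\<sigma> + 1) (real (pa + pb) + 2)" and \<Psi> = \<Psi>])
    show "strip_finite_order \<Phi>" unfolding \<Phi>_def by (rule strip_finite_order_scaled[OF F M])
    fix s :: complex
    show "\<Phi> s = Gamma s * (\<Sum>n. a (Suc n) * of_real (L * real (Suc n)) powr (- s))" if s: "Re s > max (\<sigma> + 1) (real (pa + pb) + 2)"
    proof -
      have "F (s - (of_nat k - 1) / 2) = Lambda_tw k f q (s - (of_nat k - 1) / 2)" using s by (intro FL) simp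
      then show ?thesis unfolding \<Phi>_def a_def L_def using Lambda_tw_eq[OF M summable_dirichlet_series[OF a'[unfolded a_def]], of s k] s by simp
    qed
    show "\<Psi> s = Gamma s * (\<Sum>n. b (Suc n) * of_real (L * real (Suc n)) powr (- s))" if s: "Re s > max (\<sigma> + 1) (real (pa + pb) + 2)"
    proof -
      have "G (s - (of_nat k - 1) / 2) = Lambda_tw k g q (s - (of_nat k - 1) / 2)" using s by (intro GL) simp
      then show ?thesis unfolding \<Psi>_def b_def L_def using Lambda_tw_eq[OF M summable_dirichlet_series[OF b'[unfolded b_def]], of s k] s by simp
    qed
    show "\<Phi> s = (\<i> ^ k * x) * \<Psi> (of_nat k - s)"
    proof -
      have e1: "1 - (s - (of_nat k - 1) / 2) = of_nat k - s - (of_nat k - 1) / 2" by (simp add: field_simps)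
      have e2: "s / 2 + (1/2 - (s - (of_nat k - 1) / 2)) = (of_nat k - s) / 2" by (simp add: field_simps)
      have "of_nat (N * q\<^sup>2) = complex_of_real M" by (simp add: M_def)
      then have "\<Phi> s = (\<i> ^ k * x) * (of_real M powr (s / 2) * of_real M powr (1/2 - (s - (of_nat k - 1) / 2))) * G (of_nat k - s - (of_nat k - 1) / 2) / 2"
        unfolding \<Phi>_def fe e1 by (simp only: mult_ac)
      then show ?thesis unfolding \<Psi>_def powr_add[symmetric] e2 by (simp add: mult_ac)
    qed
  qed (use v in auto)
  have es: "exp_series L (\<lambda>n. c (Suc n)) v = qexp c (\<i> * of_real (v / sqrt M))" for c v
  proof -
    have "of_real (exp (- (L * real (Suc n)) * v)) = ee (of_nat (Suc n) * (\<i> * of_real (v / sqrt M)))" for n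
      by (simp add: ee_def L_def exp_of_real[symmetric] mult_ac del: of_nat_Suc)
    then show ?thesis by (simp only: exp_series_def qexp_def)
  qed
  define Q where "Q = complex_of_real (sqrt (real N)) * of_nat q"
  have Q: "Q = of_real (sqrt M)" by (simp add: Q_def M_def real_sqrt_mult)
  have Q0: "Q \<noteq> 0" using M by (simp add: Q)
  have Mc: "of_nat (N * q\<^sup>2) = complex_of_real M" by (simp add: M_def)
  have Q2: "Q ^ 2 = of_real M" unfolding Q using M by (simp flip: of_real_power)
  define D where "D = (\<lambda>z. qexp a z - (-1) ^ k * x / (Q * z) ^ k * qexp b (- 1 / (Q ^ 2 * z)))"
  have Dseg: "D (\<i> * of_real (v / sqrt M)) = 0" if v: "0 < v" "v \<le> 1" for v
  proof -
    have 1: "Q * (\<i> * of_real (v / sqrt M)) = \<i> * of_real v" using M by (simp add: Q field_simps)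
    have 2: "- 1 / (Q ^ 2 * (\<i> * of_real (v / sqrt M))) = \<i> * of_real ((1 / v) / sqrt M)"
    proof -
      have "- 1 / (Q ^ 2 * (\<i> * of_real (v / sqrt M))) = - 1 / (Q * (\<i> * of_real v))"
        by (simp only: 1 power2_eq_square mult.assoc)
      also have "\<dots> = \<i> / (Q * of_real v)" by (simp add: divide_simps)
      finally show ?thesis by (simp add: Q field_simps)
    qed
    \<comment> \<open>Since i^k = (-1)^k / i^k, the factor i^k v^(-k) is the value of (-1)^k (Q
      z)^(-k) on the segment, an expression holomorphic in z.\<close>
    have 3: "\<i> ^ k * x * of_real v powr (- of_nat k) = (-1) ^ k * x / (\<i> * of_real v) ^ k"
    proof -
      have "of_real v powr (- of_nat k) = (1 / of_real v ^ k :: complex)"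
        using v by (simp add: powr_minus powr_nat divide_inverse)
      moreover have "(-1) ^ k = \<i> ^ k * (\<i> ^ k :: complex)" by (simp flip: power_mult_distrib)
      ultimately show ?thesis using v by (simp add: power_mult_distrib field_simps)
    qed
    show ?thesis unfolding D_def 1 2 using key[OF v] unfolding es 3 by simp
  qed
  have Dhol: "D holomorphic_on upper_half_plane"
  proof -
    have im: "Im (- 1 / (Q ^ 2 * w)) > 0" if "Im w > 0" for w
      unfolding Q2 by (rule Im_neg_inverse_pos[OF M that])
    have "(\<lambda>w. qexp b (- 1 / (Q ^ 2 * w))) holomorphic_on upper_half_plane"
      by (rule holomorphic_on_compose_gen[OF _ holomorphic_qexp[OF ab(2)], unfolded o_def])
         (use im Q0 in \<open>auto intro!: holomorphic_intros simp: upper_half_plane_def\<close>)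
    then show ?thesis
      unfolding D_def using Q0 by (intro holomorphic_intros holomorphic_qexp ab) (auto simp: upper_half_plane_def)
  qed
  have "D z = 0"
  proof (rule analytic_continuation[OF Dhol upper_half_plane_facts(1,2)])
    let ?U = "(\<lambda>v. \<i> * of_real (v / sqrt M)) ` {0<..1}"
    show "?U \<subseteq> upper_half_plane" using M by (auto simp: upper_half_plane_def)
    show "\<i> * of_real ((1/2) / sqrt M) \<in> upper_half_plane" using M by (auto simp: upper_half_plane_def)
    show "D w = 0" if "w \<in> ?U" for w using that Dseg by auto
    show "z \<in> upper_half_plane" using z by (simp add: upper_half_plane_def)
    show "(\<i> * of_real ((1/2) / sqrt M)) islimpt ?U"
    proof (rule connected_imp_perfect)
      have "continuous_on {0<..1} (\<lambda>v. \<i> * complex_of_real (v / sqrt M))"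
        using M by (intro continuous_intros) auto
      then show "connected ?U" by (rule connected_continuous_image) simp
      show "\<i> * of_real ((1/2) / sqrt M) \<in> ?U" by (intro imageI) simp
      have in_U: "\<i> * of_real (1 / sqrt M) \<in> ?U" by (intro imageI) simp
      show "?U \<noteq> {w}" for w
      proof
        assume "?U = {w}"
        then have "\<i> * of_real (1 / sqrt M) = \<i> * complex_of_real ((1/2) / sqrt M)"
          using \<open>\<i> * of_real ((1/2) / sqrt M) \<in> ?U\<close> in_U by (metis singletonD)
        then have "1 / sqrt M = (1/2) / sqrt M" by (metis mult_cancel_left complex_i_not_zero of_real_eq_iff)
        then show False using M by simp
      qed
    qed
  qed
  then have eq: "qexp a z = (-1) ^ k * x / (Q * z) ^ k * qexp b (- 1 / (of_nat (N * q\<^sup>2) * z))"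
    unfolding Mc Q2[symmetric] by (simp add: D_def)
  have "Im (- 1 / (of_nat (N * q\<^sup>2) * z)) > 0"
    unfolding Mc by (rule Im_neg_inverse_pos[OF M z])
  then have "twist (qexp g) q (- 1 / (of_nat (N * q\<^sup>2) * z)) = qexp b (- 1 / (of_nat (N * q\<^sup>2) * z))"
    unfolding b_def by (rule twist_qexp[OF g])
  moreover have "twist (qexp f) q z = qexp a z"
    unfolding a_def by (rule twist_qexp[OF f z])
  ultimately show ?thesis using eq unfolding Q_def by (simp only:)
qed

subsection \<open>Non-vanishing of sums of translates\<close>

lemma ee_of_int [simp]: "ee (of_int n) = 1"
proof -
  have "ee (of_int n) = cis (2 * pi * real_of_int n)" by (simp add: ee_def cis_conv_exp mult_ac)
  then show ?thesis by simp
qed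

lemma ee_of_nat_mult: "ee (of_nat n * z) = ee z ^ n"
  by (simp add: ee_def mult_ac flip: exp_of_nat_mult)

text \<open>For coprime moduli the sum factors by the Chinese remainder theorem, and for a prime p
  it is p - 1 or -1. Repeated primes break this: c_4(1) = 0. The parameter t is an integer because
  Bezout coefficients, possibly negative, multiply it in the induction.\<close>

lemma unit_exponential_sum_nonzero:
  fixes t :: int
  assumes "squarefree q"
  shows "(\<Sum>a\<in>totatives q. ee (of_nat a * of_int t / of_nat q)) \<noteq> 0"
  using assms
proof (induction q arbitrary: t rule: less_induct)
  case (less q)
  define R where "R = (\<lambda>q (t::int). \<Sum>a\<in>totatives q. ee (of_nat a * of_int t / of_nat q))"
  have prime_case: "R p t \<noteq> 0" if p: "prime p" for p t
  proof -
    have tot: "totatives p = {1..<p}" using p by (auto simp: totatives_prime)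
    define w where "w = ee (of_int t / of_nat p)"
    have p0: "p > 1" using p by (rule prime_gt_1_nat)
    have Rw: "R p t = (\<Sum>a=1..<p. w ^ a)"
      unfolding R_def tot w_def ee_of_nat_mult[symmetric] by simp
    show ?thesis
    proof (cases "w = 1")
      case True
      then show ?thesis using p0 by (simp add: Rw of_nat_diff)
    next
      case False
      have "w ^ p = 1" using p0 unfolding w_def ee_of_nat_mult[symmetric] by simp
      then have "(\<Sum>a<p. w ^ a) = 0" using False by (simp add: sum_gp_strict)
      moreover have "(\<Sum>a<p. w ^ a) = 1 + (\<Sum>a=1..<p. w ^ a)"
        using p0 by (simp add: lessThan_atLeast0 sum.atLeast_Suc_lessThan)
      ultimately have "R p t = - 1" unfolding Rw by (simp add: eq_neg_iff_add_eq_0 add.commute)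
      then show ?thesis by simp
    qed
  qed
  have "R q t \<noteq> 0"
  proof (cases "q = 1")
    case True
    then show ?thesis by (simp add: R_def)
  next
    case False
    have "q \<noteq> 0" using less.prems by (intro notI) simp
    obtain p where p: "prime p" "p dvd q" using prime_factor_nat[OF False] by blast
    then obtain q' where q': "q = p * q'" by (elim dvdE)
    show ?thesis
    proof (cases "q' = 1")
      case True
      then show ?thesis using prime_case p q' by simp
    next
      case False
      have q0: "q' > 1" "p > 1" using \<open>q \<noteq> 0\<close> q' False p prime_gt_1_nat by (auto simp: Suc_lessI)
      have cop: "coprime p q'"
        using less.prems p unfolding q' by (metis dvd_triv_left mult.commute mult_dvd_mono not_prime_unit power2_eq_square prime_imp_coprime squarefreeD dvd_refl)
      have sq: "squarefree q'" using less.prems q' by (metis squarefree_multD(2))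
      obtain u v where uv: "u * int q' + v * int p = 1"
        using cop by (metis bezout_int coprime_int_iff coprime_imp_gcd_eq_1 coprime_commute)
      have split: "ee (of_nat x * of_int t / of_nat q) =
          ee (of_nat (x mod p) * of_int (u * t) / of_nat p) * ee (of_nat (x mod q') * of_int (v * t) / of_nat q')" for x
      proof -
        have md: "ee (of_nat (x mod m) * of_int s / of_nat m) = ee (of_nat x * of_int s / of_nat m)" if "m > 1" for m s
        proof -
          have e: "of_nat x * of_int s / of_nat m = of_nat (x mod m) * of_int s / of_nat m + complex_of_int (int (x div m) * s)"
          proof -
            have "(of_nat x :: complex) = of_nat (x mod m) + of_nat (x div m) * of_nat m"
              by (metis mod_div_mult_eq of_nat_add of_nat_mult)
            then show ?thesis using that by (simp add: field_simps)
          qed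
          show ?thesis unfolding e ee_add ee_of_int by simp
        qed
        have "(of_int u * of_nat q' + of_int v * of_nat p :: complex) = of_int (u * int q' + v * int p)" by simp
        then have b: "(of_int u * of_nat q' + of_int v * of_nat p :: complex) = 1" unfolding uv by simp
        have "of_nat x * of_int t / of_nat q = complex_of_nat x * of_int t * (of_int u * of_nat q' + of_int v * of_nat p) / (of_nat p * of_nat q')"
          unfolding b q' by simp
        also have "\<dots> = of_nat x * of_int (u * t) / of_nat p + of_nat x * of_int (v * t) / of_nat q'"
          using q0 by (simp add: field_simps)
        finally show ?thesis using q0 by (simp only: ee_add md)
      qed
      have "R q t = (\<Sum>x\<in>totatives (p * q'). (\<lambda>(a, b). ee (of_nat a * of_int (u * t) / of_nat p) * ee (of_nat b * of_int (v * t) / of_nat q')) (x mod p, x mod q'))"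
        unfolding R_def split by (simp add: q')
      also have "\<dots> = (\<Sum>(a, b)\<in>totatives p \<times> totatives q'. ee (of_nat a * of_int (u * t) / of_nat p) * ee (of_nat b * of_int (v * t) / of_nat q'))"
        by (rule sum.reindex_bij_betw[OF bij_betw_totatives[OF q0(2,1) cop]])
      also have "\<dots> = R p (u * t) * R q' (v * t)"
        unfolding R_def sum_product sum.cartesian_product ..
      finally have "R q t = R p (u * t) * R q' (v * t)" .
      moreover have "R q' (v * t) \<noteq> 0"
        using less.IH[of q' "v * t"] sq q0 q' by (simp add: R_def)
      ultimately show ?thesis using prime_case p by simp
    qed
  qed
  then show ?case by (simp add: R_def)
qed

lemma ramanujan_sum_nonzero:
  assumes "squarefree q"
  shows "ramanujan_sum q n \<noteq> 0"
  using unit_exponential_sum_nonzero[OF assms, of "int n"]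
  by (simp add: ramanujan_sum_totatives)

text \<open>For y \<ge> 1 every later term, after normalisation, carries a factor at most
  exp(-2\<pi>(y - 1)) relative to its value at y = 1; so the series at z = i dominates the whole
  remainder.\<close>

lemma qexp_leading_term:
  assumes b: "poly_bounded b" and n0: "n0 \<ge> 1" and z: "\<And>n. 1 \<le> n \<Longrightarrow> n < n0 \<Longrightarrow> b n = 0"
  shows "((\<lambda>y. of_real (exp (2 * pi * real n0 * y)) * qexp b (\<i> * of_real y)) \<longlongrightarrow> b n0) at_top"
proof -
  obtain m where m: "n0 = Suc m" using n0 by (cases n0) auto
  define B where "B = (\<lambda>n. norm (b (Suc n) * ee (of_nat (Suc n) * \<i>)))"
  have B: "summable B" unfolding B_def by (rule summable_qexp[OF b]) simp
  have "((\<lambda>y. of_real (exp (2 * pi * real n0 * y)) * qexp b (\<i> * of_real y) - b n0) \<longlongrightarrow> 0) at_top"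
  proof (rule Lim_null_comparison)
    show "((\<lambda>y. exp (- (2 * pi * (y - 1))) * (exp (2 * pi * real n0) * suminf B)) \<longlongrightarrow> 0) at_top"
    proof -
      have "((\<lambda>y. exp (- (2 * pi * (y - 1)))) \<longlongrightarrow> 0) at_top" by real_asymp
      then show ?thesis by (rule tendsto_mult_left_zero)
    qed
    have "norm (of_real (exp (2 * pi * real n0 * y)) * qexp b (\<i> * of_real y) - b n0)
        \<le> exp (- (2 * pi * (y - 1))) * (exp (2 * pi * real n0) * suminf B)" if y: "y \<ge> 1" for y
    proof -
      let ?t = "\<lambda>n. of_real (exp (2 * pi * real n0 * y)) * (b (Suc n) * ee (of_nat (Suc n) * (\<i> * of_real y)))"
      have s: "summable (\<lambda>n. b (Suc n) * ee (of_nat (Suc n) * (\<i> * of_real y)))"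
        using y by (intro summable_norm_cancel[OF summable_qexp[OF b]]) simp
      have "of_real (exp (2 * pi * real n0 * y)) * qexp b (\<i> * of_real y) = suminf ?t"
        unfolding qexp_def by (rule suminf_mult[OF s, symmetric])
      moreover have "?t m = b n0"
      proof -
        have "ee (of_nat n0 * (\<i> * of_real y)) = of_real (exp (- (2 * pi * real n0 * y)))"
          by (simp add: ee_def exp_of_real[symmetric] mult_ac)
        then have "?t m = of_real (exp (2 * pi * real n0 * y) * exp (- (2 * pi * real n0 * y))) * b n0"
          by (simp add: m mult_ac del: of_nat_Suc)
        also have "exp (2 * pi * real n0 * y) * exp (- (2 * pi * real n0 * y)) = 1" by (simp flip: exp_add)
        finally show ?thesis by simp
      qed
      moreover have st: "summable ?t" by (rule summable_mult[OF s])
      ultimately have "of_real (exp (2 * pi * real n0 * y)) * qexp b (\<i> * of_real y) - b n0 = (\<Sum>n. ?t n - (if n = m then ?t n else 0))"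
        using suminf_diff[OF st, of "\<lambda>n. if n = m then ?t n else 0"] by (simp add: sums_unique[OF sums_single, symmetric] sums_summable[OF sums_single])
      also have "norm \<dots> \<le> (\<Sum>n. exp (- (2 * pi * (y - 1))) * (exp (2 * pi * real n0) * B n))"
      proof (rule norm_suminf_le)
        show "summable (\<lambda>n. exp (- (2 * pi * (y - 1))) * (exp (2 * pi * real n0) * B n))"
          by (intro summable_mult B)
        fix n
        consider "n < m" | "n = m" | "n > m" by linarith
        then show "norm (?t n - (if n = m then ?t n else 0)) \<le> exp (- (2 * pi * (y - 1))) * (exp (2 * pi * real n0) * B n)"
        proof cases
          case 3
          have "norm (?t n - (if n = m then ?t n else 0)) = norm (b (Suc n)) * (exp (2 * pi * real n0 * y) * exp (- (2 * pi * real (Suc n) * y)))"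
            using 3 by (simp add: norm_mult norm_ee mult_ac del: of_nat_Suc)
          also have "\<dots> \<le> norm (b (Suc n)) * (exp (- (2 * pi * (y - 1))) * (exp (2 * pi * real n0) * exp (- (2 * pi * real (Suc n)))))"
          proof (rule mult_left_mono)
            have "(real (Suc n) - real n0 - 1) * (y - 1) \<ge> 0" using 3 m y by (intro mult_nonneg_nonneg) auto
            then have "real n0 * y - real (Suc n) * y \<le> - (y - 1) + real n0 - real (Suc n)" by (simp add: algebra_simps)
            then have "(2 * pi) * (real n0 * y - real (Suc n) * y) \<le> (2 * pi) * (- (y - 1) + real n0 - real (Suc n))" by (intro mult_left_mono) auto
            then show "exp (2 * pi * real n0 * y) * exp (- (2 * pi * real (Suc n) * y)) \<le> exp (- (2 * pi * (y - 1))) * (exp (2 * pi * real n0) * exp (- (2 * pi * real (Suc n))))"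
              unfolding exp_add[symmetric] exp_le_cancel_iff by (simp add: algebra_simps)
          qed simp
          finally have "norm (?t n - (if n = m then ?t n else 0)) \<le> norm (b (Suc n)) * (exp (- (2 * pi * (y - 1))) * (exp (2 * pi * real n0) * exp (- (2 * pi * real (Suc n)))))" .
          moreover have "B n = norm (b (Suc n)) * exp (- (2 * pi * real (Suc n)))"
            by (simp add: B_def norm_mult norm_ee mult_ac del: of_nat_Suc)
          ultimately show ?thesis by (simp only: mult_ac)
        qed (use z[of "Suc n"] m in \<open>auto simp: B_def\<close>)
      qed
      also have "\<dots> = exp (- (2 * pi * (y - 1))) * (exp (2 * pi * real n0) * suminf B)"
        using suminf_mult[OF summable_mult[OF B], of "exp (- (2 * pi * (y - 1)))"] suminf_mult[OF B] by simp
      finally show ?thesis .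
    qed
    then show "\<forall>\<^sub>F y in at_top. norm (of_real (exp (2 * pi * real n0 * y)) * qexp b (\<i> * of_real y) - b n0)
        \<le> exp (- (2 * pi * (y - 1))) * (exp (2 * pi * real n0) * suminf B)"
      by (rule eventually_at_top_linorderI)
  qed
  then show ?thesis by (simp add: LIM_zero_iff)
qed

text \<open>Each j/q with 1 \<le> j \<le> q has a unique reduced form a/r with r dividing q. A
  complete sum of translates is thus the sum of the twists over all divisors of q.\<close>

lemma sum_over_denominators:
  fixes h :: "complex \<Rightarrow> complex"
  assumes q: "q > 0"
  shows "(\<Sum>j\<in>{1..q}. h (of_nat j / of_nat q)) = (\<Sum>r\<in>{r. r dvd q}. \<Sum>a\<in>totatives r. h (of_nat a / of_nat r))"
proof -
  have fin: "finite {r. r dvd q}" using q by simp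
  have "(\<Sum>r\<in>{r. r dvd q}. \<Sum>a\<in>totatives r. h (of_nat a / of_nat r)) = (\<Sum>(r, a)\<in>Sigma {r. r dvd q} totatives. h (of_nat a / of_nat r))"
    using fin by (intro sum.Sigma) auto
  also have "\<dots> = (\<Sum>j\<in>{1..q}. h (of_nat j / of_nat q))"
  proof (rule sum.reindex_bij_witness[where i = "\<lambda>j. (q div gcd j q, j div gcd j q)" and j = "\<lambda>(r, a). a * (q div r)"])
    fix x assume "x \<in> Sigma {r. r dvd q} totatives"
    then obtain r a where x: "x = (r, a)" "r dvd q" "1 \<le> a" "a \<le> r" "coprime a r" by (auto simp: totatives_def)
    obtain d where d: "q = r * d" using x by (elim dvdE)
    have d0: "d > 0" "r > 0" using d q by auto
    have g: "gcd (a * d) q = d" using x(5) unfolding d by (metis coprime_imp_gcd_eq_1 gcd_mult_distrib_nat mult.commute mult.right_neutral)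
    show "(case x of (r, a) \<Rightarrow> a * (q div r)) \<in> {1..q}" using x d d0 by simp
    show "(q div gcd (case x of (r, a) \<Rightarrow> a * (q div r)) q, (case x of (r, a) \<Rightarrow> a * (q div r)) div gcd (case x of (r, a) \<Rightarrow> a * (q div r)) q) = x"
      using x d d0 g by simp
    show "h (of_nat (case x of (r, a) \<Rightarrow> a * (q div r)) / of_nat q) = (case x of (r, a) \<Rightarrow> h (of_nat a / of_nat r))"
      using x d d0 by simp
  next
    fix j assume j: "j \<in> {1..q}"
    define d where "d = gcd j q"
    have d: "d > 0" "d dvd j" "d dvd q" using j by (auto simp: d_def)
    have "coprime (j div d) (q div d)" using j unfolding d_def by (intro div_gcd_coprime) auto
    then show "(q div gcd j q, j div gcd j q) \<in> Sigma {r. r dvd q} totatives"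
      using j d unfolding d_def[symmetric] by (auto simp: totatives_def div_le_mono dvd_imp_le Suc_le_eq dvd_div_eq_0_iff div_greater_zero_iff div_dvd_iff_mult)
    show "(case (q div gcd j q, j div gcd j q) of (r, a) \<Rightarrow> a * (q div r)) = j"
      using j d unfolding d_def[symmetric] by (auto elim!: dvdE)
  qed
  finally show ?thesis ..
qed

text \<open>If the sum vanished, the functional equations for all divisors of \<open>q\<close> would give a linear relation between
  the functions \<open>g\<^sub>r (w / r\<^sup>2)\<close>; as \<open>w\<close> tends to \<open>i\<infinity>\<close> the first nonzero coefficient of the term \<open>r = q\<close> dominates.\<close>
lemma sum_translates_nonzero:
  assumes N: "N \<ge> 1" and q: "squarefree q" and g: "poly_bounded g" "\<exists>n\<ge>1. g n \<noteq> 0"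
    and x: "x q \<noteq> 0"
    and fe: "\<And>r z. r dvd q \<Longrightarrow> Im z > 0 \<Longrightarrow>
       twist F r z = (-1) ^ k * x r / (of_real (sqrt (real N)) * of_nat r * z) ^ k * twist (qexp g) r (- 1 / (of_nat (N * r\<^sup>2) * z))"
  shows "\<exists>z. Im z > 0 \<and> (\<Sum>j\<in>{1..q}. F (z + of_nat j / of_nat q)) \<noteq> 0"
proof (rule ccontr)
  assume "\<not> ?thesis"
  then have zero: "(\<Sum>j\<in>{1..q}. F (z + of_nat j / of_nat q)) = 0" if "Im z > 0" for z using that by blast
  have q0: "q > 0" using q by (metis gr0I not_squarefree_0)
  define D where "D = {r. r dvd q}"
  have D: "finite D" "q \<in> D" using q0 by (auto simp: D_def)
  have Dpos: "r > 0" "r \<le> q" if "r \<in> D" for r using that q0 by (auto simp: D_def intro: dvd_imp_le)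
  define b where "b = (\<lambda>r n. g n * ramanujan_sum r n)"
  have pb: "poly_bounded (b r)" for r unfolding b_def by (rule poly_bounded_twist[OF g(1)])
  have rel: "(\<Sum>r\<in>D. x r / of_nat r ^ k * qexp (b r) (\<i> * of_real (y / real r ^ 2))) = 0" if y: "y > 0" for y
  proof -
    \<comment> \<open>For this z the argument -1/(N r^2 z) is i y/r^2 for all r at once.\<close>
    define z where "z = \<i> * of_real (1 / (real N * y))"
    have z: "Im z > 0" using y N by (simp add: z_def)
    define A where "A = (-1) ^ k / (of_real (sqrt (real N)) * z) ^ k"
    have "0 = (\<Sum>r\<in>D. twist F r z)"
      using zero[OF z] sum_over_denominators[OF q0, of "\<lambda>t. F (z + t)"] by (simp add: twist_def D_def)
    also have "\<dots> = (\<Sum>r\<in>D. A * (x r / of_nat r ^ k * qexp (b r) (\<i> * of_real (y / real r ^ 2))))"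
    proof (rule sum.cong[OF refl])
      fix r assume r: "r \<in> D"
      have r0: "r > 0" using Dpos r by blast
      have w: "- 1 / (of_nat (N * r\<^sup>2) * z) = \<i> * of_real (y / real r ^ 2)"
        using N y r0 by (simp add: z_def field_simps)
      have "twist (qexp g) r (\<i> * of_real (y / real r ^ 2)) = qexp (b r) (\<i> * of_real (y / real r ^ 2))"
        unfolding b_def using y r0 by (intro twist_qexp[OF g(1)]) simp
      then show "twist F r z = A * (x r / of_nat r ^ k * qexp (b r) (\<i> * of_real (y / real r ^ 2)))"
        using fe[of r z] r z unfolding w D_def A_def by (simp add: power_mult_distrib mult_ac)
    qed
    finally have AS: "A * (\<Sum>r\<in>D. x r / of_nat r ^ k * qexp (b r) (\<i> * of_real (y / real r ^ 2))) = 0"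
      by (simp only: sum_distrib_left)
    have A0: "A \<noteq> 0" using N z by (auto simp: A_def)
    from mult_eq_0_iff[THEN iffD1, OF AS] show ?thesis by (rule disjE) (use A0 in \<open>rule notE\<close>)
  qed
  define n0 where "n0 = (LEAST n. n \<ge> 1 \<and> g n \<noteq> 0)"
  have n0: "n0 \<ge> 1" "g n0 \<noteq> 0" using LeastI_ex[of "\<lambda>n. n \<ge> 1 \<and> g n \<noteq> 0"] g(2) by (auto simp: n0_def)
  have less: "g n = 0" if "1 \<le> n" "n < n0" for n using that not_less_Least unfolding n0_def by blast
  \<comment> \<open>The r-th function is O(exp(-2\<pi> n0 y/r^2)), the slowest decay belonging to
    the largest divisor r = q; normalised by that rate, all others tend to 0.\<close>
  have lim: "((\<lambda>y. of_real (exp (2 * pi * real n0 * (y / real q ^ 2))) * qexp (b r) (\<i> * of_real (y / real r ^ 2))) \<longlongrightarrow> (if r = q then b r n0 else 0)) at_top"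
    if r: "r \<in> D" for r
  proof -
    have r0: "real r > 0" "real r \<le> real q" using Dpos[OF r] by auto
    have top: "LIM y at_top. y / real r ^ 2 :> at_top" using r0 by real_asymp
    have "((\<lambda>y. of_real (exp (2 * pi * real n0 * y)) * qexp (b r) (\<i> * of_real y)) \<longlongrightarrow> b r n0) at_top"
      by (rule qexp_leading_term[OF pb n0(1)]) (simp add: b_def less)
    from filterlim_compose[OF this top]
    have 1: "((\<lambda>y. of_real (exp (2 * pi * real n0 * (y / real r ^ 2))) * qexp (b r) (\<i> * of_real (y / real r ^ 2))) \<longlongrightarrow> b r n0) at_top" .
    show ?thesis
    proof (cases "r = q")
      case True
      then show ?thesis using 1 by simp
    next
      case False
      then have rq: "real r < real q" using r0 by auto
      define c where "c = 2 * pi * real n0 * (1 / real r ^ 2 - 1 / real q ^ 2)"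
      have "real r ^ 2 < real q ^ 2" using r0 rq by (intro power_strict_mono) auto
      then have c: "c > 0" using n0 r0 by (auto simp: c_def field_simps)
      have "((\<lambda>y. exp (- c * y)) \<longlongrightarrow> 0) at_top" using c by real_asymp
      then have "((\<lambda>y. of_real (exp (- c * y))) \<longlongrightarrow> (of_real 0 :: complex)) at_top" by (rule tendsto_of_real)
      from tendsto_mult[OF this 1]
      have "((\<lambda>y. of_real (exp (- c * y)) * (of_real (exp (2 * pi * real n0 * (y / real r ^ 2))) * qexp (b r) (\<i> * of_real (y / real r ^ 2)))) \<longlongrightarrow> 0) at_top" by simp
      moreover have eqn: "of_real (exp (- c * y)) * (of_real (exp (2 * pi * real n0 * (y / real r ^ 2))) * z) = (of_real (exp (2 * pi * real n0 * (y / real q ^ 2))) * z :: complex)" for y z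
      proof -
        have "exp (- c * y) * exp (2 * pi * real n0 * (y / real r ^ 2)) = exp (2 * pi * real n0 * (y / real q ^ 2))"
          by (simp add: c_def algebra_simps flip: exp_add)
        then show ?thesis by (metis mult.assoc of_real_mult)
      qed
      ultimately have "((\<lambda>y. of_real (exp (2 * pi * real n0 * (y / real q ^ 2))) * qexp (b r) (\<i> * of_real (y / real r ^ 2))) \<longlongrightarrow> 0) at_top"
        by (simp only: eqn)
      with False show ?thesis by (simp only: if_False)
    qed
  qed
  have lim1: "((\<lambda>y. \<Sum>r\<in>D. x r / of_nat r ^ k * (of_real (exp (2 * pi * real n0 * (y / real q ^ 2))) * qexp (b r) (\<i> * of_real (y / real r ^ 2))))
     \<longlongrightarrow> (\<Sum>r\<in>D. x r / of_nat r ^ k * (if r = q then b r n0 else 0))) at_top"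
    by (intro tendsto_sum tendsto_mult tendsto_const lim)
  have val: "(\<Sum>r\<in>D. x r / of_nat r ^ k * (if r = q then b r n0 else 0)) = x q / of_nat q ^ k * b q n0"
    using D by (simp add: if_distrib sum.delta cong: if_cong)
  have "\<forall>\<^sub>F y in at_top. (\<Sum>r\<in>D. x r / of_nat r ^ k * (of_real (exp (2 * pi * real n0 * (y / real q ^ 2))) * qexp (b r) (\<i> * of_real (y / real r ^ 2)))) = 0"
    using eventually_gt_at_top[of "0::real"]
  proof eventually_elim
    case (elim y)
    have "(\<Sum>r\<in>D. x r / of_nat r ^ k * (of_real (exp (2 * pi * real n0 * (y / real q ^ 2))) * qexp (b r) (\<i> * of_real (y / real r ^ 2))))
       = of_real (exp (2 * pi * real n0 * (y / real q ^ 2))) * (\<Sum>r\<in>D. x r / of_nat r ^ k * qexp (b r) (\<i> * of_real (y / real r ^ 2)))"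
      unfolding sum_distrib_left by (intro sum.cong refl) (simp only: mult_ac)
    then show ?case using rel[OF elim] by simp
  qed
  from tendsto_unique[OF trivial_limit_at_top_linorder tendsto_eventually[OF this] lim1]
  have "x q / of_nat q ^ k * b q n0 = 0" unfolding val ..
  then show False using x n0 q0 ramanujan_sum_nonzero[OF q, of n0] by (simp add: b_def)
qed

subsection \<open>Triviality of the multiplier\<close>

lemma periodic_int:
  assumes "\<And>z. Im z > 0 \<Longrightarrow> h (z + 1) = h z" "Im z > 0"
  shows "h (z + of_int j) = h z"
proof -
  have nat: "h (z + of_nat n) = h z" if "Im z > 0" for n z
  proof (induction n)
    case (Suc n)
    have "h (z + of_nat (Suc n)) = h ((z + of_nat n) + 1)" by (simp add: add_ac)
    then show ?case using assms(1)[of "z + of_nat n"] that Suc by simp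
  qed simp
  show ?thesis
  proof (cases "j \<ge> 0")
    case True
    then show ?thesis using nat[OF assms(2), of "nat j"] by simp
  next
    case False
    then show ?thesis using nat[of "z + of_int j" "nat (- j)"] assms(2) by simp
  qed
qed

text \<open>A shift by c only permutes the complete residue system through which j runs, and h has
  period 1.\<close>

lemma sum_translates_shift:
  assumes h: "\<And>z. Im z > 0 \<Longrightarrow> h (z + 1) = h z" and w: "Im w > 0" and q: "q \<ge> (1::nat)"
  shows "(\<Sum>j\<in>{1..q}. h (w + (of_int c + of_nat j) / of_nat q)) = (\<Sum>j\<in>{1..q}. h (w + of_nat j / of_nat q) :: complex)"
proof -
  define P where "P = (\<lambda>c. \<Sum>j\<in>{1..q}. h (w + (of_int c + of_nat j) / of_nat q))"
  have step: "P (c + 1) = P c" for c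
  proof -
    let ?t = "\<lambda>j. h (w + (of_int c + of_nat j) / of_nat q)"
    have "P (c + 1) = (\<Sum>j\<in>{1..q}. ?t (Suc j))" by (simp add: P_def add_ac)
    also have "\<dots> = (\<Sum>j\<in>{2..Suc q}. ?t j)"
      by (rule sum.reindex_bij_witness[where i = "\<lambda>j. j - 1" and j = Suc]) auto
    also have "\<dots> = (\<Sum>j\<in>{2..q}. ?t j) + ?t (Suc q)" using q by (simp add: add.commute)
    also have "?t (Suc q) = h ((w + (of_int c + of_nat 1) / of_nat q) + 1)"
      using q by (simp add: add_divide_distrib add_ac)
    also have "\<dots> = ?t 1" using w by (intro h) simp
    also have "(\<Sum>j\<in>{2..q}. ?t j) + ?t 1 = P c"
      using q unfolding P_def by (simp add: sum.atLeast_Suc_atMost numeral_2_eq_2 add.commute)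
    finally show ?thesis .
  qed
  have "P c = P 0"
  proof (induction c rule: int_induct[where k = 0])
    case (step1 i)
    then show ?case using step[of i] by simp
  next
    case (step2 i)
    then show ?case using step[of "i - 1"] by simp
  qed simp
  then show ?thesis by (simp add: P_def)
qed

text \<open>By assumption \<open>c a\<close> is minus the inverse of N a modulo q, so it permutes
  the units. The representative \<open>\<tau> a\<close> is taken in 1..q rather than 0..q-1 to agree
  with \<open>totatives\<close> also for q = 1.\<close>

lemma unit_reindex:
  fixes c :: "nat \<Rightarrow> int" and h :: "complex \<Rightarrow> complex"
  assumes q: "q \<ge> 1" and c: "\<And>a. a \<in> totatives q \<Longrightarrow> int q dvd int N * int a * c a + 1"
    and h: "\<And>z. Im z > 0 \<Longrightarrow> h (z + 1) = h z" and w: "Im w > 0"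
  shows "(\<Sum>b\<in>totatives q. h (w + of_nat b / of_nat q)) = (\<Sum>a\<in>totatives q. h (w + of_int (c a) / of_nat q))"
proof -
  define \<tau> where "\<tau> = (\<lambda>a. nat ((c a - 1) mod int q) + 1)"
  have tc: "int q dvd c a - int (\<tau> a)" for a
  proof -
    have "int (\<tau> a) = (c a - 1) mod int q + 1" using q by (simp add: \<tau>_def)
    then have "c a - int (\<tau> a) = (c a - 1) - (c a - 1) mod int q" by simp
    then show ?thesis by (metis dvd_minus_mod)
  qed
  have tin: "\<tau> a \<in> totatives q" if a: "a \<in> totatives q" for a
  proof -
    have "(c a - 1) mod int q < int q" using q by simp
    then have "1 \<le> \<tau> a" "\<tau> a \<le> q" using q by (auto simp: \<tau>_def nat_less_iff Suc_le_eq)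
    moreover have "coprime (int (\<tau> a)) (int q)"
    proof (rule coprimeI)
      fix l assume l: "l dvd int (\<tau> a)" "l dvd int q"
      have "l dvd c a - int (\<tau> a)" "l dvd int N * int a * c a + 1" using tc c[OF a] l(2) by (auto intro: dvd_trans)
      then have "l dvd c a" using l(1) by (simp add: dvd_diff_left_iff)
      then have "l dvd int N * int a * c a" by simp
      with \<open>l dvd int N * int a * c a + 1\<close> show "is_unit l" by (simp add: dvd_add_right_iff)
    qed
    ultimately show ?thesis by (simp add: totatives_def)
  qed
  have inj: "inj_on \<tau> (totatives q)"
  proof (rule inj_onI)
    fix a a' assume aa: "a \<in> totatives q" "a' \<in> totatives q" "\<tau> a = \<tau> a'"
    have "int q dvd (c a - int (\<tau> a)) - (c a' - int (\<tau> a'))" by (intro dvd_diff tc)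
    then have 1: "int q dvd c a - c a'" using aa by simp
    have "int q dvd (int N * int a * c a + 1) * int a' - (int N * int a' * c a' + 1) * int a - (int N * int a * int a') * (c a - c a')"
      by (intro dvd_diff dvd_mult2 c aa dvd_mult[OF 1])
    then have "int q dvd int a' - int a" by (simp add: algebra_simps)
    then have "[int a' = int a] (mod int q)" by (simp add: cong_iff_dvd_diff)
    then have "[a' = a] (mod q)" by (simp add: cong_int_iff)
    then have "a' mod q = a mod q" by (simp add: cong_def)
    moreover have "1 \<le> a" "a \<le> q" "1 \<le> a'" "a' \<le> q" using aa by (auto simp: totatives_def)
    ultimately show "a = a'" by (metis le_neq_implies_less mod_less mod_self not_one_le_zero)
  qed
  have bij: "bij_betw \<tau> (totatives q) (totatives q)"
    unfolding bij_betw_def using inj endo_inj_surj[OF finite_totatives _ inj] tin by auto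
  have "(\<Sum>b\<in>totatives q. h (w + of_nat b / of_nat q)) = (\<Sum>a\<in>totatives q. h (w + of_nat (\<tau> a) / of_nat q))"
    by (rule sum.reindex_bij_betw[OF bij, symmetric])
  also have "\<dots> = (\<Sum>a\<in>totatives q. h (w + of_int (c a) / of_nat q))"
  proof (rule sum.cong[OF refl])
    fix a
    obtain j where j: "c a - int (\<tau> a) = int q * j" using tc[of a] by (elim dvdE)
    have "(of_int (c a) :: complex) = of_int (int (\<tau> a) + int q * j)" using j by (metis add_diff_cancel_left' diff_add_cancel add.commute)
    then have e: "w + of_int (c a) / of_nat q = (w + of_nat (\<tau> a) / of_nat q) + of_int j"
      using q by (simp add: add_divide_distrib)
    show "h (w + of_nat (\<tau> a) / of_nat q) = h (w + of_int (c a) / of_nat q)"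
      unfolding e by (subst periodic_int[where h = h and j = j]) (use w h in simp_all)
  qed
  finally show ?thesis .
qed

text \<open>The real parts of 1 - x a are nonnegative with sum 0, so each Re(x a) is 1, and modulus
  1 kills the imaginary part.\<close>

lemma unit_modulus_sum_eq_card:
  assumes "finite A" "\<And>a. a \<in> A \<Longrightarrow> norm (x a) = 1" "(\<Sum>a\<in>A. x a - 1) = (0::complex)" "a \<in> A"
  shows "x a = 1"
proof -
  have le: "Re (x a) \<le> 1" if "a \<in> A" for a using complex_Re_le_cmod[of "x a"] assms(2)[OF that] by simp
  have "(\<Sum>a\<in>A. 1 - Re (x a)) = - Re (\<Sum>a\<in>A. x a - 1)" by (simp add: sum_negf[symmetric])
  then have "(\<Sum>a\<in>A. 1 - Re (x a)) = 0" unfolding assms(3) by simp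
  then have "1 - Re (x a) = 0" using assms(1,4) le by (subst (asm) sum_nonneg_eq_0_iff) auto
  then have r: "Re (x a) = 1" by simp
  have "(Re (x a))\<^sup>2 + (Im (x a))\<^sup>2 = 1" using assms(2)[OF assms(4)] by (metis cmod_power2 one_power2)
  then have "Im (x a) = 0" by (simp add: r)
  then show ?thesis using r by (simp add: complex_eq_iff)
qed

text \<open>The weight k action of the Fricke matrix with rows (0, -1) and (N, 0). It has
  determinant N, so it is kept apart from the \<open>SL2Z\<close> action.\<close>

definition fricke :: "nat \<Rightarrow> nat \<Rightarrow> (complex \<Rightarrow> complex) \<Rightarrow> complex \<Rightarrow> complex" where
  "fricke N k h w = h (- 1 / (of_nat N * w)) / (of_real (sqrt (real N)) * w) ^ k"

text \<open>With W : w -> -1/(N w), translation by 1 followed by W and then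
  \<open>Umat (int N)\<close> is W again; so invariance under \<open>Umat (int N)\<close> becomes
  period 1.\<close>

lemma fricke_periodic:
  assumes N: "N \<ge> 1" and U: "\<And>z. Im z > 0 \<Longrightarrow> slash k h (Umat (int N)) z = h z" and w: "Im w > 0"
  shows "fricke N k h (w + 1) = fricke N k h w"
proof -
  define u where "u = - 1 / (of_nat N * (w + 1))"
  have nz: "w \<noteq> 0" "w + 1 \<noteq> 0" using w by (auto simp: complex_eq_iff)
  have u: "Im u > 0" using Im_neg_inverse_pos[of "real N" "w + 1"] w N by (simp add: u_def)
  have gen: "- 1 / s + 1 = (s - 1) / s" "- 1 / (n * s) / (w / s) = - 1 / (n * w)" if "s \<noteq> 0" "n \<noteq> 0" for s n :: complex
    using that nz by (simp_all add: field_simps)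
  have "of_nat N * u = - 1 / (w + 1)" using N by (simp add: u_def)
  then have a: "aut (Umat (int N)) u = w / (w + 1)"
    using gen(1)[OF nz(2), of 1] by (simp add: aut_def Umat_def)
  have m: "moeb (Umat (int N)) u = - 1 / (of_nat N * w)"
    unfolding moeb_def a using N gen(2)[OF nz(2), of "of_nat N"] by (simp add: Umat_def u_def)
  have "h (- 1 / (of_nat N * w)) = (w / (w + 1)) ^ k * h u"
    using U[OF u] nz unfolding slash_eq[OF TU_SL2Z(2)] a m by (simp add: field_simps)
  then show ?thesis
    unfolding fricke_def u_def[symmetric] using nz N by (simp add: power_mult_distrib power_divide)
qed

text \<open>What follows is formal in F and G: it runs on periodicity and the equations for all r,
  without q-expansions. The scalar \<open>x r\<close> stands for \<xi>(r).\<close>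

locale twist_fe =
  fixes N k :: nat and x :: "nat \<Rightarrow> complex" and F G :: "complex \<Rightarrow> complex"
  assumes N: "N \<ge> 1"
    and F_periodic: "\<And>z. Im z > 0 \<Longrightarrow> F (z + 1) = F z"
    and G_periodic: "\<And>z. Im z > 0 \<Longrightarrow> G (z + 1) = G z"
    and x1: "x 1 = 1"
    and fe: "\<And>r z. r \<ge> 1 \<Longrightarrow> coprime r N \<Longrightarrow> Im z > 0 \<Longrightarrow>
      twist F r z = (-1) ^ k * x r / (of_real (sqrt (real N)) * of_nat r * z) ^ k * twist G r (- 1 / (of_nat (N * r\<^sup>2) * z))"
begin

lemma sqrtN: "of_real (sqrt (real N)) * (of_real (sqrt (real N)) * z) = of_nat N * z" "complex_of_real (sqrt (real N)) \<noteq> 0"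
  using N by (simp_all add: mult.assoc[symmetric] flip: of_real_mult)

lemma fe_reversed:
  assumes r: "r \<ge> 1" "coprime r N" and w: "Im w > 0"
  shows "twist F r (- 1 / (of_nat (N * r\<^sup>2) * w)) = x r * (of_real (sqrt (real N)) * of_nat r * w) ^ k * twist G r w"
proof -
  define z where "z = - 1 / (of_nat (N * r\<^sup>2) * w)"
  have w0: "w \<noteq> 0" using w by auto
  have z: "Im z > 0" using Im_neg_inverse_pos[of "real (N * r\<^sup>2)" w] w N r by (simp add: z_def)
  have 1: "- 1 / (of_nat (N * r\<^sup>2) * z) = w" using w0 N r by (simp add: z_def)
  have 2: "of_real (sqrt (real N)) * of_nat r * z = - 1 / (of_real (sqrt (real N)) * of_nat r * w)"
    using w0 N r sqrtN(1)[of 1] sqrtN(2) by (simp add: z_def field_simps power2_eq_square)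
  have 3: "(-1) ^ k / (- 1 / y) ^ k = y ^ k" if "y \<noteq> 0" for y :: complex
    unfolding power_divide[symmetric] using that by simp
  have "of_real (sqrt (real N)) * of_nat r * w \<noteq> 0" using w0 r sqrtN(2) by simp
  note 3 = 3[OF this]
  have "twist F r z = ((-1) ^ k / (- 1 / (of_real (sqrt (real N)) * of_nat r * w)) ^ k) * x r * twist G r w"
    using fe[OF r z] unfolding 1 2 by simp
  then show ?thesis unfolding 3 z_def by (simp add: mult_ac)
qed

lemma twist_1: "twist h 1 z = h (z + 1)"
  by (simp add: twist_def )

lemma G_eq_fricke:
  assumes w: "Im w > 0"
  shows "G w = fricke N k F w"
proof -
  have w0: "w \<noteq> 0" using w by auto
  have u: "Im (- 1 / (of_nat N * w)) > 0" using Im_neg_inverse_pos[of "real N" w] w N by simp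
  have "F (- 1 / (of_nat N * w)) = (of_real (sqrt (real N)) * w) ^ k * G w"
    using fe_reversed[of 1 w] w unfolding twist_1 using F_periodic[OF u] G_periodic[OF w] x1 by simp
  then show ?thesis unfolding fricke_def using w0 sqrtN(2) by simp
qed

text \<open>W carries \<open>Umat (int N)\<close> to translation by -1, so the period of G becomes
  this invariance of F.\<close>

lemma F_Umat:
  assumes z: "Im z > 0"
  shows "slash k F (Umat (int N)) z = F z"
proof -
  have Ff: "F v = (-1) ^ k / (of_real (sqrt (real N)) * v) ^ k * G (- 1 / (of_nat N * v))" if v: "Im v > 0" for v
  proof -
    have "Im (- 1 / (of_nat N * v)) > 0" using Im_neg_inverse_pos[of "real N" v] v N by simp
    note p = G_periodic[OF this]
    have "F (v + 1) = (-1) ^ k / (of_real (sqrt (real N)) * v) ^ k * G (- 1 / (of_nat N * v) + 1)"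
      using fe[of 1 v] v x1 unfolding twist_1 by simp
    then show ?thesis unfolding p F_periodic[OF v] .
  qed
  have z0: "z \<noteq> 0" using z by auto
  have a0: "aut (Umat (int N)) z \<noteq> 0" by (rule aut_nonzero[OF TU_SL2Z(2) z])
  have m: "moeb (Umat (int N)) z = z / aut (Umat (int N)) z" by (simp add: moeb_def Umat_def)
  have mp: "Im (z / aut (Umat (int N)) z) > 0" using Im_moeb_pos[OF TU_SL2Z(2) z, of "int N"] unfolding m .
  have v: "Im (- 1 / (of_nat N * z)) > 0" using Im_neg_inverse_pos[of "real N" z] z N by simp
  have "- 1 / (of_nat N * (z / aut (Umat (int N)) z)) = - 1 / (of_nat N * z) + of_int (- 1)"
    using z0 N by (simp add: aut_def Umat_def field_simps)
  then have "G (- 1 / (of_nat N * (z / aut (Umat (int N)) z))) = G (- 1 / (of_nat N * z))"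
    using periodic_int[where h = G and j = "- 1", OF G_periodic v] by simp
  then have "F (z / aut (Umat (int N)) z) = (-1) ^ k / (of_real (sqrt (real N)) * (z / aut (Umat (int N)) z)) ^ k * G (- 1 / (of_nat N * z))"
    using Ff[OF mp] by simp
  then show ?thesis unfolding slash_eq[OF TU_SL2Z(2)] m Ff[OF z]
    using a0 z0 sqrtN(2) by (simp add: power_mult_distrib power_divide)
qed

text \<open>\<open>\<gamma>\<close> maps \<open>-1/(N(w + c/q))\<close> to \<open>-1/(Nq\<^sup>2w) + a/q\<close>.\<close>
lemma F_translate:
  assumes \<gamma>: "\<gamma> \<in> SL2Z" "mb \<gamma> = int a" "mc \<gamma> = int N * c" "md \<gamma> = int q" and q: "q \<ge> 1" and w: "Im w > 0"
    and sl: "\<And>u. Im u > 0 \<Longrightarrow> slash k F \<gamma> u = y * F' u"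
  shows "F (- 1 / (of_nat (N * q\<^sup>2) * w) + of_nat a / of_nat q)
     = (of_real (sqrt (real N)) * of_nat q * w) ^ k * (y * fricke N k F' (w + of_int c / of_nat q))"
proof -
  define v where "v = w + of_int c / of_nat q"
  define u where "u = - 1 / (of_nat N * v)"
  have v: "Im v > 0" using w by (simp add: v_def)
  have nz: "w \<noteq> 0" "v \<noteq> 0" "(of_nat N :: complex) \<noteq> 0" "(of_nat q :: complex) \<noteq> 0" using w v N q by auto
  have u: "Im u > 0" using Im_neg_inverse_pos[of "real N" v] v N by (simp add: u_def)
  have cq: "of_int c = of_nat q * (v - w)" using nz by (simp add: v_def)
  have au: "aut \<gamma> u = of_nat q * w / v"
    unfolding aut_def \<gamma> u_def using nz by (simp add: cq field_simps)
  have det: "of_int (ma \<gamma>) * of_nat q = 1 + of_nat a * (of_nat N * complex_of_int c)"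
  proof -
    have "ma \<gamma> * int q = 1 + int a * (int N * c)" using \<gamma> by (simp add: SL2Z_iff)
    then have "complex_of_int (ma \<gamma> * int q) = of_int (1 + int a * (int N * c))" by (rule arg_cong)
    then show ?thesis by simp
  qed
  have "moeb \<gamma> u = - 1 / (of_nat (N * q\<^sup>2) * w) + of_nat a / of_nat q"
  proof -
    have A: "of_int (ma \<gamma>) = (1 + of_nat a * (of_nat N * complex_of_int c)) / of_nat q" using det nz by (simp add: field_simps)
    show ?thesis unfolding moeb_def au unfolding \<gamma> A u_def cq using nz
      by (simp add: field_simps power2_eq_square)
  qed
  then have "F (- 1 / (of_nat (N * q\<^sup>2) * w) + of_nat a / of_nat q) = slash k F \<gamma> u * aut \<gamma> u ^ k"
    using aut_nonzero[OF \<gamma>(1) u] by (simp add: slash_eq[OF \<gamma>(1)])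
  also have "\<dots> = y * F' u * (of_nat q * w / v) ^ k" by (simp add: sl[OF u] au)
  also have "\<dots> = (of_real (sqrt (real N)) * of_nat q * w) ^ k * (y * fricke N k F' v)"
    unfolding fricke_def u_def[symmetric] using nz sqrtN(2) by (simp add: power_mult_distrib power_divide)
  finally show ?thesis by (simp add: v_def)
qed

text \<open>The determinant equation read modulo q; it supplies the hypothesis of
  \<open>unit_reindex\<close>.\<close>

lemma lower_left_entry_inverse:
  assumes "\<gamma> \<in> SL2Z \<and> mb \<gamma> = int a \<and> mc \<gamma> = int N * c \<and> md \<gamma> = int q"
  shows "int q dvd int N * int a * c + 1"
proof -
  have "ma \<gamma> * int q - int a * (int N * c) = 1" using assms unfolding SL2Z_iff by metis
  then have "int N * int a * c + 1 = ma \<gamma> * int q" by (simp add: algebra_simps)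
  then show ?thesis by simp
qed

text \<open>Each summand of the reversed equation is rewritten by \<open>F_translate\<close>, and
  the common factor (sqrt N q w)^k cancels. The shape \<open>y a * F' u\<close> serves two uses: F'
  = F with unknown scalars, and one common F' with all scalars 1.\<close>

lemma family_relation:
  assumes q: "q \<ge> 1" "coprime q N"
    and \<gamma>: "\<And>a. a \<in> totatives q \<Longrightarrow> \<gamma> a \<in> SL2Z \<and> mb (\<gamma> a) = int a \<and> mc (\<gamma> a) = int N * c a \<and> md (\<gamma> a) = int q"
    and sl: "\<And>a u. a \<in> totatives q \<Longrightarrow> Im u > 0 \<Longrightarrow> slash k F (\<gamma> a) u = y a * F' u"
    and w: "Im w > 0"
  shows "(\<Sum>a\<in>totatives q. y a * fricke N k F' (w + of_int (c a) / of_nat q)) = x q * (\<Sum>a\<in>totatives q. G (w + of_int (c a) / of_nat q))"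
proof -
  have c: "int q dvd int N * int a * c a + 1" if "a \<in> totatives q" for a
    by (rule lower_left_entry_inverse[OF \<gamma>[OF that]])
  have ur: "(\<Sum>b\<in>totatives q. G (w + of_nat b / of_nat q)) = (\<Sum>a\<in>totatives q. G (w + of_int (c a) / of_nat q))"
    by (rule unit_reindex[where h = G and N = N and c = c, OF q(1) c G_periodic w])
  let ?P = "(of_real (sqrt (real N)) * of_nat q * w) ^ k"
  have "?P * (\<Sum>a\<in>totatives q. y a * fricke N k F' (w + of_int (c a) / of_nat q)) = twist F q (- 1 / (of_nat (N * q\<^sup>2) * w))"
    unfolding twist_def sum_distrib_left using F_translate \<gamma> sl q w by (intro sum.cong refl) (metis)
  also have "\<dots> = ?P * (x q * (\<Sum>a\<in>totatives q. G (w + of_int (c a) / of_nat q)))"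
    unfolding fe_reversed[OF q w] unfolding twist_def ur by (simp only: mult_ac)
  finally show ?thesis using w q sqrtN(2) by auto
qed

lemma exists_family_member:
  assumes "q \<ge> 1" "coprime q N" "a \<in> totatives q"
  shows "\<exists>\<gamma> c. \<gamma> \<in> SL2Z \<and> mb \<gamma> = int a \<and> mc \<gamma> = int N * c \<and> md \<gamma> = int q"
proof -
  have "coprime (int N * int a) (int q)" using assms by (simp add: totatives_def coprime_commute)
  then obtain c where "[int N * int a * c = 1] (mod int q)" using cong_solve_coprime_int by metis
  then have "int q dvd int N * int a * (- c) + 1" by (simp add: cong_iff_dvd_diff) (metis dvd_minus_iff minus_diff_eq diff_conv_add_uminus add.commute)
  then obtain A where "int N * int a * (- c) + 1 = int q * A" by (elim dvdE)
  then have "mk A (int a) (int N * (- c)) (int q) \<in> SL2Z" by (simp add: SL2Z_iff algebra_simps)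
  then show ?thesis by (intro exI[of _ "mk A (int a) (int N * (- c)) (int q)"] exI[of _ "- c"]) simp
qed

lemma exists_family:
  assumes "q \<ge> 1" "coprime q N"
  obtains \<gamma> c where "\<And>a. a \<in> totatives q \<Longrightarrow> \<gamma> a \<in> SL2Z \<and> mb (\<gamma> a) = int a \<and> mc (\<gamma> a) = int N * c a \<and> md (\<gamma> a) = int q"
  using exists_family_member[OF assms] by metis

lemma slash_scalar_Tmat: "slash_scalar k F (Tmat j) 1"
  using periodic_int[where h = F and j = j, OF F_periodic] by (simp add: slash_scalar_def slash_Tmat)

end

text \<open>Modulo a prime only one class is missing from the units, so the sum over all translates
  by j/p equals h. That sum has period 1/p, hence so has h, and the hypothesis becomes (p - 1) h =
  0.\<close>

lemma periodic_totatives_sum_zero: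
  assumes p: "prime p" and h: "\<And>z. Im z > 0 \<Longrightarrow> h (z + 1) = (h z :: complex)"
    and s: "\<And>z. Im z > 0 \<Longrightarrow> (\<Sum>a\<in>totatives p. h (z + of_nat a / of_nat p)) = 0" and w: "Im w > 0"
  shows "h w = 0"
proof -
  have p1: "p > 1" using p by (rule prime_gt_1_nat)
  have units: "totatives p = {1..<p}" using p by (auto simp: totatives_prime)
  have S: "(\<Sum>j\<in>{1..p}. h (z + of_nat j / of_nat p)) = h z" if "Im z > 0" for z
  proof -
    have "{1..p} = insert p {1..<p}" using p1 by auto
    then have "(\<Sum>j\<in>{1..p}. h (z + of_nat j / of_nat p)) = h (z + 1) + (\<Sum>a\<in>totatives p. h (z + of_nat a / of_nat p))"
      using p1 by (simp add: units)
    then show ?thesis using s h that by simp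
  qed
  have step: "h (z + 1 / of_nat p) = h z" if z: "Im z > 0" for z
  proof -
    have "h (z + 1 / of_nat p) = (\<Sum>j\<in>{1..p}. h ((z + 1 / of_nat p) + of_nat j / of_nat p))" using z by (intro S[symmetric]) simp
    also have "\<dots> = (\<Sum>j\<in>{1..p}. h (z + (of_int 1 + of_nat j) / of_nat p))"
      by (intro sum.cong refl arg_cong[of _ _ h]) (simp add: add_divide_distrib)
    also have "\<dots> = (\<Sum>j\<in>{1..p}. h (z + of_nat j / of_nat p))"
      using p1 by (intro sum_translates_shift h z) auto
    also have "\<dots> = h z" by (rule S[OF z])
    finally show ?thesis .
  qed
  have all: "h (w + of_nat j / of_nat p) = h w" for j
  proof (induction j)
    case (Suc j)
    have "w + of_nat (Suc j) / of_nat p = (w + of_nat j / of_nat p) + 1 / of_nat p" by (simp add: add_divide_distrib)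
    then have "h (w + of_nat (Suc j) / of_nat p) = h ((w + of_nat j / of_nat p) + 1 / of_nat p)" by (simp only:)
    also have "\<dots> = h (w + of_nat j / of_nat p)" by (rule step) (use w in simp)
    finally show ?case using Suc by (simp only:)
  qed simp
  have "of_nat (p - 1) * h w = 0" using s[OF w] by (simp add: all units)
  then show ?thesis using p1 by simp
qed

context twist_fe
begin

text \<open>Averaging the relation over all translates by \<open>j / q\<close> turns it into a statement about the sum of the scalars
  \<open>y a\<close> alone, and \<open>|y a| = 1\<close> then forces \<open>y a = 1\<close>.\<close>
lemma character_trivial:
  assumes ch: "\<And>\<gamma>. \<gamma> \<in> SL2Z \<Longrightarrow> int N dvd mc \<gamma> \<Longrightarrow> md \<gamma> mod int N = 1 mod int N \<Longrightarrow> \<exists>y. norm y = 1 \<and> slash_scalar k F \<gamma> y"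
    and q: "q \<ge> 1" "coprime q N" "int q mod int N = 1 mod int N" "x q = 1"
    and nz: "Im w > 0" "(\<Sum>j\<in>{1..q}. G (w + of_nat j / of_nat q)) \<noteq> 0"
    and \<gamma>0: "\<gamma>0 \<in> SL2Z" "int N dvd mc \<gamma>0" "md \<gamma>0 = int q" and z: "Im z > 0"
  shows "slash k F \<gamma>0 z = F z"
proof -
  have adb: "ma \<gamma>0 * int q - mb \<gamma>0 * mc \<gamma>0 = 1" using \<gamma>0 by (simp add: SL2Z_iff)
  \<comment> \<open>Left multiplication by T^i brings the upper right entry into 1..q without
    changing the lower row; the result can then serve as the family member of index a0.\<close>
  define a0 where "a0 = nat ((mb \<gamma>0 - 1) mod int q) + 1"
  define i where "i = - ((mb \<gamma>0 - 1) div int q)"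
  have a0: "int a0 = mb \<gamma>0 + i * int q"
  proof -
    have "int a0 = (mb \<gamma>0 - 1) mod int q + 1" using q(1) by (simp add: a0_def)
    moreover have "(mb \<gamma>0 - 1) div int q * int q + (mb \<gamma>0 - 1) mod int q = mb \<gamma>0 - 1"
      by (rule div_mult_mod_eq)
    ultimately show ?thesis by (simp only: i_def mult_minus_left)
  qed
  have a0u: "a0 \<in> totatives q"
  proof -
    have "(mb \<gamma>0 - 1) mod int q < int q" using q by simp
    then have "1 \<le> a0" "a0 \<le> q" using q by (auto simp: a0_def nat_less_iff Suc_le_eq)
    moreover have "coprime (int a0) (int q)"
    proof (rule coprimeI)
      fix l assume l: "l dvd int a0" "l dvd int q"
      then have "l dvd mb \<gamma>0" unfolding a0 by (simp add: dvd_add_left_iff)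
      then have "l dvd ma \<gamma>0 * int q - mb \<gamma>0 * mc \<gamma>0" using l by (intro dvd_diff dvd_mult dvd_mult2)
      then show "is_unit l" unfolding adb .
    qed
    ultimately show ?thesis by (simp add: totatives_def)
  qed
  define \<gamma>1 where "\<gamma>1 = Tmat i ** \<gamma>0"
  obtain c0 where c0: "mc \<gamma>0 = int N * c0" using \<gamma>0(2) by (elim dvdE)
  have \<gamma>1: "\<gamma>1 \<in> SL2Z" "mb \<gamma>1 = int a0" "mc \<gamma>1 = int N * c0" "md \<gamma>1 = int q"
    using \<gamma>0 a0 c0 SL2Z_mult[OF TU_SL2Z(1) \<gamma>0(1)] by (auto simp: \<gamma>1_def Tmat_def)
  obtain \<beta> d where p: "\<And>a. a \<in> totatives q \<Longrightarrow> \<beta> a \<in> SL2Z \<and> mb (\<beta> a) = int a \<and> mc (\<beta> a) = int N * d a \<and> md (\<beta> a) = int q"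
    using exists_family[OF q(1,2)] by metis
  \<comment> \<open>Any family satisfies the relation, so the given matrix is placed at index
    a0.\<close>
  define \<gamma> where "\<gamma> = (\<lambda>a. if a = a0 then \<gamma>1 else \<beta> a)"
  define c where "c = (\<lambda>a. if a = a0 then c0 else d a)"
  have \<gamma>: "\<gamma> a \<in> SL2Z \<and> mb (\<gamma> a) = int a \<and> mc (\<gamma> a) = int N * c a \<and> md (\<gamma> a) = int q" if "a \<in> totatives q" for a
    using p[OF that] \<gamma>1 by (simp add: \<gamma>_def c_def)
  have "\<exists>y. norm y = 1 \<and> slash_scalar k F (\<gamma> a) y" if "a \<in> totatives q" for a
    using \<gamma>[OF that] q(3) by (intro ch) auto
  then obtain y where y: "\<And>a. a \<in> totatives q \<Longrightarrow> norm (y a) = 1 \<and> slash_scalar k F (\<gamma> a) (y a)" by metis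
  have Gf: "fricke N k F (w + of_int c / of_nat q) = G (w + of_int c / of_nat q)" if "Im w > 0" for w c
    using that by (intro G_eq_fricke[symmetric]) simp
  have rel: "(\<Sum>a\<in>totatives q. (y a - 1) * G (w + of_int (c a) / of_nat q)) = 0" if w: "Im w > 0" for w
  proof -
    have "(\<Sum>a\<in>totatives q. y a * fricke N k F (w + of_int (c a) / of_nat q)) = x q * (\<Sum>a\<in>totatives q. G (w + of_int (c a) / of_nat q))"
      by (rule family_relation[where \<gamma> = \<gamma>, OF q(1,2) \<gamma> _ w]) (use y in \<open>auto simp: slash_scalar_def\<close>)
    then show ?thesis using q(4) by (simp add: Gf[OF w] left_diff_distrib sum_subtractf)
  qed
  define U where "U = (\<Sum>j\<in>{1..q}. G (w + of_nat j / of_nat q))"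
  have "0 = (\<Sum>j\<in>{1..q}. \<Sum>a\<in>totatives q. (y a - 1) * G ((w + of_nat j / of_nat q) + of_int (c a) / of_nat q))"
    using nz(1) by (intro sum.neutral[symmetric] ballI rel) simp
  also have "\<dots> = (\<Sum>a\<in>totatives q. \<Sum>j\<in>{1..q}. (y a - 1) * G ((w + of_nat j / of_nat q) + of_int (c a) / of_nat q))"
    by (rule sum.swap)
  also have "\<dots> = (\<Sum>a\<in>totatives q. (y a - 1) * U)"
  proof (rule sum.cong[OF refl])
    fix a
    have "U = (\<Sum>j\<in>{1..q}. G (w + (of_int (c a) + of_nat j) / of_nat q))"
      unfolding U_def by (rule sum_translates_shift[where h = G, OF G_periodic nz(1) q(1), symmetric])
    also have "\<dots> = (\<Sum>j\<in>{1..q}. G ((w + of_nat j / of_nat q) + of_int (c a) / of_nat q))"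
      by (intro sum.cong refl arg_cong[of _ _ G]) (simp add: add_divide_distrib)
    finally show "(\<Sum>j\<in>{1..q}. (y a - 1) * G ((w + of_nat j / of_nat q) + of_int (c a) / of_nat q)) = (y a - 1) * U"
      by (simp only: sum_distrib_left)
  qed
  finally have "(\<Sum>a\<in>totatives q. y a - 1) * U = 0" by (simp only: sum_distrib_right)
  then have S: "(\<Sum>a\<in>totatives q. y a - 1) = 0" using nz(2) unfolding U_def by simp
  have "y a0 = 1"
    by (rule unit_modulus_sum_eq_card[OF _ _ S a0u]) (use y in auto)
  then have s1: "slash_scalar k F \<gamma>1 1" using y[OF a0u] by (simp add: \<gamma>_def)
  from slash_scalar_mult[OF slash_scalar_Tmat s1] have "slash_scalar k F (Tmat (- i) ** \<gamma>1) 1" by simp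
  moreover have "Tmat (- i) ** \<gamma>1 = \<gamma>0" by (auto intro!: imat_eqI simp: \<gamma>1_def Tmat_def)
  ultimately show ?thesis using z by (simp add: slash_scalar_def)
qed

lemma Gamma1_invariant:
  assumes ch: "\<And>\<gamma>. \<gamma> \<in> SL2Z \<Longrightarrow> int N dvd mc \<gamma> \<Longrightarrow> md \<gamma> mod int N = 1 mod int N \<Longrightarrow> \<exists>y. norm y = 1 \<and> slash_scalar k F \<gamma> y"
    and x: "\<And>q. q \<ge> 1 \<Longrightarrow> int q mod int N = 1 mod int N \<Longrightarrow> x q = 1"
    and nz: "\<And>q. squarefree q \<Longrightarrow> coprime q N \<Longrightarrow> \<exists>w. Im w > 0 \<and> (\<Sum>j\<in>{1..q}. G (w + of_nat j / of_nat q)) \<noteq> 0"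
    and \<gamma>: "\<gamma> \<in> SL2Z" "int N dvd mc \<gamma>" "md \<gamma> mod int N = 1 mod int N"
  shows "slash_scalar k F \<gamma> 1"
proof -
  have main: "slash_scalar k F \<gamma> 1" if \<gamma>: "\<gamma> \<in> SL2Z" "int N dvd mc \<gamma>" "md \<gamma> mod int N = 1 mod int N" and c: "mc \<gamma> \<noteq> 0" for \<gamma>
  proof -
    \<comment> \<open>Right multiplication by T^i adds i times the lower left entry c to the lower
      right entry d; a squarefree q is therefore sought in the class of d modulo |c|.\<close>
    define m where "m = nat \<bar>mc \<gamma>\<bar>"
    have m: "m > 0" "int m = \<bar>mc \<gamma>\<bar>" using c by (auto simp: m_def)
    define r where "r = nat (md \<gamma> mod int m)"
    have r: "int r = md \<gamma> mod int m" using m by (simp add: r_def)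
    have "coprime (md \<gamma>) (int m)" using SL2Z_coprime[OF \<gamma>(1)] unfolding m by (simp add: coprime_commute)
    then have "coprime (int r) (int m)" unfolding r using m(1) by simp
    then have "coprime r m" by simp
    then obtain j where j: "squarefree (r + m * j)" using squarefree_in_progression m by blast
    define q where "q = r + m * j"
    have "md \<gamma> = int m * (md \<gamma> div int m) + int r" unfolding r by simp
    then have "int q = md \<gamma> + int m * (int j - md \<gamma> div int m)" by (simp add: q_def algebra_simps)
    moreover have "int m = mc \<gamma> * sgn (mc \<gamma>)" unfolding m by (simp add: abs_sgn)
    ultimately obtain i where i: "int q = md \<gamma> + mc \<gamma> * i" by (metis mult.assoc)
    define \<gamma>' where "\<gamma>' = \<gamma> ** Tmat i"
    have g': "\<gamma>' \<in> SL2Z" "int N dvd mc \<gamma>'" "md \<gamma>' = int q"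
      using \<gamma> SL2Z_mult[OF \<gamma>(1) TU_SL2Z(1)] i by (auto simp: \<gamma>'_def Tmat_def add.commute)
    have q1: "q \<ge> 1" using j unfolding q_def[symmetric] by (cases q) auto
    have qN: "int q mod int N = 1 mod int N"
    proof -
      have "int q mod int N = (md \<gamma> mod int N + (mc \<gamma> * i) mod int N) mod int N" unfolding i by (simp add: mod_add_eq)
      also have "(mc \<gamma> * i) mod int N = 0" using \<gamma>(2) by (simp add: mod_eq_0_iff_dvd)
      finally show ?thesis using \<gamma>(3) by simp
    qed
    have cop: "coprime q N"
    proof -
      have "[int q = 1] (mod int N)" using qN by (simp add: cong_def)
      then have "coprime (int q) (int N)" by (metis cong_imp_coprime cong_sym coprime_1_left)
      then show ?thesis by simp
    qed
    obtain w where w: "Im w > 0" "(\<Sum>j\<in>{1..q}. G (w + of_nat j / of_nat q)) \<noteq> 0"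
      using nz[OF j[folded q_def] cop] by blast
    have "slash k F \<gamma>' z = F z" if "Im z > 0" for z
      by (rule character_trivial[OF ch q1 cop qN x[OF q1 qN] w g' that])
    then have s1: "slash_scalar k F \<gamma>' 1" using g'(1) by (simp add: slash_scalar_def)
    from slash_scalar_mult[OF s1 slash_scalar_Tmat] have "slash_scalar k F (\<gamma>' ** Tmat (- i)) 1" by simp
    moreover have "\<gamma>' ** Tmat (- i) = \<gamma>" by (auto intro!: imat_eqI simp: \<gamma>'_def Tmat_def)
    ultimately show ?thesis by simp
  qed
  show ?thesis
  proof (cases "mc \<gamma> = 0")
    case False
    then show ?thesis using main \<gamma> by blast
  next
    \<comment> \<open>With lower left entry 0 there is no progression to search; multiplication by U
      makes that entry N d, which is nonzero.\<close>
    case True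
    have s1: "slash_scalar k F (\<gamma> ** Umat (int N)) 1"
    proof (rule main)
      have "md \<gamma> \<noteq> 0" using \<gamma>(1) True by (auto simp: SL2Z_iff)
      then show "mc (\<gamma> ** Umat (int N)) \<noteq> 0" using N True by (simp add: Umat_def)
    qed (use \<gamma> True SL2Z_mult[OF \<gamma>(1) TU_SL2Z(2)] in \<open>auto simp: Umat_def\<close>)
    have "slash_scalar k F (Umat (int N)) 1" using F_Umat by (simp add: slash_scalar_def)
    from slash_scalar_mult[OF s1 slash_scalar_inv[OF this]]
    have "slash_scalar k F (\<gamma> ** Umat (int N) ** sl2_inv (Umat (int N))) 1" by simp
    moreover have "\<gamma> ** Umat (int N) ** sl2_inv (Umat (int N)) = \<gamma>" by (auto intro!: imat_eqI simp: Umat_def)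
    ultimately show ?thesis by simp
  qed
qed

text \<open>All F|\<gamma>_a equal one F', since \<gamma>_a \<gamma>_1^(-1) is in \<Gamma>_1(N); F'
  is invariant under U, since \<gamma>_1 U \<gamma>_1^(-1) is as well. So the difference h of the
  Fricke transform of F' and x(p) G has period 1, its sums over the units vanish by
  \<open>family_relation\<close>, and \<open>periodic_totatives_sum_zero\<close> gives F' = x(p)
  F.\<close>

lemma prime_invariant:
  assumes G1: "\<And>\<gamma>. \<gamma> \<in> SL2Z \<Longrightarrow> int N dvd mc \<gamma> \<Longrightarrow> md \<gamma> mod int N = 1 mod int N \<Longrightarrow> slash_scalar k F \<gamma> 1"
    and p: "prime p" "coprime p N"
  shows "\<exists>\<gamma>. int N dvd mc \<gamma> \<and> md \<gamma> = int p \<and> slash_scalar k F \<gamma> (x p)"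
proof -
  have p1: "p \<ge> 1" using prime_gt_0_nat[OF p(1)] by simp
  obtain \<gamma> c where \<gamma>: "\<And>a. a \<in> totatives p \<Longrightarrow> \<gamma> a \<in> SL2Z \<and> mb (\<gamma> a) = int a \<and> mc (\<gamma> a) = int N * c a \<and> md (\<gamma> a) = int p"
    using exists_family[OF p1 p(2)] by metis
  have one: "1 \<in> totatives p" using p1 by (simp add: totatives_def)
  define F' where "F' = slash k F (\<gamma> 1)"
  have sl: "slash k F (\<gamma> a) u = 1 * F' u" if a: "a \<in> totatives p" and u: "Im u > 0" for a u
  proof -
    define \<delta> where "\<delta> = \<gamma> a ** sl2_inv (\<gamma> 1)"
    have gs: "\<gamma> a \<in> SL2Z" "\<gamma> 1 \<in> SL2Z" using \<gamma> a one by auto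
    have d: "\<delta> \<in> SL2Z" unfolding \<delta>_def by (intro SL2Z_mult SL2Z_inv gs)
    have "ma (\<gamma> 1) * int p = 1 + int 1 * (int N * c 1)" using gs(2) \<gamma>[OF one] unfolding SL2Z_iff by (metis add.commute diff_add_cancel)
    then have md: "md \<delta> = 1 + int N * (c 1 - c a)" using \<gamma>[OF a] \<gamma>[OF one] by (simp add: \<delta>_def algebra_simps)
    have "slash_scalar k F \<delta> 1"
    proof (rule G1[OF d])
      show "int N dvd mc \<delta>" using \<gamma>[OF a] \<gamma>[OF one] by (simp add: \<delta>_def)
      show "md \<delta> mod int N = 1 mod int N" unfolding md by simp
    qed
    then have dF: "slash k F \<delta> z = F z" if "Im z > 0" for z using that by (simp add: slash_scalar_def)
    have "\<delta> ** \<gamma> 1 = \<gamma> a" unfolding \<delta>_def using mult_sl2_inv(2)[OF gs(2)] by (simp flip: matrix_mul_assoc)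
    then have "slash k F (\<gamma> a) u = slash k (slash k F \<delta>) (\<gamma> 1) u" using slash_mult[OF d gs(2) u, of k F] by simp
    also have "\<dots> = F' u" unfolding F'_def by (rule slash_cong[OF gs(2) u dF])
    finally show ?thesis by simp
  qed
  have gs: "\<gamma> 1 \<in> SL2Z" using \<gamma>[OF one] by simp
  have F'U: "slash k F' (Umat (int N)) z = F' z" if z: "Im z > 0" for z
  proof -
    define \<delta> where "\<delta> = \<gamma> 1 ** Umat (int N) ** sl2_inv (\<gamma> 1)"
    have d: "\<delta> \<in> SL2Z" unfolding \<delta>_def by (intro SL2Z_mult SL2Z_inv gs TU_SL2Z)
    have "ma (\<gamma> 1) * md (\<gamma> 1) - mb (\<gamma> 1) * mc (\<gamma> 1) = 1" using gs by (simp add: SL2Z_iff)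
    then have md: "md \<delta> = 1 + int N * (- (md (\<gamma> 1) * mb (\<gamma> 1)))" by (simp add: \<delta>_def Umat_def algebra_simps)
    have "slash_scalar k F \<delta> 1"
    proof (rule G1[OF d])
      show "int N dvd mc \<delta>" using \<gamma>[OF one] by (simp add: \<delta>_def Umat_def algebra_simps)
      show "md \<delta> mod int N = 1 mod int N" unfolding md by (simp only: mod_mult_self2)
    qed
    then have dF: "slash k F \<delta> z = F z" if "Im z > 0" for z using that by (simp add: slash_scalar_def)
    have "\<delta> ** \<gamma> 1 = \<gamma> 1 ** Umat (int N)" unfolding \<delta>_def using mult_sl2_inv(2)[OF gs] by (simp flip: matrix_mul_assoc)
    then have "slash k F' (Umat (int N)) z = slash k F (\<delta> ** \<gamma> 1) z"
      unfolding F'_def using slash_mult[OF gs TU_SL2Z(2) z, of k F "int N"] by simp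
    also have "\<dots> = slash k (slash k F \<delta>) (\<gamma> 1) z" by (rule slash_mult[OF d gs z])
    also have "\<dots> = F' z" unfolding F'_def by (rule slash_cong[OF gs z dF])
    finally show ?thesis .
  qed
  define h where "h = (\<lambda>w. fricke N k F' w - x p * G w)"
  have hper: "h (w + 1) = h w" if "Im w > 0" for w
    unfolding h_def using fricke_periodic[OF N F'U that] G_periodic[OF that] by simp
  have cdiv: "int p dvd int N * int a * c a + 1" if "a \<in> totatives p" for a
    by (rule lower_left_entry_inverse[OF \<gamma>[OF that]])
  have hsum: "(\<Sum>a\<in>totatives p. h (w + of_nat a / of_nat p)) = 0" if w: "Im w > 0" for w
  proof -
    have "(\<Sum>a\<in>totatives p. h (w + of_nat a / of_nat p)) = (\<Sum>a\<in>totatives p. h (w + of_int (c a) / of_nat p))"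
      by (rule unit_reindex[where h = h and N = N and c = c, OF p1 cdiv hper w])
    also have "\<dots> = (\<Sum>a\<in>totatives p. 1 * fricke N k F' (w + of_int (c a) / of_nat p)) - x p * (\<Sum>a\<in>totatives p. G (w + of_int (c a) / of_nat p))"
      by (simp add: h_def sum_subtractf sum_distrib_left)
    also have "\<dots> = 0"
      using family_relation[where \<gamma> = \<gamma> and y = "\<lambda>_. 1", OF p1 p(2) \<gamma> sl w] by simp
    finally show ?thesis .
  qed
  have "F' u = x p * F u" if u: "Im u > 0" for u
  proof -
    define w where "w = - 1 / (of_nat N * u)"
    have w: "Im w > 0" using Im_neg_inverse_pos[of "real N" u] u N by (simp add: w_def)
    have u0: "u \<noteq> 0" using u by auto
    have uw: "- 1 / (of_nat N * w) = u" using N u0 by (simp add: w_def)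
    have "h w = 0" by (rule periodic_totatives_sum_zero[OF p(1) hper hsum w])
    then have "fricke N k F' w = x p * fricke N k F w" using G_eq_fricke[OF w] by (simp add: h_def)
    moreover have "w \<noteq> 0" using w by auto
    ultimately show ?thesis unfolding fricke_def uw using sqrtN(2) by simp
  qed
  then show ?thesis using \<gamma>[OF one] gs by (intro exI[of _ "\<gamma> 1"]) (simp add: slash_scalar_def F'_def)
qed

text \<open>The prime factors of n give matrices acting by x(p). Their product \<delta> acts by x(n)
  and has lower right entry n modulo N, so \<gamma> \<delta>^(-1) lies in \<Gamma>_1(N).\<close>

lemma Gamma0_scalar:
  assumes G1: "\<And>\<gamma>. \<gamma> \<in> SL2Z \<Longrightarrow> int N dvd mc \<gamma> \<Longrightarrow> md \<gamma> mod int N = 1 mod int N \<Longrightarrow> slash_scalar k F \<gamma> 1"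
    and xm: "\<And>m n. x (m * n) = x m * x n"
    and \<gamma>: "\<gamma> \<in> SL2Z" "int N dvd mc \<gamma>" and n: "n \<ge> 1" "int n mod int N = md \<gamma> mod int N"
  shows "slash_scalar k F \<gamma> (x n)"
proof -
  have ex: "\<exists>\<delta>. int N dvd mc \<delta> \<and> md \<delta> mod int N = int n mod int N \<and> slash_scalar k F \<delta> (x n)"
    if "n \<ge> 1" "coprime n N" for n
    using that
  proof (induction n rule: less_induct)
    case (less n)
    show ?case
    proof (cases "n = 1")
      case True
      have "slash_scalar k F (mk 1 0 0 1) 1" by (simp add: slash_scalar_def slash_id SL2Z_iff)
      then show ?thesis using True x1 by (intro exI[of _ "mk 1 0 0 1"]) simp
    next
      case False
      then obtain p where p: "prime p" "p dvd n" using prime_factor_nat by blast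
      then obtain m where m: "n = p * m" by (elim dvdE)
      have cop: "coprime p N" "coprime m N" using less.prems m by simp_all
      have m1: "m \<ge> 1" using less.prems(1) m by (cases m) auto
      have "1 * m < p * m" using m1 prime_gt_1_nat[OF p(1)] by (intro mult_strict_right_mono) auto
      then have "m < n" by (simp add: m)
      with m1 obtain \<delta> where d: "int N dvd mc \<delta>" "md \<delta> mod int N = int m mod int N" "slash_scalar k F \<delta> (x m)"
        using less.IH cop by blast
      obtain \<epsilon> where e: "int N dvd mc \<epsilon>" "md \<epsilon> = int p" "slash_scalar k F \<epsilon> (x p)"
        using prime_invariant[OF G1 p(1) cop(1)] by blast
      have "slash_scalar k F (\<epsilon> ** \<delta>) (x n)" using slash_scalar_mult[OF e(3) d(3)] by (simp add: m xm)
      moreover have "int N dvd mc (\<epsilon> ** \<delta>)" using e d by simp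
      moreover have "md (\<epsilon> ** \<delta>) mod int N = int n mod int N"
      proof -
        have "[mc \<epsilon> * mb \<delta> + md \<epsilon> * md \<delta> = 0 + int p * int m] (mod int N)"
          by (intro cong_add cong_mult) (use e d in \<open>auto simp: cong_def mod_eq_0_iff_dvd\<close>)
        then show ?thesis by (simp add: cong_def m)
      qed
      ultimately show ?thesis by blast
    qed
  qed
  have "coprime (md \<gamma>) (int N)"
    using coprime_divisors[OF \<gamma>(2) dvd_refl SL2Z_coprime[OF \<gamma>(1)]] by (simp add: coprime_commute)
  then have "coprime (int n) (int N)" using n(2) by (metis cong_def cong_imp_coprime)
  then have "coprime n N" by simp
  then obtain \<delta> where d: "int N dvd mc \<delta>" "md \<delta> mod int N = int n mod int N" "slash_scalar k F \<delta> (x n)"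
    using ex n by blast
  have dS: "\<delta> \<in> SL2Z" using d by (simp add: slash_scalar_def)
  define \<epsilon> where "\<epsilon> = \<gamma> ** sl2_inv \<delta>"
  have "slash_scalar k F \<epsilon> 1"
  proof (rule G1)
    show "\<epsilon> \<in> SL2Z" unfolding \<epsilon>_def by (intro SL2Z_mult SL2Z_inv \<gamma> dS)
    show "int N dvd mc \<epsilon>" using \<gamma>(2) d(1) by (simp add: \<epsilon>_def)
    have 1: "ma \<delta> * md \<delta> - mb \<delta> * mc \<delta> = 1" using dS by (simp add: SL2Z_iff)
    have "[md \<epsilon> = 0 + ma \<delta> * md \<delta>] (mod int N)"
    proof -
      have "[mc \<gamma> * (- mb \<delta>) + md \<gamma> * ma \<delta> = 0 + md \<delta> * ma \<delta>] (mod int N)"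
        by (intro cong_add cong_mult) (use \<gamma>(2) d n in \<open>auto simp: cong_def mod_eq_0_iff_dvd\<close>)
      then show ?thesis by (simp add: \<epsilon>_def mult.commute)
    qed
    also have "0 + ma \<delta> * md \<delta> = 1 + mb \<delta> * mc \<delta>" using 1 by simp
    also have "[1 + mb \<delta> * mc \<delta> = 1 + 0] (mod int N)"
      by (intro cong_add) (use d in \<open>auto simp: cong_def mod_eq_0_iff_dvd\<close>)
    finally show "md \<epsilon> mod int N = 1 mod int N" by (simp add: cong_def)
  qed
  from slash_scalar_mult[OF this d(3)] have "slash_scalar k F (\<epsilon> ** \<delta>) (x n)" by simp
  moreover have "\<epsilon> ** \<delta> = \<gamma>" unfolding \<epsilon>_def using mult_sl2_inv(2)[OF dS] by (simp flip: matrix_mul_assoc)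
  ultimately show ?thesis by simp
qed

end

subsection \<open>Growth at the cusps\<close>

text \<open>Phragmen-Lindelof for polynomial growth: h is divided by (1 - i \<epsilon> z)^(m+1),
  whose modulus on Im z \<ge> 1 is at least 1 and at least (\<epsilon>|z|)^(m+1). The quotient is at
  most B on the frontier of a large box, and then \<epsilon> tends to 0.\<close>

lemma half_plane_bounded:
  assumes h: "h holomorphic_on upper_half_plane" and B: "B > 0"
    and edge: "\<And>z. Im z = 1 \<Longrightarrow> norm (h z) \<le> B"
    and growth: "\<And>z. Im z \<ge> 1 \<Longrightarrow> norm (h z) \<le> D * (1 + norm z) ^ m" and z: "Im z \<ge> 1"
  shows "norm (h z) \<le> B"
proof -
  have "D * (1 + norm \<i>) ^ m \<ge> 0" using order_trans[OF norm_ge_zero growth[of "\<i>"]] by simp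
  then have D: "D \<ge> 0" by (auto simp: zero_le_mult_iff power_le_zero_eq)
  have key: "norm (h z) \<le> B * norm (1 - \<i> * of_real \<epsilon> * z) ^ (m + 1)" if \<epsilon>: "\<epsilon> > 0" for \<epsilon>
  proof -
    define k where "k = (\<lambda>z. (1 - \<i> * of_real \<epsilon> * z) ^ (m + 1))"
    have big: "norm (1 - \<i> * of_real \<epsilon> * z) \<ge> 1" "norm (1 - \<i> * of_real \<epsilon> * z) \<ge> \<epsilon> * norm z" if "Im z \<ge> 1" for z
    proof -
      have "1 \<le> Re (1 - \<i> * of_real \<epsilon> * z)" using that \<epsilon> by simp
      then show "norm (1 - \<i> * of_real \<epsilon> * z) \<ge> 1" using complex_Re_le_cmod order_trans by blast
      have "(\<epsilon> * norm z)\<^sup>2 = (\<epsilon> * Im z)\<^sup>2 + (\<epsilon> * Re z)\<^sup>2" by (simp add: power_mult_distrib cmod_power2 algebra_simps)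
      also have "\<dots> \<le> (1 + \<epsilon> * Im z)\<^sup>2 + (\<epsilon> * Re z)\<^sup>2" using that \<epsilon> by (intro add_right_mono power_mono) auto
      also have "\<dots> = (norm (1 - \<i> * of_real \<epsilon> * z))\<^sup>2" by (simp add: cmod_power2)
      finally show "norm (1 - \<i> * of_real \<epsilon> * z) \<ge> \<epsilon> * norm z" by (rule power2_le_imp_le) simp
    qed
    have nk: "norm (k z) \<ge> 1" "norm (k z) \<ge> (\<epsilon> * norm z) ^ (m + 1)" if "Im z \<ge> 1" for z
      using big[OF that] \<epsilon> unfolding k_def norm_power by (auto intro: one_le_power power_mono simp del: power_Suc add_Suc_right)
    \<comment> \<open>For |z| \<ge> 1 the quotient is at most E/|z|, hence at most B beyond the
      radius 1 + E/B.\<close>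
    define E where "E = D * 2 ^ m / \<epsilon> ^ (m + 1)"
    have E: "E \<ge> 0" using D \<epsilon> by (simp add: E_def)
    have far: "norm (h z / k z) \<le> B" if z1: "Im z \<ge> 1" and zE: "norm z \<ge> 1 + E / B" for z
    proof -
      have n1: "norm z \<ge> 1" using zE E B by (smt (verit) divide_nonneg_pos)
      have "norm (h z / k z) \<le> (D * (1 + norm z) ^ m) / (\<epsilon> * norm z) ^ (m + 1)"
        unfolding norm_divide
        by (intro frac_le zero_less_power mult_pos_pos mult_nonneg_nonneg zero_le_power growth nk z1 D) (use n1 \<epsilon> in auto)
      also have "\<dots> \<le> (D * (2 * norm z) ^ m) / (\<epsilon> * norm z) ^ (m + 1)"
        using n1 D \<epsilon> by (intro divide_right_mono mult_left_mono power_mono) auto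
      also have "\<dots> = E / norm z"
        using n1 \<epsilon> by (simp add: E_def power_mult_distrib field_simps)
      also have "\<dots> \<le> B"
      proof -
        have "E / B \<le> norm z" using zE by simp
        then have "E \<le> norm z * B" using B by (simp add: pos_divide_le_eq)
        moreover have "norm z > 0" using n1 by linarith
        ultimately show ?thesis by (simp add: pos_divide_le_eq mult.commute)
      qed
      finally show ?thesis .
    qed
    define R where "R = norm z + 1 + E / B"
    have R: "R \<ge> 1 + E / B" "R > norm z" "R \<ge> 1" using divide_nonneg_pos[OF E B] norm_ge_zero[of z] unfolding R_def by linarith+
    let ?S = "cbox (Complex (- R) 1) (Complex R R)"
    have sub: "?S \<subseteq> {z. Im z \<ge> 1}" by (auto simp: in_cbox_complex_iff)
    have "norm (h z / k z) \<le> B"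
    proof (rule maximum_modulus_frontier[where S = ?S and f = "\<lambda>z. h z / k z"])
      have "(\<lambda>z. h z / k z) holomorphic_on {z. Im z > 1 / 2}"
      proof (rule holomorphic_on_divide)
        show "h holomorphic_on {z. Im z > 1 / 2}" by (rule holomorphic_on_subset[OF h]) (auto simp: upper_half_plane_def)
        show "k holomorphic_on {z. Im z > 1 / 2}" unfolding k_def by (intro holomorphic_intros)
        fix z assume "z \<in> {z. Im z > 1 / 2}"
        then have "Re (1 - \<i> * of_real \<epsilon> * z) > 0" using \<epsilon> by (simp add: add_pos_pos)
        then show "k z \<noteq> 0" unfolding k_def by (metis power_eq_0_iff less_irrefl zero_complex.simps(1))
      qed
      then have hol: "(\<lambda>z. h z / k z) holomorphic_on ?S"
        by (rule holomorphic_on_subset) (use sub in force)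
      show "(\<lambda>z. h z / k z) holomorphic_on interior ?S"
        by (rule holomorphic_on_subset[OF hol interior_subset])
      show "continuous_on (closure ?S) (\<lambda>z. h z / k z)"
        using holomorphic_on_imp_continuous_on[OF hol] by simp
      show "z \<in> ?S" using z R abs_Re_le_cmod[of z] abs_Im_le_cmod[of z] by (auto simp: in_cbox_complex_iff)
      fix v assume v: "v \<in> frontier ?S"
      then have v1: "Im v \<ge> 1" by (auto simp: frontier_cbox in_cbox_complex_iff)
      have "Im v = 1 \<or> \<bar>Re v\<bar> = R \<or> Im v = R"
        using v by (auto simp: frontier_cbox in_cbox_complex_iff in_box_complex_iff)
      then consider "Im v = 1" | "norm v \<ge> R" using abs_Re_le_cmod[of v] abs_Im_le_cmod[of v] R by fastforce
      then show "norm (h v / k v) \<le> B"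
      proof cases
        case 1
        have "norm (h v) / norm (k v) \<le> B / 1" using nk[OF v1] edge[OF 1] B by (intro frac_le) auto
        then show ?thesis by (simp add: norm_divide)
      next
        case 2
        then show ?thesis using far[OF v1] R by linarith
      qed
    qed auto
    then have "norm (h z) \<le> B * norm (k z)" using nk(1)[OF z] by (simp add: norm_divide divide_le_eq split: if_splits)
    then show ?thesis by (simp only: k_def norm_power)
  qed
  have lim: "((\<lambda>\<epsilon>. B * norm (1 - \<i> * of_real \<epsilon> * z) ^ (m + 1)) \<longlongrightarrow> B * norm (1 - \<i> * of_real 0 * z) ^ (m + 1)) (at_right 0)"
    by (intro tendsto_intros)
  have "\<forall>\<^sub>F \<epsilon> in at_right 0. norm (h z) \<le> B * norm (1 - \<i> * of_real \<epsilon> * z) ^ (m + 1)"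
    by (rule eventually_mono[OF eventually_at_right_less]) (rule key)
  from tendsto_lowerbound[OF lim this trivial_limit_at_right_real]
  have "norm (h z) \<le> B * norm (1 - \<i> * of_real 0 * z) ^ (m + 1)" .
  then show ?thesis by simp
qed

text \<open>F|\<gamma> has period N because \<gamma> T^N \<gamma>^(-1) lies in \<Gamma>_1(N). So its
  polynomial growth gives boundedness on the line Im z = 1, and \<open>half_plane_bounded\<close>
  extends the bound upwards.\<close>

lemma bounded_at_cusps:
  assumes f: "poly_bounded f" and N: "N \<ge> 1"
    and G1: "\<And>\<gamma>. \<gamma> \<in> SL2Z \<Longrightarrow> int N dvd mc \<gamma> \<Longrightarrow> md \<gamma> mod int N = 1 mod int N \<Longrightarrow> slash_scalar k (qexp f) \<gamma> 1"
    and \<gamma>: "\<gamma> \<in> SL2Z"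
  shows "\<exists>C. \<forall>z. Im z \<ge> 1 \<longrightarrow> norm (slash k (qexp f) \<gamma> z) \<le> C"
proof -
  define h where "h = slash k (qexp f) \<gamma>"
  obtain p where p: "\<forall>m\<ge>p. \<exists>D\<ge>0. \<forall>z. Im z > 0 \<longrightarrow> norm (qexp f z) \<le> D * inverse (Im z) ^ m"
    using qexp_bound[OF f] by blast
  then obtain D where D: "D \<ge> 0" "\<And>z. Im z > 0 \<Longrightarrow> norm (qexp f z) \<le> D * inverse (Im z) ^ p" by blast
  define K where "K = \<bar>real_of_int (mc \<gamma>)\<bar> + \<bar>real_of_int (md \<gamma>)\<bar>"
  have growth: "norm (h z) \<le> (D * K ^ (2 * p)) * (1 + norm z) ^ (2 * p)" if z: "Im z \<ge> 1" for z
  proof -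
    have z0: "Im z > 0" using z by simp
    have a1: "norm (aut \<gamma> z) \<ge> 1"
    proof (cases "mc \<gamma> = 0")
      case True
      then have "ma \<gamma> * md \<gamma> = 1" using \<gamma> by (simp add: SL2Z_iff)
      then have "\<bar>md \<gamma>\<bar> = 1" by (auto simp: zmult_eq_1_iff)
      then have "\<bar>real_of_int (md \<gamma>)\<bar> = 1" by linarith
      then show ?thesis using True by (simp add: aut_def)
    next
      case False
      then have "1 \<le> \<bar>mc \<gamma>\<bar>" by linarith
      then have c1: "1 \<le> \<bar>real_of_int (mc \<gamma>)\<bar>" by linarith
      have "1 * 1 \<le> \<bar>real_of_int (mc \<gamma>)\<bar> * \<bar>Im z\<bar>" using c1 z by (intro mult_mono) auto
      also have "\<dots> = \<bar>Im (aut \<gamma> z)\<bar>" by (simp add: aut_def abs_mult)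
      also have "\<dots> \<le> norm (aut \<gamma> z)" by (rule abs_Im_le_cmod)
      finally show ?thesis by simp
    qed
    have a2: "norm (aut \<gamma> z) \<le> K * (1 + norm z)"
    proof -
      have "norm (aut \<gamma> z) \<le> \<bar>real_of_int (mc \<gamma>)\<bar> * norm z + \<bar>real_of_int (md \<gamma>)\<bar>"
        unfolding aut_def by (rule order_trans[OF norm_triangle_ineq]) (simp add: norm_mult)
      also have "\<dots> \<le> K * (1 + norm z)" by (simp add: K_def algebra_simps)
      finally show ?thesis .
    qed
    have "norm (h z) = norm (qexp f (moeb \<gamma> z)) / norm (aut \<gamma> z) ^ k"
      unfolding h_def slash_eq[OF \<gamma>] by (simp add: norm_divide norm_power)
    also have "\<dots> \<le> norm (qexp f (moeb \<gamma> z)) / 1"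
      by (intro frac_le one_le_power a1) auto
    also have "\<dots> \<le> D * inverse (Im (moeb \<gamma> z)) ^ p" using D(2)[OF Im_moeb_pos[OF \<gamma> z0]] by simp
    also have "inverse (Im (moeb \<gamma> z)) = (norm (aut \<gamma> z))\<^sup>2 / Im z" by (simp add: Im_moeb[OF \<gamma> z0])
    also have "D * ((norm (aut \<gamma> z))\<^sup>2 / Im z) ^ p \<le> D * ((K * (1 + norm z))\<^sup>2) ^ p"
    proof (intro mult_left_mono power_mono)
      have "(norm (aut \<gamma> z))\<^sup>2 / Im z \<le> (norm (aut \<gamma> z))\<^sup>2 / 1" using z by (intro divide_left_mono) auto
      also have "\<dots> \<le> (K * (1 + norm z))\<^sup>2" using a2 by (simp add: power_mono)
      finally show "(norm (aut \<gamma> z))\<^sup>2 / Im z \<le> (K * (1 + norm z))\<^sup>2" .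
    qed (use D z in auto)
    finally show ?thesis by (simp add: power_mult[symmetric] power_mult_distrib mult_ac)
  qed
  have per: "h (z + of_int (int N * j)) = h z" if z: "Im z > 0" for z j
  proof -
    define \<delta> where "\<delta> = \<gamma> ** Tmat (int N * j) ** sl2_inv \<gamma>"
    have d: "\<delta> \<in> SL2Z" unfolding \<delta>_def by (intro SL2Z_mult SL2Z_inv \<gamma> TU_SL2Z)
    have adb: "ma \<gamma> * md \<gamma> - mb \<gamma> * mc \<gamma> = 1" using \<gamma> by (simp add: SL2Z_iff)
    then have md: "md \<delta> = 1 + int N * (j * mc \<gamma> * ma \<gamma>)" by (simp add: \<delta>_def Tmat_def algebra_simps)
    have s: "slash_scalar k (qexp f) \<delta> 1"
    proof (rule G1[OF d])
      show "int N dvd mc \<delta>" by (simp add: \<delta>_def Tmat_def algebra_simps)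
      show "md \<delta> mod int N = 1 mod int N" unfolding md by simp
    qed
    have "\<delta> ** \<gamma> = \<gamma> ** Tmat (int N * j)" unfolding \<delta>_def using mult_sl2_inv(2)[OF \<gamma>] by (simp flip: matrix_mul_assoc)
    then have "slash k h (Tmat (int N * j)) z = slash k (qexp f) (\<delta> ** \<gamma>) z"
      unfolding h_def using slash_mult[OF \<gamma> TU_SL2Z(1) z] by simp
    also have "\<dots> = slash k (slash k (qexp f) \<delta>) \<gamma> z" by (rule slash_mult[OF d \<gamma> z])
    also have "\<dots> = h z" unfolding h_def by (rule slash_cong[OF \<gamma> z]) (use s in \<open>simp add: slash_scalar_def\<close>)
    finally show ?thesis by (simp only: slash_Tmat)
  qed
  define B where "B = (D * K ^ (2 * p)) * (1 + (real N + 1)) ^ (2 * p) + 1"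
  have DK: "D * K ^ (2 * p) \<ge> 0" using D by (simp add: K_def)
  have "norm (h z) \<le> B" if z: "Im z = 1" for z
  proof -
    define j where "j = - \<lfloor>Re z / real N\<rfloor>"
    define v where "v = z + of_int (int N * j)"
    have v: "Im v = 1" using z by (simp add: v_def)
    have "Re v = real N * (Re z / real N - of_int \<lfloor>Re z / real N\<rfloor>)" using N by (simp add: v_def j_def algebra_simps)
    moreover have "0 \<le> Re z / real N - of_int \<lfloor>Re z / real N\<rfloor>" "Re z / real N - of_int \<lfloor>Re z / real N\<rfloor> \<le> 1" by linarith+
    ultimately have "0 \<le> Re v" "Re v \<le> real N" using N by (auto simp: mult_left_le)
    then have "norm v \<le> real N + 1" using cmod_le[of v] v by simp
    then have "(D * K ^ (2 * p)) * (1 + norm v) ^ (2 * p) \<le> (D * K ^ (2 * p)) * (1 + (real N + 1)) ^ (2 * p)"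
      using DK by (intro mult_left_mono power_mono) auto
    then have "norm (h v) \<le> B" using growth[of v] v by (simp add: B_def)
    then show ?thesis using per[of z j] z by (simp add: v_def)
  qed
  moreover have "B > 0" using DK by (simp add: B_def add_nonneg_pos)
  moreover have "h holomorphic_on upper_half_plane"
    unfolding h_def by (rule holomorphic_slash[OF holomorphic_qexp[OF f] \<gamma>])
  ultimately have "norm (h z) \<le> B" if "Im z \<ge> 1" for z
    using half_plane_bounded[of h B] growth that by blast
  then show ?thesis unfolding h_def by blast
qed

section \<open>Dirichlet characters and the passage to nebentypus \<xi>\<close>

lemma dirichlet_character_facts:
  assumes "dirichlet_character N \<xi>"
  shows "\<xi> 1 = 1" "\<xi> (m * n) = \<xi> m * \<xi> n" "coprime n (int N) \<Longrightarrow> \<xi> n \<noteq> 0"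
    "m mod int N = n mod int N \<Longrightarrow> \<xi> m = \<xi> n"
proof -
  note d = assms[unfolded dirichlet_character_def]
  show mult: "\<xi> (m * n) = \<xi> m * \<xi> n" for m n using d by blast
  show nz: "\<xi> n \<noteq> 0" if "coprime n (int N)" for n using d that by blast
  show "\<xi> 1 = 1" using mult[of 1 1] nz[of 1] by simp
  have per: "\<xi> (n + int N * int j) = \<xi> n" for n j
  proof (induction j)
    case (Suc j)
    have "\<xi> (n + int N * int (Suc j)) = \<xi> ((n + int N * int j) + int N)" by (simp add: algebra_simps)
    also have "\<dots> = \<xi> (n + int N * int j)" using d by blast
    finally show ?case using Suc by simp
  qed simp
  have red: "\<xi> n = \<xi> (n mod int N)" for n
  proof (cases "n div int N \<ge> 0")
    case True
    then have "n = n mod int N + int N * int (nat (n div int N))" by simp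
    then show ?thesis using per[of "n mod int N" "nat (n div int N)"] by simp
  next
    case False
    then have "n + int N * int (nat (- (n div int N))) = n mod int N" by (simp add: minus_mult_div_eq_mod)
    then show ?thesis using per[of n "nat (- (n div int N))"] by simp
  qed
  show "\<xi> m = \<xi> n" if "m mod int N = n mod int N" using red[of m] red[of n] that by simp
qed

theorem theorem2p3:
  fixes N k :: nat and \<xi> :: "int \<Rightarrow> complex" and f g :: "nat \<Rightarrow> complex" and \<sigma> :: real
    and H :: "imat set"
  assumes "N \<ge> 1"
    and "dirichlet_character N \<xi>"
    and "k > 0"
    and "\<xi> (-1) = (-1) ^ k"
    and "\<sigma> > 0"
    and "\<exists>C. \<forall>n\<ge>1. norm (f n) \<le> C * real n powr \<sigma>"
    and "\<exists>C. \<forall>n\<ge>1. norm (g n) \<le> C * real n powr \<sigma>"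
    and "\<forall>q\<ge>1. coprime q N \<longrightarrow>
          (\<exists>F G. entire_finite_order F \<and> entire_finite_order G \<and>
             (\<forall>s. Re s > \<sigma> + 1 - (real k - 1) / 2 \<longrightarrow> F s = Lambda_tw k f q s) \<and>
             (\<forall>s. Re s > \<sigma> + 1 - (real k - 1) / 2 \<longrightarrow> G s = Lambda_tw k g q s) \<and>
             (\<forall>s. F s = \<i> ^ k * \<xi> (int q) * (of_nat (N * q\<^sup>2)) powr (1/2 - s) * G (1 - s)))"
    and "congruence_subgroup H" and "H \<subseteq> Gamma0 N"
    and "\<forall>\<gamma>\<in>H. \<forall>z\<in>upper_half_plane. norm (slash k (qexp f) \<gamma> z) = norm (qexp f z)"
  shows "modular_form k N \<xi> (qexp f)"
proof (cases "\<exists>n\<ge>1. f n \<noteq> 0")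
  \<comment> \<open>The zero sequence has no first nonzero coefficient, on which \<open>nz\<close>
    below relies.\<close>
  case False
  then have "qexp f = (\<lambda>z. 0)" by (auto simp: qexp_def)
  then show ?thesis by (auto simp: modular_form_def slash_def)
next
  case True
  note \<xi> = dirichlet_character_facts[OF assms(2)]
  have pf: "poly_bounded f" and pg: "poly_bounded g"
    using poly_boundedI_powr[OF assms(6)] poly_boundedI_powr[OF assms(7)] by auto
  interpret twist_fe N k "\<lambda>q. \<xi> (int q)" "qexp f" "qexp g"
  proof
    fix r :: nat and z :: complex
    assume r: "1 \<le> r" "coprime r N" and z: "0 < Im z"
    obtain F G where FG: "entire_finite_order F" "entire_finite_order G"
      "\<forall>s. Re s > \<sigma> + 1 - (real k - 1) / 2 \<longrightarrow> F s = Lambda_tw k f r s"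
      "\<forall>s. Re s > \<sigma> + 1 - (real k - 1) / 2 \<longrightarrow> G s = Lambda_tw k g r s"
      "\<forall>s. F s = \<i> ^ k * \<xi> (int r) * (of_nat (N * r\<^sup>2)) powr (1/2 - s) * G (1 - s)"
      using assms(8)[rule_format, OF r] by (elim exE conjE)
    show "twist (qexp f) r z = (- 1) ^ k * \<xi> (int r) / (of_real (sqrt (real N)) * of_nat r * z) ^ k *
            twist (qexp g) r (- 1 / (of_nat (N * r\<^sup>2) * z))"
      by (rule twist_functional_equation[OF assms(1) r(1) assms(3) pf pg FG[rule_format] z])
  qed (use assms(1) \<xi>(1) qexp_periodic[of _ _ 1] in auto)
  have ch: "\<exists>y. norm y = 1 \<and> slash_scalar k (qexp f) \<gamma> y"
    if "\<gamma> \<in> SL2Z" "int N dvd mc \<gamma>" "md \<gamma> mod int N = 1 mod int N" for \<gamma>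
    by (rule slash_scalar_Gamma1[OF holomorphic_qexp[OF pf] F_periodic F_Umat assms(9,11) that])
  \<comment> \<open>Here f and g exchange roles: the reversed equations express the twists of G
    through those of F with scalar (-1)^k/\<xi>(r), so a nonzero coefficient of f suffices.\<close>
  have nz: "\<exists>w. Im w > 0 \<and> (\<Sum>j\<in>{1..q}. qexp g (w + of_nat j / of_nat q)) \<noteq> 0" if q: "squarefree q" "coprime q N" for q
  proof (rule sum_translates_nonzero[where x = "\<lambda>r. (-1) ^ k / \<xi> (int r)" and F = "qexp g", OF assms(1) q(1) pf True])
    have q0: "q > 0" using q(1) by (cases q) auto
    show "(- 1) ^ k / \<xi> (int q) \<noteq> 0" using \<xi>(3) q by simp
    fix r z assume r: "r dvd q" and z: "0 < Im z"
    have r1: "r \<ge> 1" "coprime r N"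
      using dvd_pos_nat[OF q0 r] coprime_divisors[OF r dvd_refl q(2)] by simp_all
    have "\<xi> (int r) \<noteq> 0" using \<xi>(3) r1 by simp
    moreover have "of_real (sqrt (real N)) * of_nat r * z \<noteq> 0" using sqrtN(2) r1 z by auto
    ultimately show "twist (qexp g) r z = (- 1) ^ k * ((- 1) ^ k / \<xi> (int r)) / (of_real (sqrt (real N)) * of_nat r * z) ^ k *
       twist (qexp f) r (- 1 / (of_nat (N * r\<^sup>2) * z))"
      unfolding fe_reversed[OF r1 z] by simp
  qed
  have G1: "slash_scalar k (qexp f) \<gamma> 1" if "\<gamma> \<in> SL2Z" "int N dvd mc \<gamma>" "md \<gamma> mod int N = 1 mod int N" for \<gamma>
  proof (rule Gamma1_invariant[OF ch _ nz that])
    show "\<xi> (int q) = 1" if "int q mod int N = 1 mod int N" for q using \<xi>(4)[OF that] \<xi>(1) by simp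
  qed
  have "slash k (qexp f) \<gamma> z = \<xi> (md \<gamma>) * qexp f z" if \<gamma>: "\<gamma> \<in> Gamma0 N" and z: "z \<in> upper_half_plane" for \<gamma> z
  proof -
    have g: "\<gamma> \<in> SL2Z" "int N dvd mc \<gamma>" using \<gamma> by (auto simp: Gamma0_def)
    \<comment> \<open>Adding N keeps n positive when the residue is 0, which happens for N =
      1.\<close>
    define n where "n = nat (md \<gamma> mod int N) + N"
    have n: "n \<ge> 1" "int n mod int N = md \<gamma> mod int N" using assms(1) by (auto simp: n_def)
    have "slash_scalar k (qexp f) \<gamma> (\<xi> (int n))"
      by (rule Gamma0_scalar[OF G1 _ g n]) (auto simp: \<xi>(2))
    moreover have "\<xi> (int n) = \<xi> (md \<gamma>)" by (rule \<xi>(4)[OF n(2)])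
    ultimately show ?thesis using z by (simp add: slash_scalar_def upper_half_plane_def)
  qed
  then show ?thesis
    unfolding modular_form_def using holomorphic_qexp[OF pf] bounded_at_cusps[OF pf assms(1) G1] by blast
qed

end
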